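(* Let $n\ge 1$ and let $D\subset\mathbb{C}^n$ be a bounded domain with smooth boundary. Let $B_D$ be the Bergman projection of $D$, i.e. the orthogonal projection of $L^2(D)$ (with respect to Lebesgue measure $\lambda$) onto the Bergman space $A^2(D)$ of holomorphic functions in $L^2(D)$. Then $B_D$ does not extend to a bounded operator on $L^1(D)$; that is, there is no constant $C<\infty$ such that $\|B_Df\|_{L^1(D)}\le C\|f\|_{L^1(D)}$ for all $f\in L^2(D)$.
   Context: A domain is a connected open set. $D$ is smoothly bounded if there are an open neighborhood $V$ of $bD$ and $\rho\in C^\infty(V;\mathbb{R})$ with $d\rho\ne 0$ on $bD$ and $D\cap V=\{\rho<0\}$. *)

theory Defs
  imports "HOL-Analysis.Analysis"
begin

text \<open>C-infinity smoothness of a real-valued function on an open set V of a Euclidean space: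
  f is (Frechet) differentiable on V and all its partial derivatives are again smooth on V
  (coinductively, i.e. partial derivatives of all orders exist and are differentiable).\<close>
coinductive smooth_on :: "'a::euclidean_space set \<Rightarrow> ('a \<Rightarrow> real) \<Rightarrow> bool" where
  "f differentiable_on V \<Longrightarrow>
   (\<forall>b\<in>Basis. smooth_on V (\<lambda>x. frechet_derivative f (at x) b)) \<Longrightarrow> smooth_on V f"

definition smoothly_bounded :: "'a::euclidean_space set \<Rightarrow> bool" where
  "smoothly_bounded D \<longleftrightarrow>
     (\<exists>V \<rho>. open V \<and> frontier D \<subseteq> V \<and> smooth_on V \<rho> \<and>
        (\<forall>x\<in>frontier D. frechet_derivative \<rho> (at x) \<noteq> (\<lambda>v. 0)) \<and>
        D \<inter> V = {x\<in>V. \<rho> x < 0})"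

definition holomorphic_n :: "(complex^'n \<Rightarrow> complex) \<Rightarrow> (complex^'n) set \<Rightarrow> bool" where
  "holomorphic_n f U \<longleftrightarrow>
     (\<forall>z\<in>U. \<exists>L. (f has_derivative L) (at z) \<and> (\<forall>(c::complex) v. L (c *s v) = c * L v))"

definition L2_on :: "(complex^'n) set \<Rightarrow> (complex^'n \<Rightarrow> complex) \<Rightarrow> bool" where
  "L2_on D f \<longleftrightarrow> f \<in> borel_measurable (lebesgue_on D) \<and>
     set_integrable lebesgue D (\<lambda>z. (cmod (f z))\<^sup>2)"

definition bergman_space :: "(complex^'n) set \<Rightarrow> (complex^'n \<Rightarrow> complex) set" where
  "bergman_space D = {h. holomorphic_n h D \<and> L2_on D h}"

definition is_bergman_projection ::
  "(complex^'n) set \<Rightarrow> (complex^'n \<Rightarrow> complex) \<Rightarrow> (complex^'n \<Rightarrow> complex) \<Rightarrow> bool" where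
  "is_bergman_projection D f g \<longleftrightarrow> g \<in> bergman_space D \<and>
     (\<forall>h\<in>bergman_space D. (LINT z:D|lebesgue. (f z - g z) * cnj (h z)) = 0)"

end

theory Submission
  imports Defs "HOL-Complex_Analysis.Complex_Analysis"
begin

text \<open>
  Boundedness on \<open>L\<^sup>1\<close> is dual to boundedness in the supremum norm, so it suffices to find
  functions that are uniformly bounded while their Bergman projections are not. Let \<open>p\<close> be the point
  of the closure of \<open>D\<close> farthest from the origin, \<open>w z = 1 - \<langle>z, p\<rangle> / |p|\<^sup>2\<close> and \<open>h = log (\<epsilon> + w)\<close>.
  If \<open>u\<close> vanishes on the boundary of \<open>D\<close>, then its derivative \<open>\<partial>u\<close> in the holomorphic direction \<open>p\<close>
  is orthogonal to all holomorphic functions. For \<open>u = - \<chi> \<rho> h\<close>, with \<open>\<rho>\<close> a defining function and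
  \<open>\<chi>\<close> a cut-off at \<open>p\<close>, the function \<open>\<partial>u + c h\<close>, where \<open>c = d\<rho>\<^sub>p p > 0\<close>, has projection \<open>c h\<close>. It is
  bounded uniformly in \<open>\<epsilon>\<close>: \<open>\<rho> \<partial>h\<close> is bounded because \<open>D\<close> lies on one side of the hyperplane
  \<open>Re w = 0\<close>, and the coefficient of the logarithm is \<open>O(|z - p|)\<close> while \<open>|z - p|\<^sup>2 = O(|w|)\<close>. But \<open>h\<close>
  is unbounded near \<open>p\<close> as \<open>\<epsilon> \<rightarrow> 0\<close>.
\<close>

section \<open>Integration by parts for compactly supported functions\<close>

text \<open>The choice of \<open>p\<close> supplies several facts at once: \<open>w\<close> has
  positive real part on \<open>D\<close>, so the principal logarithm is holomorphic on all of
  \<open>D\<close>; and the gradient of \<open>\<rho>\<close> at \<open>p\<close> is a positive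
  multiple of \<open>p\<close>, so its component along \<open>\<i> *s p\<close> vanishes and the
  logarithm enters \<open>\<Phi>\<close> with the real coefficient \<open>- c\<close> at
  \<open>p\<close>. A logarithm is the right singularity: it is unbounded, yet any coefficient
  vanishing linearly at \<open>p\<close> absorbs it. The obstacle is the boundary of
  \<open>D\<close>, where neither surface integrals nor global regularity of \<open>u\<close> are at
  hand. Therefore \<open>- \<rho>\<close> is replaced by \<open>trunc d (- \<rho>)\<close>, which
  vanishes where \<open>- \<rho> \<le> d\<close>; every integration by parts then concerns a
  compactly supported function on the whole space. The two parameters are kept apart:
  \<open>d\<close> tends to 0 for fixed \<epsilon>, with dominating functions that may depend on
  \<epsilon>, and only the limit is estimated uniformly in \<epsilon>. Point values of
  \<open>h\<close> are read off by pairing with the projection of a bump, so the Bergman kernel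
  itself does not appear.\<close>

lemma has_derivative_directional_sequence:
  fixes u :: "'a::real_normed_vector \<Rightarrow> 'b::real_normed_vector"
  assumes "(u has_derivative u') (at x)" "t \<longlonglongrightarrow> 0" "\<And>n::nat. t n > 0"
  shows "(\<lambda>n. (u (x + t n *\<^sub>R v) - u x) /\<^sub>R t n) \<longlonglongrightarrow> u' v"
proof -
  have "(u has_derivative u') (at (x + 0 *\<^sub>R v))" using assms(1) by simp
  then have "((\<lambda>s. u (x + s *\<^sub>R v)) has_derivative (\<lambda>s. u' (s *\<^sub>R v))) (at 0)"
    by (rule has_derivative_compose[rotated]) (auto intro!: derivative_eq_intros)
  moreover have "(\<lambda>s. u' (s *\<^sub>R v)) = (\<lambda>s. s *\<^sub>R u' v)"
    using assms(1) by (simp add: has_derivative_def bounded_linear.linear linear_scale)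
  ultimately have "((\<lambda>s. u (x + s *\<^sub>R v)) has_vector_derivative u' v) (at 0)"
    by (simp add: has_vector_derivative_def)
  then have "((\<lambda>y. (1 / norm y) *\<^sub>R (u (x + y *\<^sub>R v) - (u x + y *\<^sub>R u' v))) \<longlongrightarrow> 0) (at 0)"
    unfolding has_vector_derivative_def has_derivative_within by simp
  then have "(\<lambda>n. (1 / norm (t n)) *\<^sub>R (u (x + t n *\<^sub>R v) - (u x + t n *\<^sub>R u' v))) \<longlonglongrightarrow> 0"
    by (rule filterlim_compose) (use assms(2,3) in \<open>auto simp: filterlim_at less_imp_neq[symmetric] intro!: always_eventually\<close>)
  from tendsto_add[OF this tendsto_const[of "u' v"]]
  have "(\<lambda>n. (1 / norm (t n)) *\<^sub>R (u (x + t n *\<^sub>R v) - (u x + t n *\<^sub>R u' v)) + u' v) \<longlonglongrightarrow> u' v"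
    by simp
  moreover have "(1 / norm (t n)) *\<^sub>R (u (x + t n *\<^sub>R v) - (u x + t n *\<^sub>R u' v)) + u' v
       = (u (x + t n *\<^sub>R v) - u x) /\<^sub>R t n" for n
      using assms(3)[of n] by (simp add: algebra_simps inverse_eq_divide)
  ultimately show ?thesis by simp
qed

lemma integrable_continuous_bounded_support:
  fixes u :: "'a::euclidean_space \<Rightarrow> 'b::{banach,second_countable_topology}"
  assumes "continuous_on UNIV u" "bounded K" "\<And>x. x \<notin> K \<Longrightarrow> u x = 0"
  shows "integrable lborel u"
proof -
  have "integrable lborel (\<lambda>x. indicator (closure K) x *\<^sub>R u x)"
    using assms by (intro borel_integrable_compact) (auto intro: continuous_on_subset)
  moreover have "(\<lambda>x. indicator (closure K) x *\<^sub>R u x) = u"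
    using assms(3) closure_subset[of K] by (auto simp: indicator_def fun_eq_iff)
  ultimately show ?thesis by simp
qed

lemma lborel_integral_shift:
  fixes u :: "'a::euclidean_space \<Rightarrow> 'b::{banach,second_countable_topology}"
  assumes [measurable]: "u \<in> borel_measurable borel"
  shows "integral\<^sup>L lborel (\<lambda>x. u (x + c)) = integral\<^sup>L lborel u"
    and "integrable lborel (\<lambda>x. u (x + c)) \<longleftrightarrow> integrable lborel u"
proof -
  have "integral\<^sup>L lborel u = integral\<^sup>L (distr lborel borel ((+) c)) u"
    by (simp add: lborel_distr_plus)
  also have "\<dots> = integral\<^sup>L lborel (\<lambda>x. u (x + c))"
    by (subst integral_distr) (auto simp: add.commute)
  finally show "integral\<^sup>L lborel (\<lambda>x. u (x + c)) = integral\<^sup>L lborel u" by simp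
  have "integrable (distr lborel borel ((+) c)) u \<longleftrightarrow> integrable lborel (\<lambda>x. u (x + c))"
    by (subst integrable_distr_eq) (auto simp: add.commute)
  then show "integrable lborel (\<lambda>x. u (x + c)) \<longleftrightarrow> integrable lborel u"
    by (simp add: lborel_distr_plus)
qed

lemma lipschitz_of_derivative_bound:
  fixes u :: "'a::{real_normed_vector,perfect_space} \<Rightarrow> 'b::real_normed_vector"
  assumes "convex S" "\<And>x. x \<in> S \<Longrightarrow> (u has_derivative u' x) (at x)"
    and "\<And>x v. x \<in> S \<Longrightarrow> norm (u' x v) \<le> L * norm v" "x \<in> S" "y \<in> S"
  shows "norm (u x - u y) \<le> L * norm (x - y)"
  by (rule differentiable_bound[OF \<open>convex S\<close>, where f'=u'])
     (use assms in \<open>auto intro: has_derivative_at_withinI onorm_le\<close>)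

text \<open>Each difference quotient integrates to zero by translation invariance. The quotients
  share a Lipschitz bound and a bounded support, so dominated convergence carries this over to the
  derivative.\<close>

lemma directional_derivative_integral:
  fixes u :: "'a::euclidean_space \<Rightarrow> 'b::{banach,second_countable_topology}"
  assumes der: "\<And>x. (u has_derivative u' x) (at x)"
    and bnd: "\<And>x v. norm (u' x v) \<le> L * norm v"
    and K: "bounded K" "\<And>x. x \<notin> K \<Longrightarrow> u x = 0"
  shows integrable_directional_derivative: "integrable lborel (\<lambda>x. u' x v)"
    and integral_directional_derivative: "integral\<^sup>L lborel (\<lambda>x. u' x v) = 0"
proof -
  define t where "t n = inverse (real (Suc n))" for n
  have t: "t \<longlonglongrightarrow> 0" "\<And>n. t n > 0" "\<And>n. t n \<le> 1"
    unfolding t_def using LIMSEQ_inverse_real_of_nat by (auto simp: field_simps)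
  obtain R where R: "\<And>x. x \<in> K \<Longrightarrow> norm x \<le> R"
    using K(1) by (auto simp: bounded_iff)
  have contu: "continuous_on UNIV u"
    using der by (meson continuous_at_imp_continuous_on has_derivative_continuous)
  then have [measurable]: "u \<in> borel_measurable borel"
    by (rule borel_measurable_continuous_onI)
  have intu: "integrable lborel u"
    by (rule integrable_continuous_bounded_support[OF contu K])
  define q where "q n x = (u (x + t n *\<^sub>R v) - u x) /\<^sub>R t n" for n x
  have [measurable]: "q n \<in> borel_measurable lborel" for n unfolding q_def by measurable
  have shift: "integral\<^sup>L lborel (\<lambda>x. u (x + c)) = integral\<^sup>L lborel u"
       "integrable lborel (\<lambda>x. u (x + c))" for c
    using lborel_integral_shift[of u c] intu by auto
  have int0: "integral\<^sup>L lborel (q n) = 0" for n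
    unfolding q_def by (simp add: shift intu)
  have lim: "(\<lambda>n. q n x) \<longlonglongrightarrow> u' x v" for x
    unfolding q_def by (rule has_derivative_directional_sequence[OF der t(1)]) (rule t(2))
  have [measurable]: "(\<lambda>x. u' x v) \<in> borel_measurable lborel"
    by (rule borel_measurable_LIMSEQ_metric[OF _ lim]) measurable
  \<comment> \<open>All shifts have length at most \<open>norm v\<close> because
    \<open>t n \<le> 1\<close>, so one ball contains the supports of all quotients.\<close>
  define w :: "'a \<Rightarrow> real" where "w x = indicator (cball 0 (R + norm v)) x *\<^sub>R (L * norm v)" for x
  have w: "integrable lborel w"
    unfolding w_def by (intro borel_integrable_compact) auto
  have bq: "norm (q n x) \<le> w x" for n x
  proof (cases "x \<in> cball 0 (R + norm v)")
    case True
    have "norm (u (x + t n *\<^sub>R v) - u x) \<le> L * norm (x + t n *\<^sub>R v - x)"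
      by (rule lipschitz_of_derivative_bound[of UNIV _ u']) (auto simp: der bnd)
    moreover have "norm (q n x) = norm (u (x + t n *\<^sub>R v) - u x) / t n"
      using t(2)[of n] unfolding q_def by (simp add: divide_inverse mult.commute)
    ultimately have "norm (q n x) \<le> L * norm v"
      using t(2)[of n] by (simp add: pos_divide_le_eq mult_ac)
    then show ?thesis using True by (simp add: w_def)
  next
    case False
    then have "norm x > R + norm v" by (simp)
    moreover have "norm x \<le> norm (x + t n *\<^sub>R v) + norm (t n *\<^sub>R v)"
      by (metis add_diff_cancel_right' norm_triangle_ineq4)
    moreover have "norm (t n *\<^sub>R v) \<le> norm v"
      using t(2,3)[of n] by (simp add: mult_left_le_one_le)
    ultimately have "norm (x + t n *\<^sub>R v) > R" "norm x > R"
      using norm_ge_zero[of v] by linarith+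
    then have "x + t n *\<^sub>R v \<notin> K" "x \<notin> K" using R by force+
    then show ?thesis using False by (simp add: q_def w_def K)
  qed
  show "integrable lborel (\<lambda>x. u' x v)"
    by (rule integrable_dominated_convergence[OF _ _ w, of _ q]) (auto simp: lim bq)
  have "(\<lambda>n. integral\<^sup>L lborel (q n)) \<longlonglongrightarrow> integral\<^sup>L lborel (\<lambda>x. u' x v)"
    by (rule integral_dominated_convergence[OF _ _ w]) (auto simp: lim bq)
  then show "integral\<^sup>L lborel (\<lambda>x. u' x v) = 0"
    by (simp add: int0 LIMSEQ_const_iff)
qed

section \<open>Complex directions, Cauchy estimates and compactly supported products\<close>

lemma norm_cscale: "norm (c *s v) = cmod c * norm (v :: complex^'n)"
  by (simp add: norm_vec_def L2_set_def norm_mult power_mult_distrib flip: sum_distrib_left)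
     (simp add: real_sqrt_mult)

text \<open>Multiplication by \<i> is skew for the real inner product. This makes the field
  \<open>\<i> *s w\<close> both tangent to spheres and divergence free.\<close>

lemma inner_i_cscale_self [simp]: "(\<i> *s w) \<bullet> w = 0" "w \<bullet> (\<i> *s w) = 0" for w :: "complex^'n"
  by (simp_all add: inner_vec_def inner_complex_def mult.commute)

lemma bounded_linear_cscale_left: "bounded_linear (\<lambda>c. c *s (v :: complex^'n))"
  by (rule bounded_linear_intro[where K="norm v"])
     (simp_all add: norm_cscale vec_eq_iff algebra_simps)

lemma bounded_linear_cscale_right: "bounded_linear (\<lambda>v. c *s (v :: complex^'n))"
  by (rule bounded_linear_intro[where K="cmod c"])
     (simp_all add: norm_cscale vec_eq_iff algebra_simps)

lemma holomorphic_n_frechet: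
  assumes "holomorphic_n h U" "z \<in> U"
  shows "(h has_derivative frechet_derivative h (at z)) (at z)"
    and "frechet_derivative h (at z) (c *s v) = c * frechet_derivative h (at z) v"
proof -
  obtain L where L: "(h has_derivative L) (at z)" "\<And>c v. L (c *s v) = c * L v"
    using assms unfolding holomorphic_n_def by metis
  then have "L = frechet_derivative h (at z)" by (simp add: frechet_derivative_at)
  then show "(h has_derivative frechet_derivative h (at z)) (at z)"
    "frechet_derivative h (at z) (c *s v) = c * frechet_derivative h (at z) v"
    using L by auto
qed

lemma holomorphic_n_continuous_on: "holomorphic_n h U \<Longrightarrow> continuous_on U h"
  by (meson continuous_at_imp_continuous_on has_derivative_continuous holomorphic_n_frechet(1))

lemma holomorphic_n_line:
  assumes "holomorphic_n h U" "z + c *s v \<in> U"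
  shows "((\<lambda>c. h (z + c *s v)) has_field_derivative frechet_derivative h (at (z + c *s v)) v) (at c)"
proof -
  have "((\<lambda>c. z + c *s v) has_derivative (\<lambda>c. c *s v)) (at c)"
    using bounded_linear_imp_has_derivative[OF bounded_linear_cscale_left, of v "at c"]
    by (auto intro!: derivative_eq_intros)
  from has_derivative_compose[OF this holomorphic_n_frechet(1)[OF assms]]
  show ?thesis
    by (simp add: has_field_derivative_def holomorphic_n_frechet(2)[OF assms] mult.commute[of _ "frechet_derivative h (at (z + c *s v)) v"])
qed

text \<open>The definition of holomorphy does not include continuity of the derivative; the bound
  comes from Cauchy's inequality on the discs \<open>x + c *s v\<close>. The radius
  \<open>e / norm v\<close> moves \<open>x\<close> by at most \<open>e\<close>, which keeps all
  discs in the compact set \<open>S\<close>, and it turns the estimate \<open>B / r\<close> into one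
  that is linear in \<open>norm v\<close>.\<close>

lemma holomorphic_n_derivative_bound:
  fixes h :: "complex^'n \<Rightarrow> complex"
  assumes "open U" and hol: "holomorphic_n h U" and "compact K" "K \<subseteq> U"
  obtains L where "L \<ge> 0" "\<And>x v. x \<in> K \<Longrightarrow> cmod (frechet_derivative h (at x) v) \<le> L * norm v"
proof -
  obtain e where e: "e > 0" "(\<Union>x\<in>K. cball x e) \<subseteq> U"
    using compact_subset_open_imp_cball_epsilon_subset[OF assms(3,1,4)] by blast
  define S where "S = {x + y | x y. x \<in> K \<and> y \<in> cball 0 e}"
  have "compact S" unfolding S_def by (rule compact_sums[OF \<open>compact K\<close> compact_cball])
  have "S \<subseteq> U"
  proof
    fix z assume "z \<in> S"
    then obtain x y where "x \<in> K" "norm y \<le> e" "z = x + y" by (auto simp: S_def)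
    then have "z \<in> cball x e" by (simp add: dist_norm)
    then show "z \<in> U" using e(2) \<open>x \<in> K\<close> by blast
  qed
  have "compact (h ` S)"
    by (rule compact_continuous_image[OF continuous_on_subset[OF holomorphic_n_continuous_on[OF hol] \<open>S \<subseteq> U\<close>] \<open>compact S\<close>])
  then obtain B where B: "B > 0" "\<And>z. z \<in> S \<Longrightarrow> cmod (h z) \<le> B"
    unfolding compact_eq_bounded_closed bounded_pos by blast
  show ?thesis
  proof (rule that[of "B / e"])
    show "B / e \<ge> 0" using B(1) e(1) by simp
    fix x v assume "x \<in> K"
    show "cmod (frechet_derivative h (at x) v) \<le> B / e * norm v"
    proof (cases "v = 0")
      case True
      have "linear (frechet_derivative h (at x))"
        using holomorphic_n_frechet(1)[OF hol] \<open>x \<in> K\<close> \<open>K \<subseteq> U\<close> by (blast intro: has_derivative_linear)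
      then show ?thesis using True by (simp add: linear_0)
    next
      case False
      define r where "r = e / norm v"
      have r: "r > 0" using False e(1) by (simp add: r_def)
      have inS: "x + c *s v \<in> S" if "cmod c \<le> r" for c
      proof -
        have "norm (c *s v) \<le> r * norm v" unfolding norm_cscale by (intro mult_right_mono that) simp
        then have "c *s v \<in> cball 0 e" using False by (simp add: r_def)
        then show ?thesis unfolding S_def using \<open>x \<in> K\<close> by blast
      qed
      have der: "((\<lambda>c. h (x + c *s v)) has_field_derivative frechet_derivative h (at (x + c *s v)) v) (at c)"
        if "cmod c \<le> r" for c
        by (rule holomorphic_n_line[OF hol]) (use inS[OF that] \<open>S \<subseteq> U\<close> in blast)
      have "norm ((deriv ^^ 1) (\<lambda>c. h (x + c *s v)) 0) \<le> fact 1 * B / r ^ 1"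
      proof (rule Cauchy_inequality)
        show "(\<lambda>c. h (x + c *s v)) holomorphic_on ball 0 r"
          unfolding holomorphic_on_def field_differentiable_def
          by (auto intro!: exI has_field_derivative_at_within[OF der])
        show "continuous_on (cball 0 r) (\<lambda>c. h (x + c *s v))"
          by (rule DERIV_continuous_on, rule has_field_derivative_at_within, rule der) simp
        show "cmod (h (x + c *s v)) \<le> B" if "cmod (0 - c) = r" for c
          by (intro B(2) inS) (use that in simp)
      qed (use r in auto)
      moreover have "deriv (\<lambda>c. h (x + c *s v)) 0 = frechet_derivative h (at x) v"
        using der[of 0] r by (simp add: DERIV_imp_deriv)
      ultimately show ?thesis by (simp add: r_def)
    qed
  qed
qed

lemma has_derivative_zero_off_support:
  assumes "(A has_derivative A') (at x)" "closed K" "x \<notin> K" "\<And>x. x \<notin> K \<Longrightarrow> A x = 0"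
  shows "A' = (\<lambda>v. 0)"
proof -
  have "((\<lambda>x. 0) has_derivative A') (at x)"
    by (rule has_derivative_transform_within_open[OF assms(1), of "- K"]) (use assms in auto)
  then show ?thesis using has_derivative_unique[OF _ has_derivative_const] by blast
qed

text \<open>\<open>F\<close> may be arbitrary off \<open>K\<close>: there the product vanishes on an
  open set, which settles the remaining points.\<close>

lemma has_derivative_mult_compact_support:
  fixes A F :: "'a::real_normed_vector \<Rightarrow> complex"
  assumes A: "\<And>x. (A has_derivative A' x) (at x)" "\<And>x. x \<notin> K \<Longrightarrow> A x = 0" "closed K"
    and F: "\<And>x. x \<in> K \<Longrightarrow> (F has_derivative F' x) (at x)"
  shows "((\<lambda>x. A x * F x) has_derivative (\<lambda>v. A x * F' x v + A' x v * F x)) (at x)"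
proof (cases "x \<in> K")
  case True
  then show ?thesis by (intro has_derivative_mult A F)
next
  case False
  have "A' x = (\<lambda>v. 0)" by (rule has_derivative_zero_off_support[OF A(1) A(3) False A(2)])
  moreover have "((\<lambda>x. A x * F x) has_derivative (\<lambda>v. 0)) (at x)"
    by (rule has_derivative_transform_within_open[OF has_derivative_const, of "- K" x 0])
       (use A False in auto)
  ultimately show ?thesis using A(2)[OF False] by simp
qed

text \<open>The product has compact support and a bounded derivative, so its directional derivative
  integrates to zero. Bounds for \<open>A\<close> and \<open>F\<close> themselves come from
  continuity on the compact set \<open>K\<close>.\<close>

lemma integration_by_parts_compact_support:
  fixes A F :: "'a::euclidean_space \<Rightarrow> complex"
  assumes A: "\<And>x. (A has_derivative A' x) (at x)" "\<And>x. x \<notin> K \<Longrightarrow> A x = 0"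
    and K: "compact K"
    and A': "\<And>x v. x \<in> K \<Longrightarrow> cmod (A' x v) \<le> L * norm v"
    and F: "\<And>x. x \<in> K \<Longrightarrow> (F has_derivative F' x) (at x)"
    and F': "\<And>x v. x \<in> K \<Longrightarrow> cmod (F' x v) \<le> L' * norm v"
  shows "integrable lborel (\<lambda>x. A x * F' x v + A' x v * F x)" (is ?thesis1)
    and "integral\<^sup>L lborel (\<lambda>x. A x * F' x v + A' x v * F x) = 0" (is ?thesis2)
proof -
  note der = has_derivative_mult_compact_support[OF A compact_imp_closed[OF K] F]
  have "continuous_on K A" "continuous_on K F"
    using A(1) F by (meson continuous_at_imp_continuous_on has_derivative_continuous)+
  then have "bounded (A ` K)" "bounded (F ` K)"
    by (auto intro!: compact_imp_bounded compact_continuous_image K)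
  then obtain a b where ab: "\<And>x. x \<in> K \<Longrightarrow> cmod (A x) \<le> a" "\<And>x. x \<in> K \<Longrightarrow> cmod (F x) \<le> b"
    unfolding bounded_iff by blast
  define C where "C = \<bar>a\<bar> * \<bar>L'\<bar> + \<bar>L\<bar> * \<bar>b\<bar>"
  have bound: "cmod (A x * F' x v + A' x v * F x) \<le> C * norm v" for x v
  proof (cases "x \<in> K")
    case True
    have "cmod (A x * F' x v + A' x v * F x) \<le> cmod (A x) * cmod (F' x v) + cmod (A' x v) * cmod (F x)"
      by (metis norm_mult norm_triangle_ineq)
    also have "\<dots> \<le> \<bar>a\<bar> * (\<bar>L'\<bar> * norm v) + (\<bar>L\<bar> * norm v) * \<bar>b\<bar>"
    proof (intro add_mono mult_mono)
      show "cmod (F' x v) \<le> \<bar>L'\<bar> * norm v" "cmod (A' x v) \<le> \<bar>L\<bar> * norm v"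
        using F'[OF True, of v] A'[OF True, of v]
          mult_right_mono[OF abs_ge_self[of L'] norm_ge_zero[of v]]
          mult_right_mono[OF abs_ge_self[of L] norm_ge_zero[of v]] by linarith+
      show "cmod (A x) \<le> \<bar>a\<bar>" "cmod (F x) \<le> \<bar>b\<bar>" using ab[OF True] by auto
    qed auto
    finally show ?thesis by (simp add: C_def algebra_simps)
  next
    case False
    have "A' x = (\<lambda>v. 0)"
      by (rule has_derivative_zero_off_support[OF A(1) compact_imp_closed[OF K] False A(2)])
    then show ?thesis using A(2)[OF False] by (simp add: C_def)
  qed
  show ?thesis1
    by (rule integrable_directional_derivative[OF der bound compact_imp_bounded[OF K]])
       (use A in auto)
  show ?thesis2
    by (rule integral_directional_derivative[OF der bound compact_imp_bounded[OF K]])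
       (use A in auto)
qed

section \<open>The mean value property for holomorphic functions of several variables\<close>

lemma has_real_derivative_pos_part_square:
  "((\<lambda>s::real. (max 0 s)\<^sup>2) has_real_derivative 2 * max 0 s) (at s)"
proof -
  consider "s > 0" | "s < 0" | "s = 0" by linarith
  then show ?thesis
  proof cases
    case 1
    have "((\<lambda>s::real. s\<^sup>2) has_real_derivative 2 * max 0 s) (at s)"
      using 1 by (auto intro!: derivative_eq_intros)
    then show ?thesis
      by (rule has_field_derivative_transform_within_open[where S="{0<..}"]) (use 1 in auto)
  next
    case 2
    have "((\<lambda>s::real. 0) has_real_derivative 2 * max 0 s) (at s)"
      using 2 by (auto intro!: derivative_eq_intros)
    then show ?thesis
      by (rule has_field_derivative_transform_within_open[where S="{..<0}"]) (use 2 in auto)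
  next
    case 3
    have "((\<lambda>h::real. (max 0 h)\<^sup>2 / h) \<longlongrightarrow> 0) (at 0)"
    proof (rule Lim_null_comparison)
      show "\<forall>\<^sub>F h in at 0. norm ((max 0 h)\<^sup>2 / h) \<le> norm (h::real)"
        by (rule always_eventually) (auto simp: max_def power2_eq_square)
      show "((\<lambda>h::real. norm h) \<longlongrightarrow> 0) (at 0)"
        by (intro tendsto_norm_zero tendsto_ident_at)
    qed
    then show ?thesis using 3 by (simp add: DERIV_def)
  qed
qed

text \<open>A radial weight supported in the ball of radius \<open>r\<close>. Squaring the positive
  part makes it differentiable across the sphere, and being polynomial on its support it has the
  explicit bounds \<open>r ^ 4\<close> and \<open>4 * r ^ 3\<close> for its values and
  slopes.\<close>

definition bump :: "real \<Rightarrow> 'a::real_inner \<Rightarrow> real" where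
  "bump r w = (max 0 (r\<^sup>2 - w \<bullet> w))\<^sup>2"

definition bump_deriv :: "real \<Rightarrow> 'a::real_inner \<Rightarrow> 'a \<Rightarrow> real" where
  "bump_deriv r w v = - 4 * max 0 (r\<^sup>2 - w \<bullet> w) * (w \<bullet> v)"

lemma has_derivative_bump: "(bump r has_derivative bump_deriv r w) (at w)"
proof -
  have "((\<lambda>w. r\<^sup>2 - w \<bullet> w) has_derivative (\<lambda>v. - 2 * (w \<bullet> v))) (at w)"
    by (auto intro!: derivative_eq_intros simp: inner_commute)
  from has_derivative_compose[OF this
      has_real_derivative_pos_part_square[unfolded has_field_derivative_def]]
  show ?thesis unfolding bump_def[abs_def] bump_deriv_def[abs_def]
    by (simp add: algebra_simps)
qed

lemma continuous_on_bump: "continuous_on S (bump r)"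
  unfolding bump_def[abs_def] by (intro continuous_intros)

lemma bump_nonneg: "bump r w \<ge> 0"
  by (simp add: bump_def)

lemma bump_outside: "r \<ge> 0 \<Longrightarrow> w \<notin> cball 0 r \<Longrightarrow> bump r w = 0"
  using power_mono[of r "norm w" 2] by (simp add: bump_def power2_norm_eq_inner)

lemma bump_le: "bump r w \<le> r ^ 4"
proof -
  have "bump r w \<le> (r\<^sup>2)\<^sup>2"
    unfolding bump_def by (intro power_mono) auto
  then show ?thesis by simp
qed

lemma bump_deriv_bound:
  assumes "r \<ge> 0" shows "\<bar>bump_deriv r w v\<bar> \<le> 4 * r ^ 3 * norm v"
proof (cases "norm w \<le> r")
  case True
  have "\<bar>bump_deriv r w v\<bar> = 4 * max 0 (r\<^sup>2 - w \<bullet> w) * \<bar>w \<bullet> v\<bar>"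
    by (simp add: bump_deriv_def abs_mult)
  also have "\<dots> \<le> 4 * r\<^sup>2 * (r * norm v)"
  proof (intro mult_mono)
    show "\<bar>w \<bullet> v\<bar> \<le> r * norm v"
      using Cauchy_Schwarz_ineq2[of w v] mult_right_mono[OF True norm_ge_zero[of v]] by linarith
  qed (use assms in auto)
  also have "\<dots> = 4 * r ^ 3 * norm v" by (simp add: power_numeral_reduce)
  finally show ?thesis .
next
  case False
  then have "max 0 (r\<^sup>2 - w \<bullet> w) = 0"
    using power_mono[of r "norm w" 2] assms by (simp add: power2_norm_eq_inner)
  then show ?thesis using assms by (simp add: bump_deriv_def)
qed

lemma linear_euclidean_sum:
  fixes F :: "'a::euclidean_space \<Rightarrow> 'b::real_vector"
  assumes "linear F"
  shows "F v = (\<Sum>b\<in>Basis. (v \<bullet> b) *\<^sub>R F b)"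
proof -
  have "F v = F (\<Sum>b\<in>Basis. (v \<bullet> b) *\<^sub>R b)" by (simp add: euclidean_representation)
  also have "\<dots> = (\<Sum>b\<in>Basis. (v \<bullet> b) *\<^sub>R F b)" using assms by (simp add: linear_sum linear_scale)
  finally show ?thesis .
qed

text \<open>The field \<open>w \<mapsto> \<i> w\<close> is divergence free and tangent to spheres, so it integrates to zero
  against radial weights; complex linearity then removes the factor \<open>\<i>\<close>.\<close>
lemma bump_radial_derivative_integral:
  fixes F :: "complex^'n \<Rightarrow> complex"
  assumes r: "r \<ge> 0"
    and F: "\<And>x. x \<in> cball 0 r \<Longrightarrow> (F has_derivative F' x) (at x)"
    and lin: "\<And>x c v. x \<in> cball 0 r \<Longrightarrow> F' x (c *s v) = c * F' x v"
    and F': "\<And>x v. x \<in> cball 0 r \<Longrightarrow> cmod (F' x v) \<le> L * norm v"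
  shows "integrable lborel (\<lambda>w. bump r w *\<^sub>R F' w w)"
    and "integral\<^sup>L lborel (\<lambda>w. bump r w *\<^sub>R F' w w) = 0"
proof -
  define A where "A b w = complex_of_real ((\<i> *s w) \<bullet> b * bump r w)" for b w :: "complex^'n"
  define A' where "A' b w v = complex_of_real ((\<i> *s w) \<bullet> b * bump_deriv r w v + (\<i> *s v) \<bullet> b * bump r w)"
    for b w v :: "complex^'n"
  have derA: "(A b has_derivative A' b w) (at w)" for b w
  proof -
    have "((\<lambda>w. (\<i> *s w) \<bullet> b) has_derivative (\<lambda>v. (\<i> *s v) \<bullet> b)) (at w)"
      by (intro has_derivative_inner_left bounded_linear_imp_has_derivative bounded_linear_cscale_right)
    from has_derivative_mult[OF this has_derivative_bump]
    have "((\<lambda>w. (\<i> *s w) \<bullet> b * bump r w) has_derivative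
        (\<lambda>v. (\<i> *s w) \<bullet> b * bump_deriv r w v + (\<i> *s v) \<bullet> b * bump r w)) (at w)" .
    from has_derivative_of_real[OF this] show ?thesis unfolding A_def[abs_def] A'_def[abs_def] .
  qed
  have A0: "A b w = 0" if "w \<notin> cball 0 r" for b w
    using bump_outside[OF r that] by (simp add: A_def)
  have A'b: "cmod (A' b w v) \<le> (r * norm b * (4 * r ^ 3) + norm b * r ^ 4) * norm v"
    if "w \<in> cball 0 r" for b w v
  proof -
    have n: "\<bar>(\<i> *s x) \<bullet> b\<bar> \<le> norm x * norm b" for x :: "complex^'n"
      using Cauchy_Schwarz_ineq2[of "\<i> *s x" b] by (simp add: norm_cscale)
    have "cmod (A' b w v) \<le> \<bar>(\<i> *s w) \<bullet> b\<bar> * \<bar>bump_deriv r w v\<bar> + \<bar>(\<i> *s v) \<bullet> b\<bar> * \<bar>bump r w\<bar>"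
      unfolding A'_def norm_of_real by (metis abs_mult abs_triangle_ineq)
    also have "\<dots> \<le> (r * norm b) * (4 * r ^ 3 * norm v) + (norm v * norm b) * r ^ 4"
    proof (intro add_mono mult_mono)
      show "\<bar>(\<i> *s w) \<bullet> b\<bar> \<le> r * norm b"
        using n[of w] that mult_right_mono[of "norm w" r "norm b"] by simp
      show "\<bar>bump r w\<bar> \<le> r ^ 4" using bump_le[of r w] bump_nonneg[of r w] by simp
    qed (use r n bump_deriv_bound in auto)
    finally show ?thesis by (simp add: algebra_simps)
  qed
  note ibp = integration_by_parts_compact_support[OF derA A0 compact_cball A'b F F']
  \<comment> \<open>The sum over the basis is the divergence of \<open>F\<close> times the weighted
    field \<open>bump r w\<close> times \<open>\<i> *s w\<close>. The first terms add up to
    \<open>F'\<close> in the direction \<open>\<i> *s w\<close>; the others form the divergence of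
    the weighted field, which is zero because \<open>\<i> *s b\<close> is orthogonal to
    \<open>b\<close> and \<open>\<i> *s w\<close> to \<open>w\<close>.\<close>
  have sum_eq: "(\<Sum>b\<in>Basis. A b w * F' w b + A' b w b * F w) = \<i> * (bump r w *\<^sub>R F' w w)" for w
  proof (cases "w \<in> cball 0 r")
    case True
    have linF: "linear (F' w)" using F[OF True] by (rule has_derivative_linear)
    have "(\<Sum>b\<in>Basis. A b w * F' w b) = bump r w *\<^sub>R (\<Sum>b\<in>Basis. ((\<i> *s w) \<bullet> b) *\<^sub>R F' w b)"
      by (simp add: A_def scaleR_conv_of_real sum_distrib_left mult_ac)
    also have "\<dots> = bump r w *\<^sub>R F' w (\<i> *s w)" by (simp only: linear_euclidean_sum[OF linF, symmetric])
    also have "\<dots> = \<i> * (bump r w *\<^sub>R F' w w)" by (simp add: lin[OF True])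
    finally have 1: "(\<Sum>b\<in>Basis. A b w * F' w b) = \<i> * (bump r w *\<^sub>R F' w w)" .
    have "(\<Sum>b\<in>Basis. A' b w b) = of_real (\<Sum>b\<in>Basis. (\<i> *s w) \<bullet> b * bump_deriv r w b)"
      by (simp add: A'_def)
    also have "(\<Sum>b\<in>Basis. (\<i> *s w) \<bullet> b * bump_deriv r w b)
        = - 4 * max 0 (r\<^sup>2 - w \<bullet> w) * (\<Sum>b\<in>Basis. (\<i> *s w) \<bullet> b * (w \<bullet> b))"
      unfolding bump_deriv_def by (simp add: sum_distrib_left mult_ac flip: sum_negf)
    also have "(\<Sum>b\<in>Basis. (\<i> *s w) \<bullet> b * (w \<bullet> b)) = (\<i> *s w) \<bullet> w"
      by (rule euclidean_inner[symmetric])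
    finally have 2: "(\<Sum>b\<in>Basis. A' b w b) = 0" by simp
    show ?thesis using 1 2 by (simp add: sum.distrib flip: sum_distrib_right)
  next
    case False
    have "A' b w = (\<lambda>v. 0)" for b
      by (rule has_derivative_zero_off_support[OF derA closed_cball False A0])
    then show ?thesis using A0[OF False] bump_outside[OF r False] by simp
  qed
  have ibp1: "integrable lborel (\<lambda>w. A b w * F' w b + A' b w b * F w)" for b
    by (rule ibp(1))
  have ibp2: "integral\<^sup>L lborel (\<lambda>w. A b w * F' w b + A' b w b * F w) = 0" for b
    by (rule ibp(2))
  have 1: "integrable lborel (\<lambda>w. \<Sum>b\<in>Basis. A b w * F' w b + A' b w b * F w)"
    by (intro Bochner_Integration.integrable_sum ibp1)
  have 2: "integral\<^sup>L lborel (\<lambda>w. \<Sum>b\<in>Basis. A b w * F' w b + A' b w b * F w) = 0"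
    by (subst Bochner_Integration.integral_sum[OF ibp1]) (simp only: ibp2 sum.neutral_const)
  have eq: "bump r w *\<^sub>R F' w w = - \<i> * (\<Sum>b\<in>Basis. A b w * F' w b + A' b w b * F w)" for w
    unfolding sum_eq by (simp flip: mult.assoc)
  show "integrable lborel (\<lambda>w. bump r w *\<^sub>R F' w w)"
    unfolding eq by (rule integrable_mult_right) (rule 1)
  show "integral\<^sup>L lborel (\<lambda>w. bump r w *\<^sub>R F' w w) = 0"
    unfolding eq by (subst integral_mult_right_zero) (simp only: 2 mult_zero_right)
qed

lemma integrable_bump: "r \<ge> 0 \<Longrightarrow> integrable lborel (bump r :: 'a::euclidean_space \<Rightarrow> real)"
  by (rule integrable_continuous_bounded_support[OF continuous_on_bump bounded_cball])
     (rule bump_outside)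

lemma continuous_on_bump_scaleR:
  fixes F :: "'a::real_inner \<Rightarrow> 'b::real_normed_vector"
  assumes "r \<ge> 0" "open U" "cball 0 r \<subseteq> U" "continuous_on U F"
  shows "continuous_on UNIV (\<lambda>w. bump r w *\<^sub>R F w)"
proof -
  have "continuous_on (U \<union> - cball 0 r) (\<lambda>w. bump r w *\<^sub>R F w)"
  proof (rule continuous_on_open_Un)
    show "continuous_on U (\<lambda>w. bump r w *\<^sub>R F w)"
      by (intro continuous_on_scaleR continuous_on_bump assms)
    have "continuous_on (- cball 0 r :: 'a set) (\<lambda>w. 0 :: 'b)" by simp
    then show "continuous_on (- cball 0 r) (\<lambda>w. bump r w *\<^sub>R F w)"
      by (rule continuous_on_eq) (simp add: bump_outside[OF assms(1)])
  qed (use assms in auto)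
  moreover have "U \<union> - cball 0 r = UNIV" using assms(3) by blast
  ultimately show ?thesis by simp
qed

text \<open>The ball is contracted to its centre: the weighted integral \<open>I t\<close> of
  \<open>h (a + t *\<^sub>R w)\<close> has as derivative in \<open>t\<close> the radial integral
  that was just shown to vanish. That identity is available for positive \<open>t\<close>, and
  continuity of \<open>I\<close> reaches \<open>t = 0\<close>.\<close>

theorem holomorphic_n_mean_value_centered:
  fixes h :: "complex^'n \<Rightarrow> complex"
  assumes U: "open U" and hol: "holomorphic_n h U" and r: "r > 0" and sub: "cball a r \<subseteq> U"
  shows "integral\<^sup>L lborel (\<lambda>w. bump r w *\<^sub>R h (a + w)) = integral\<^sup>L lborel (bump r :: complex^'n \<Rightarrow> real) *\<^sub>R h a"
proof -
  let ?D = "\<lambda>x. frechet_derivative h (at x)"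
  obtain L where L: "L \<ge> 0" "\<And>x v. x \<in> cball a r \<Longrightarrow> cmod (?D x v) \<le> L * norm v"
    using holomorphic_n_derivative_bound[OF U hol compact_cball sub] by blast
  have seg: "a + t *\<^sub>R w \<in> cball a r" if "t \<in> {0..1}" "w \<in> cball 0 r" for t w
  proof -
    have "\<bar>t\<bar> * norm w \<le> 1 * r" using that by (intro mult_mono) auto
    then show ?thesis by (simp add: dist_norm)
  qed
  have Lip: "cmod (h x - h y) \<le> L * norm (x - y)" if "x \<in> cball a r" "y \<in> cball a r" for x y
    by (rule lipschitz_of_derivative_bound[OF convex_cball holomorphic_n_frechet(1)[OF hol] L(2) that])
       (use sub in auto)
  define g where "g t w = bump r w *\<^sub>R h (a + t *\<^sub>R w)" for t w
  have contg: "continuous_on UNIV (g t)" if t: "t \<in> {0..1}" for t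
    unfolding g_def[abs_def]
  proof (rule continuous_on_bump_scaleR)
    show "open ((\<lambda>w. a + t *\<^sub>R w) -` U)"
      using U by (intro open_vimage continuous_intros)
    show "cball 0 r \<subseteq> (\<lambda>w. a + t *\<^sub>R w) -` U" using seg[OF t] sub by blast
    show "continuous_on ((\<lambda>w. a + t *\<^sub>R w) -` U) (\<lambda>w. h (a + t *\<^sub>R w))"
      by (rule continuous_on_compose2[OF holomorphic_n_continuous_on[OF hol]])
         (auto intro!: continuous_intros)
  qed (use r in auto)
  have intg: "integrable lborel (g t)" if "t \<in> {0..1}" for t
    by (rule integrable_continuous_bounded_support[OF contg[OF that] bounded_cball[of 0 r]])
       (simp add: g_def bump_outside[OF less_imp_le[OF r]])
  define I where "I t = integral\<^sup>L lborel (g t)" for t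
  have intb: "integrable lborel (\<lambda>w::complex^'n. L * r * bump r w)"
    using r by (intro integrable_mult_right integrable_bump) simp
  have rad: "integrable lborel (\<lambda>w. bump r w *\<^sub>R ?D (a + t *\<^sub>R w) w)"
     "integral\<^sup>L lborel (\<lambda>w. bump r w *\<^sub>R ?D (a + t *\<^sub>R w) w) = 0" if t: "t \<in> {0<..1}" for t
  proof -
    \<comment> \<open>The derivative of \<open>h (a + t *\<^sub>R x)\<close> in \<open>x\<close>
      carries a factor \<open>t\<close> that has to be divided out again, hence the restriction to
      \<open>t > 0\<close>.\<close>
    define F' where "F' x v = ?D (a + t *\<^sub>R x) (t *\<^sub>R v)" for x v
    have t01: "t \<in> {0..1}" using t by auto
    have "a + t *\<^sub>R x \<in> U" if "x \<in> cball 0 r" for x using seg[OF t01 that] sub by blast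
    note fr = holomorphic_n_frechet[OF hol this]
    have F'eq: "F' x v = t *\<^sub>R ?D (a + t *\<^sub>R x) v" if "x \<in> cball 0 r" for x v
      unfolding F'_def using has_derivative_linear[OF fr(1)[OF that]] by (simp add: linear_scale)
    have dF: "((\<lambda>w. h (a + t *\<^sub>R w)) has_derivative F' x) (at x)" if "x \<in> cball 0 r" for x
    proof -
      have "((\<lambda>w. a + t *\<^sub>R w) has_derivative (\<lambda>v. t *\<^sub>R v)) (at x)"
        by (auto intro!: derivative_eq_intros)
      from has_derivative_compose[OF this fr(1)[OF that]]
      show ?thesis unfolding F'_def[abs_def] .
    qed
    have linF: "F' x (c *s v) = c * F' x v" if "x \<in> cball 0 r" for x c v
      by (simp add: F'eq[OF that] fr(2)[OF that])
    have bF: "cmod (F' x v) \<le> L * norm v" if "x \<in> cball 0 r" for x v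
    proof -
      have "cmod (F' x v) \<le> L * norm (t *\<^sub>R v)" unfolding F'_def by (rule L(2)[OF seg[OF t01 that]])
      also have "\<dots> \<le> L * norm v" using t L(1) by (intro mult_left_mono) (auto simp: mult_left_le_one_le)
      finally show ?thesis .
    qed
    note * = bump_radial_derivative_integral[OF less_imp_le[OF r] dF linF bF]
    have eq: "bump r w *\<^sub>R ?D (a + t *\<^sub>R w) w = (1 / t) *\<^sub>R (bump r w *\<^sub>R F' w w)" for w
      by (cases "w \<in> cball 0 r") (use bump_outside[of r w] r t F'eq in auto)
    show "integrable lborel (\<lambda>w. bump r w *\<^sub>R ?D (a + t *\<^sub>R w) w)"
      unfolding eq by (intro integrable_scaleR_right *(1))
    show "integral\<^sup>L lborel (\<lambda>w. bump r w *\<^sub>R ?D (a + t *\<^sub>R w) w) = 0"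
      unfolding eq by (subst integral_scaleR_right) (simp only: *(2) scaleR_zero_right)
  qed
  \<comment> \<open>Differentiation under the integral sign, tested along sequences. The difference
    quotient and the derivative are each at most \<open>L * r\<close>, which gives the factor 2 in
    the dominating function.\<close>
  have der0: "(I has_derivative (\<lambda>_. 0)) (at t within {0..1})" if t: "t \<in> {0<..1}" for t
    unfolding has_derivative_within tendsto_at_iff_sequentially comp_def
  proof (intro conjI allI impI)
    fix s :: "nat \<Rightarrow> real" assume s: "\<forall>i. s i \<in> {0..1} - {t}" "s \<longlonglongrightarrow> t"
    have t01: "t \<in> {0..1}" using t by auto
    have s01: "s i \<in> {0..1}" "s i \<noteq> t" for i using s(1) by auto
    define E where "E w = bump r w *\<^sub>R ?D (a + t *\<^sub>R w) w" for w
    have E: "integrable lborel E" "integral\<^sup>L lborel E = 0"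
      unfolding E_def by (rule rad[OF t])+
    define q where "q i w = (1 / norm (s i - t)) *\<^sub>R (g (s i) w - (g t w + (s i - t) *\<^sub>R E w))" for i w
    have intq: "integrable lborel (q i)" for i
      unfolding q_def
      by (intro integrable_scaleR_right Bochner_Integration.integrable_diff Bochner_Integration.integrable_add intg E t01 s01)
    have Iq: "integral\<^sup>L lborel (q i) = (1 / norm (s i - t)) *\<^sub>R (I (s i) - (I t + 0))" for i
      unfolding q_def I_def using intg[OF s01(1)] intg[OF t01] E by simp
    have "(\<lambda>i. integral\<^sup>L lborel (q i)) \<longlonglongrightarrow> integral\<^sup>L lborel (\<lambda>w::complex^'n. 0::complex)"
    proof (rule integral_dominated_convergence[where w="\<lambda>w. 2 * (L * r * bump r w)"])
      show "integrable lborel (\<lambda>w::complex^'n. 2 * (L * r * bump r w))" using intb by simp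
      show "AE w in lborel. (\<lambda>i. q i w) \<longlonglongrightarrow> 0"
      proof (rule AE_I2)
        fix w :: "complex^'n"
        show "(\<lambda>i. q i w) \<longlonglongrightarrow> 0"
        proof (cases "w \<in> cball 0 r")
          case True
          have "a + t *\<^sub>R w \<in> U" using seg[OF t01 True] sub by blast
          note fr = holomorphic_n_frechet[OF hol this]
          have "((\<lambda>t. a + t *\<^sub>R w) has_derivative (\<lambda>v. v *\<^sub>R w)) (at t within {0..1})"
            by (auto intro!: derivative_eq_intros)
          from has_derivative_compose[OF this fr(1)]
          have "((\<lambda>t. h (a + t *\<^sub>R w)) has_derivative (\<lambda>x. x *\<^sub>R ?D (a + t *\<^sub>R w) w)) (at t within {0..1})"
            using has_derivative_linear[OF fr(1)] by (simp add: linear_scale)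
          then have "(\<lambda>i. (1 / norm (s i - t)) *\<^sub>R (h (a + s i *\<^sub>R w) -
              (h (a + t *\<^sub>R w) + (s i - t) *\<^sub>R ?D (a + t *\<^sub>R w) w))) \<longlonglongrightarrow> 0"
            unfolding has_derivative_within tendsto_at_iff_sequentially comp_def using s by blast
          from tendsto_scaleR[OF tendsto_const[of "bump r w"] this]
          show ?thesis unfolding q_def g_def E_def by (simp add: algebra_simps)
        qed (use bump_outside[of r w] r in \<open>simp add: q_def g_def E_def\<close>)
      qed
      show "AE w in lborel. norm (q i w) \<le> 2 * (L * r * bump r w)" for i
      proof (rule AE_I2)
        fix w :: "complex^'n"
        show "norm (q i w) \<le> 2 * (L * r * bump r w)"
        proof (cases "w \<in> cball 0 r")
          case True
          have wr: "norm w \<le> r" using True by simp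
          have "cmod (h (a + s i *\<^sub>R w) - h (a + t *\<^sub>R w)) \<le> L * norm ((a + s i *\<^sub>R w) - (a + t *\<^sub>R w))"
            by (intro Lip seg s01 t01 True)
          also have "(a + s i *\<^sub>R w) - (a + t *\<^sub>R w) = (s i - t) *\<^sub>R w" by (simp add: algebra_simps)
          also have "L * norm ((s i - t) *\<^sub>R w) \<le> L * (\<bar>s i - t\<bar> * r)"
            using wr L(1) by (intro mult_left_mono) (auto intro: mult_left_mono)
          finally have 1: "cmod (h (a + s i *\<^sub>R w) - h (a + t *\<^sub>R w)) \<le> L * (\<bar>s i - t\<bar> * r)" .
          have "cmod (?D (a + t *\<^sub>R w) w) \<le> L * r"
            using L(2)[OF seg[OF t01 True], of w] mult_left_mono[OF wr L(1)] by linarith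
          then have 2: "cmod ((s i - t) *\<^sub>R ?D (a + t *\<^sub>R w) w) \<le> \<bar>s i - t\<bar> * (L * r)"
            by (simp add: mult_left_mono)
          let ?d = "h (a + s i *\<^sub>R w) - h (a + t *\<^sub>R w) - (s i - t) *\<^sub>R ?D (a + t *\<^sub>R w) w"
          have 3: "cmod ?d \<le> 2 * (L * r) * \<bar>s i - t\<bar>"
            using 1 2 norm_triangle_ineq4[of "h (a + s i *\<^sub>R w) - h (a + t *\<^sub>R w)" "(s i - t) *\<^sub>R ?D (a + t *\<^sub>R w) w"]
            by (simp add: algebra_simps)
          have "q i w = (bump r w / \<bar>s i - t\<bar>) *\<^sub>R ?d"
            unfolding q_def g_def E_def by (simp add: algebra_simps)
          then have "norm (q i w) = bump r w * (cmod ?d / \<bar>s i - t\<bar>)"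
            using bump_nonneg[of r w] by simp
          also have "\<dots> \<le> bump r w * (2 * (L * r))"
            using 3 s01(2)[of i] bump_nonneg[of r w] by (intro mult_left_mono) (auto simp: pos_divide_le_eq)
          finally show ?thesis by (simp add: mult_ac)
        qed (use bump_outside[of r w] r in \<open>simp add: q_def g_def E_def\<close>)
      qed
    qed (use intq in auto)
    then show "(\<lambda>i. (1 / norm (s i - t)) *\<^sub>R (I (s i) - (I t + 0))) \<longlonglongrightarrow> 0"
      unfolding Iq by simp
  qed simp
  have LipI: "cmod (I s - I t) \<le> (L * r * integral\<^sup>L lborel (bump r :: complex^'n \<Rightarrow> real)) * \<bar>s - t\<bar>"
    if st: "s \<in> {0..1}" "t \<in> {0..1}" for s t
  proof -
    have "cmod (I s - I t) = cmod (integral\<^sup>L lborel (\<lambda>w. g s w - g t w))"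
      unfolding I_def using intg st by simp
    also have "\<dots> \<le> integral\<^sup>L lborel (\<lambda>w::complex^'n. \<bar>s - t\<bar> * (L * r * bump r w))"
    proof (rule Bochner_Integration.integral_norm_bound_integral)
      show "integrable lborel (\<lambda>w. g s w - g t w)" using intg st by simp
      show "integrable lborel (\<lambda>w::complex^'n. \<bar>s - t\<bar> * (L * r * bump r w))" using intb by simp
      fix w :: "complex^'n"
      show "cmod (g s w - g t w) \<le> \<bar>s - t\<bar> * (L * r * bump r w)"
      proof (cases "w \<in> cball 0 r")
        case True
        have "cmod (h (a + s *\<^sub>R w) - h (a + t *\<^sub>R w)) \<le> L * norm ((a + s *\<^sub>R w) - (a + t *\<^sub>R w))"
          by (intro Lip seg st True)
        also have "(a + s *\<^sub>R w) - (a + t *\<^sub>R w) = (s - t) *\<^sub>R w" by (simp add: algebra_simps)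
        also have "L * norm ((s - t) *\<^sub>R w) \<le> L * (\<bar>s - t\<bar> * r)"
          using True L(1) by (intro mult_left_mono) (auto intro: mult_left_mono)
        finally have "bump r w * cmod (h (a + s *\<^sub>R w) - h (a + t *\<^sub>R w)) \<le> bump r w * (L * (\<bar>s - t\<bar> * r))"
          by (intro mult_left_mono bump_nonneg)
        moreover have "g s w - g t w = bump r w *\<^sub>R (h (a + s *\<^sub>R w) - h (a + t *\<^sub>R w))"
          by (simp add: g_def algebra_simps)
        ultimately show ?thesis using bump_nonneg[of r w] by (simp add: mult_ac)
      qed (use bump_outside[of r w] r in \<open>simp add: g_def\<close>)
    qed
    finally show ?thesis by (simp add: mult_ac)
  qed
  have contI: "continuous_on {0..1} I"
  proof (rule lipschitz_on_continuous_on)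
    show "(L * r * integral\<^sup>L lborel (bump r :: complex^'n \<Rightarrow> real))-lipschitz_on {0..1} I"
      using LipI L(1) r by (intro lipschitz_onI) (auto simp: dist_norm bump_nonneg)
  qed
  \<comment> \<open>The derivative is not known at 0; a finite exceptional set is harmless because
    \<open>I\<close> is continuous.\<close>
  have "I 1 = I 0"
    by (rule has_derivative_zero_unique_strong_interval[of "{0}" 0 1 I])
       (use contI der0 in auto)
  then have "integral\<^sup>L lborel (\<lambda>w. bump r w *\<^sub>R h (a + w)) = integral\<^sup>L lborel (\<lambda>w::complex^'n. bump r w *\<^sub>R h a)"
    by (simp add: I_def g_def[abs_def])
  also have "\<dots> = integral\<^sup>L lborel (bump r :: complex^'n \<Rightarrow> real) *\<^sub>R h a"
    by (rule integral_scaleR_left) (use r in \<open>simp add: integrable_bump\<close>)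
  finally show ?thesis .
qed

theorem holomorphic_n_mean_value:
  fixes h :: "complex^'n \<Rightarrow> complex"
  assumes "open U" "holomorphic_n h U" "r > 0" "cball a r \<subseteq> U"
  shows "integrable lborel (\<lambda>x. bump r (x - a) *\<^sub>R h x)"
    and "integral\<^sup>L lborel (\<lambda>x. bump r (x - a) *\<^sub>R h x) = integral\<^sup>L lborel (bump r :: complex^'n \<Rightarrow> real) *\<^sub>R h a"
proof -
  define u where "u w = bump r w *\<^sub>R h (a + w)" for w
  have cont: "continuous_on UNIV u"
    unfolding u_def
  proof (rule continuous_on_bump_scaleR)
    show "open ((\<lambda>w. a + w) -` U)"
      using assms(1) by (intro open_vimage continuous_intros)
    show "cball 0 r \<subseteq> (\<lambda>w. a + w) -` U" using assms(4) by (force simp: dist_norm)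
    show "continuous_on ((\<lambda>w. a + w) -` U) (\<lambda>w. h (a + w))"
      by (rule continuous_on_compose2[OF holomorphic_n_continuous_on[OF assms(2)]])
         (auto intro!: continuous_intros)
  qed (use assms in auto)
  then have u: "u \<in> borel_measurable borel" by (rule borel_measurable_continuous_onI)
  have int: "integrable lborel u"
    by (rule integrable_continuous_bounded_support[OF cont bounded_cball[of 0 r]])
       (simp add: u_def bump_outside[OF less_imp_le[OF assms(3)]])
  have mean: "integral\<^sup>L lborel u = integral\<^sup>L lborel (bump r :: complex^'n \<Rightarrow> real) *\<^sub>R h a"
    unfolding u_def by (rule holomorphic_n_mean_value_centered[OF assms])
  have "u (x + - a) = bump r (x - a) *\<^sub>R h x" for x by (simp add: u_def)
  with int show "integrable lborel (\<lambda>x. bump r (x - a) *\<^sub>R h x)"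
    "integral\<^sup>L lborel (\<lambda>x. bump r (x - a) *\<^sub>R h x) = integral\<^sup>L lborel (bump r :: complex^'n \<Rightarrow> real) *\<^sub>R h a"
    using lborel_integral_shift[OF u, of "- a"] mean by simp_all
qed

section \<open>Orthogonal projection onto the Bergman space\<close>

definition sq_integrable :: "'a measure \<Rightarrow> ('a \<Rightarrow> complex) \<Rightarrow> bool" where
  "sq_integrable M f \<longleftrightarrow> f \<in> borel_measurable M \<and> integrable M (\<lambda>x. (cmod (f x))\<^sup>2)"

lemma sq_integrableD [measurable_dest]: "sq_integrable M f \<Longrightarrow> f \<in> borel_measurable M"
  by (simp add: sq_integrable_def)

lemma sq_integrable_mult_cnj:
  assumes "sq_integrable M f" "sq_integrable M g"
  shows "integrable M (\<lambda>x. f x * cnj (g x))"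
proof (rule Bochner_Integration.integrable_bound)
  show "integrable M (\<lambda>x. (cmod (f x))\<^sup>2 + (cmod (g x))\<^sup>2)"
    using assms by (simp add: sq_integrable_def)
  have [measurable]: "f \<in> borel_measurable M" "g \<in> borel_measurable M"
    using assms by (auto simp: sq_integrable_def)
  have [measurable]: "(\<lambda>x. cnj (g x)) \<in> borel_measurable M"
    using assms(2) by (intro borel_measurable_continuous_on[OF _ sq_integrableD] continuous_intros)
  show "(\<lambda>x. f x * cnj (g x)) \<in> borel_measurable M" by measurable
  show "AE x in M. norm (f x * cnj (g x)) \<le> norm ((cmod (f x))\<^sup>2 + (cmod (g x))\<^sup>2)"
  proof (rule AE_I2)
    fix x
    have "2 * cmod (f x) * cmod (g x) \<le> (cmod (f x))\<^sup>2 + (cmod (g x))\<^sup>2"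
      by (rule sum_squares_bound)
    moreover have "0 \<le> cmod (f x) * cmod (g x)" by simp
    ultimately have "cmod (f x) * cmod (g x) \<le> (cmod (f x))\<^sup>2 + (cmod (g x))\<^sup>2" by linarith
    then show "norm (f x * cnj (g x)) \<le> norm ((cmod (f x))\<^sup>2 + (cmod (g x))\<^sup>2)"
      by (simp add: norm_mult)
  qed
qed

lemma sq_integrable_add_scaled:
  assumes "sq_integrable M f" "sq_integrable M g"
  shows "sq_integrable M (\<lambda>x. f x + c * g x)"
  unfolding sq_integrable_def
proof
  have [measurable]: "f \<in> borel_measurable M" "g \<in> borel_measurable M"
    using assms by (auto simp: sq_integrable_def)
  show "(\<lambda>x. f x + c * g x) \<in> borel_measurable M" by measurable
  show "integrable M (\<lambda>x. (cmod (f x + c * g x))\<^sup>2)"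
  proof (rule Bochner_Integration.integrable_bound)
    show "integrable M (\<lambda>x. 2 * (cmod (f x))\<^sup>2 + 2 * ((cmod c)\<^sup>2 * (cmod (g x))\<^sup>2))"
      using assms by (simp add: sq_integrable_def)
    show "AE x in M. norm ((cmod (f x + c * g x))\<^sup>2)
        \<le> norm (2 * (cmod (f x))\<^sup>2 + 2 * ((cmod c)\<^sup>2 * (cmod (g x))\<^sup>2))"
    proof (rule AE_I2)
      fix x
      have "(cmod (f x + c * g x))\<^sup>2 \<le> (cmod (f x) + cmod (c * g x))\<^sup>2"
        by (intro power_mono norm_triangle_ineq) simp
      also have "\<dots> \<le> 2 * (cmod (f x))\<^sup>2 + 2 * (cmod (c * g x))\<^sup>2"
        using sum_squares_bound[of "cmod (f x)" "cmod (c * g x)"] by (simp add: power2_sum)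
      finally show "norm ((cmod (f x + c * g x))\<^sup>2)
        \<le> norm (2 * (cmod (f x))\<^sup>2 + 2 * ((cmod c)\<^sup>2 * (cmod (g x))\<^sup>2))"
        by (simp add: norm_mult power_mult_distrib)
    qed
  qed measurable
qed

lemma sq_integrable_diff:
  assumes "sq_integrable M f" "sq_integrable M g"
  shows "sq_integrable M (\<lambda>x. f x - g x)"
  using sq_integrable_add_scaled[OF assms, of "-1"] by simp

text \<open>Fatou's lemma. It yields integrability of a pointwise limit together with lower
  semicontinuity of the norm.\<close>

lemma sq_integrable_limit:
  assumes f: "\<And>j. sq_integrable M (f j)" "\<And>j::nat. integral\<^sup>L M (\<lambda>x. (cmod (f j x))\<^sup>2) \<le> b j"
    and lim: "\<And>x. x \<in> space M \<Longrightarrow> (\<lambda>j. f j x) \<longlonglongrightarrow> g x" and b: "b \<longlonglongrightarrow> d"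
  shows "sq_integrable M g" and "integral\<^sup>L M (\<lambda>x. (cmod (g x))\<^sup>2) \<le> d"
proof -
  have [measurable]: "f j \<in> borel_measurable M" for j using f(1) by (simp add: sq_integrable_def)
  have [measurable]: "g \<in> borel_measurable M"
    by (rule borel_measurable_LIMSEQ_metric[OF _ lim]) measurable
  have d: "d \<ge> 0"
  proof (rule LIMSEQ_le_const[OF b])
    show "\<exists>N. \<forall>n\<ge>N. 0 \<le> b n"
      using order_trans[OF integral_nonneg_AE f(2)] by (auto intro!: exI[of _ 0])
  qed
  have "(\<integral>\<^sup>+x. ennreal ((cmod (g x))\<^sup>2) \<partial>M) = (\<integral>\<^sup>+x. liminf (\<lambda>j. ennreal ((cmod (f j x))\<^sup>2)) \<partial>M)"
  proof (rule nn_integral_cong)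
    fix x assume "x \<in> space M"
    from lim[OF this] have "(\<lambda>j. ennreal ((cmod (f j x))\<^sup>2)) \<longlonglongrightarrow> ennreal ((cmod (g x))\<^sup>2)"
      by (intro tendsto_ennrealI tendsto_power tendsto_norm)
    then show "ennreal ((cmod (g x))\<^sup>2) = liminf (\<lambda>j. ennreal ((cmod (f j x))\<^sup>2))"
      by (rule lim_imp_Liminf[OF trivial_limit_sequentially, symmetric])
  qed
  also have "\<dots> \<le> liminf (\<lambda>j. \<integral>\<^sup>+x. ennreal ((cmod (f j x))\<^sup>2) \<partial>M)"
    by (rule nn_integral_liminf) measurable
  also have "\<dots> \<le> liminf (\<lambda>j. ennreal (b j))"
  proof (rule Liminf_mono, rule always_eventually, rule allI)
    fix j
    have "(\<integral>\<^sup>+x. ennreal ((cmod (f j x))\<^sup>2) \<partial>M) = ennreal (integral\<^sup>L M (\<lambda>x. (cmod (f j x))\<^sup>2))"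
      using f(1)[of j] by (intro nn_integral_eq_integral) (auto simp: sq_integrable_def)
    also have "\<dots> \<le> ennreal (b j)" using f(2) by (rule ennreal_leI)
    finally show "(\<integral>\<^sup>+x. ennreal ((cmod (f j x))\<^sup>2) \<partial>M) \<le> ennreal (b j)" .
  qed
  also have "\<dots> = ennreal d"
    by (rule lim_imp_Liminf[OF trivial_limit_sequentially tendsto_ennrealI[OF b]])
  finally have le: "(\<integral>\<^sup>+x. ennreal ((cmod (g x))\<^sup>2) \<partial>M) \<le> ennreal d" .
  have int: "integrable M (\<lambda>x. (cmod (g x))\<^sup>2)"
    by (rule integrableI_nonneg) (use le in \<open>auto simp: less_top[symmetric] top_unique\<close>)
  then show "sq_integrable M g" by (simp add: sq_integrable_def)
  have "ennreal (integral\<^sup>L M (\<lambda>x. (cmod (g x))\<^sup>2)) = (\<integral>\<^sup>+x. ennreal ((cmod (g x))\<^sup>2) \<partial>M)"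
    by (rule nn_integral_eq_integral[symmetric]) (use int in auto)
  with le show "integral\<^sup>L M (\<lambda>x. (cmod (g x))\<^sup>2) \<le> d" using d
    by (metis ennreal_le_iff)
qed

text \<open>The minimising sequence argument for genuine functions instead of classes modulo null
  sets. Completeness therefore asks for pointwise limits, and membership of the limit in
  \<open>H\<close> is asked for only under square integrability, which Fatou's lemma
  delivers.\<close>

lemma orthogonal_projection_exists:
  fixes H :: "('a \<Rightarrow> complex) set"
  assumes sq: "\<And>h. h \<in> H \<Longrightarrow> sq_integrable M h"
    and zero: "(\<lambda>x. 0) \<in> H"
    and lin: "\<And>h k c. h \<in> H \<Longrightarrow> k \<in> H \<Longrightarrow> (\<lambda>x. h x + c * k x) \<in> H"
    and complete: "\<And>h. (\<And>j::nat. h j \<in> H) \<Longrightarrow>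
        (\<And>e. e > 0 \<Longrightarrow> \<exists>N. \<forall>i\<ge>N. \<forall>j\<ge>N. integral\<^sup>L M (\<lambda>x. (cmod (h i x - h j x))\<^sup>2) \<le> e) \<Longrightarrow>
        \<exists>k. (\<forall>x\<in>space M. (\<lambda>j. h j x) \<longlonglongrightarrow> k x) \<and> (sq_integrable M k \<longrightarrow> k \<in> H)"
    and f: "sq_integrable M f"
  shows "\<exists>g\<in>H. \<forall>h\<in>H. integral\<^sup>L M (\<lambda>x. (f x - g x) * cnj (h x)) = 0"
proof -
  define N where "N g = integral\<^sup>L M (\<lambda>x. (cmod (g x))\<^sup>2)" for g
  have N0: "N g \<ge> 0" for g unfolding N_def by simp
  define d where "d = Inf ((\<lambda>h. N (\<lambda>x. f x - h x)) ` H)"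
  have bdd: "bdd_below ((\<lambda>h. N (\<lambda>x. f x - h x)) ` H)"
    by (rule bdd_belowI[of _ 0]) (use N0 in auto)
  have d_le: "d \<le> N (\<lambda>x. f x - h x)" if "h \<in> H" for h
    unfolding d_def by (rule cInf_lower[OF _ bdd]) (use that in auto)
  have "\<exists>h\<in>H. N (\<lambda>x. f x - h x) < d + e" if "e > 0" for e
  proof -
    have "Inf ((\<lambda>h. N (\<lambda>x. f x - h x)) ` H) < d + e" using that unfolding d_def by simp
    from cInf_lessD[OF _ this] zero show ?thesis by blast
  qed
  then have "\<forall>j::nat. \<exists>h\<in>H. N (\<lambda>x. f x - h x) < d + inverse (real (Suc j))" by simp
  then obtain h where h: "\<And>j. h j \<in> H" "\<And>j. N (\<lambda>x. f x - h j x) < d + inverse (real (Suc j))"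
    by metis
  have cauchy: "N (\<lambda>x. h i x - h j x) \<le> 2 * inverse (real (Suc i)) + 2 * inverse (real (Suc j))" for i j
  proof -
    \<comment> \<open>The midpoint of \<open>h i\<close> and \<open>h j\<close>, assembled from 0 by
      two uses of the closure rule. By the parallelogram identity, and because the squared distance
      from \<open>f\<close> to \<open>m\<close> is at least \<open>d\<close>, the two functions are
      close.\<close>
    define m where "m x = (0 + (1/2) * h i x) + (1/2) * h j x" for x
    have m: "m \<in> H" unfolding m_def by (intro lin zero h)
    have int: "integrable M (\<lambda>x. (cmod (f x - g x))\<^sup>2)" if "g \<in> H" for g
      using sq_integrable_diff[OF f sq[OF that]] by (simp add: sq_integrable_def)
    have "(cmod (h i x - h j x))\<^sup>2 = 2 * (cmod (f x - h i x))\<^sup>2 + 2 * (cmod (f x - h j x))\<^sup>2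
       - 4 * (cmod (f x - m x))\<^sup>2" for x
      unfolding cmod_power2 m_def by (simp add: power2_eq_square field_simps)
    then have "N (\<lambda>x. h i x - h j x) = 2 * N (\<lambda>x. f x - h i x) + 2 * N (\<lambda>x. f x - h j x) - 4 * N (\<lambda>x. f x - m x)"
      unfolding N_def using int[OF h(1)] int[OF m] by simp
    with h(2)[of i] h(2)[of j] d_le[OF m] show ?thesis by linarith
  qed
  have "\<exists>k. (\<forall>x\<in>space M. (\<lambda>j. h j x) \<longlonglongrightarrow> k x) \<and> (sq_integrable M k \<longrightarrow> k \<in> H)"
  proof (rule complete[OF h(1)])
    fix e :: real assume "e > 0"
    then obtain n where n: "inverse (real (Suc n)) < e / 4"
      using reals_Archimedean[of "e/4"] by auto
    have small: "inverse (real (Suc i)) < e / 4" if "i \<ge> n" for i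
    proof -
      have "inverse (real (Suc i)) \<le> inverse (real (Suc n))" using that by (intro le_imp_inverse_le) auto
      with n show ?thesis by linarith
    qed
    have "N (\<lambda>x. h i x - h j x) \<le> e" if "i \<ge> n" "j \<ge> n" for i j
      using cauchy[of i j] small[OF that(1)] small[OF that(2)] by linarith
    then show "\<exists>N. \<forall>i\<ge>N. \<forall>j\<ge>N. integral\<^sup>L M (\<lambda>x. (cmod (h i x - h j x))\<^sup>2) \<le> e"
      unfolding N_def by blast
  qed
  then obtain k where k: "\<And>x. x \<in> space M \<Longrightarrow> (\<lambda>j. h j x) \<longlonglongrightarrow> k x" "sq_integrable M k \<Longrightarrow> k \<in> H"
    by blast
  \<comment> \<open>The limit attains the infimum. Square integrability of \<open>f - k\<close>
    comes first and gives that of \<open>k\<close>, which puts \<open>k\<close> into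
    \<open>H\<close>.\<close>
  have "sq_integrable M (\<lambda>x. f x - k x) \<and> N (\<lambda>x. f x - k x) \<le> d"
    unfolding N_def
  proof (intro conjI; rule sq_integrable_limit[where f = "\<lambda>j x. f x - h j x" and d = d and b = "\<lambda>j. d + inverse (real (Suc j))"])
    show "sq_integrable M (\<lambda>x. f x - h j x)" for j by (intro sq_integrable_diff f sq h)
    then show "sq_integrable M (\<lambda>x. f x - h j x)" for j .
    show "(\<integral>x. (cmod (f x - h j x))\<^sup>2 \<partial>M) \<le> d + inverse (real (Suc j))" for j
      using h(2)[of j] unfolding N_def by simp
    then show "(\<integral>x. (cmod (f x - h j x))\<^sup>2 \<partial>M) \<le> d + inverse (real (Suc j))" for j .
    show "(\<lambda>j. f x - h j x) \<longlonglongrightarrow> f x - k x" if "x \<in> space M" for x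
      by (intro tendsto_intros k that)
    then show "(\<lambda>j. f x - h j x) \<longlonglongrightarrow> f x - k x" if "x \<in> space M" for x using that .
    show "(\<lambda>j. d + inverse (real (Suc j))) \<longlonglongrightarrow> d"
      by (rule LIMSEQ_inverse_real_of_nat_add)
    then show "(\<lambda>j. d + inverse (real (Suc j))) \<longlonglongrightarrow> d" .
  qed
  then have fk: "sq_integrable M (\<lambda>x. f x - k x)" "N (\<lambda>x. f x - k x) \<le> d" by auto
  have kH: "k \<in> H" using k(2) sq_integrable_diff[OF f fk(1)] by simp
  show ?thesis
  proof (intro bexI[OF _ kH] ballI)
    fix g assume g: "g \<in> H"
    define q where "q = integral\<^sup>L M (\<lambda>x. (f x - k x) * cnj (g x))"
    \<comment> \<open>Minimality of \<open>k\<close> against the competitor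
      \<open>k + c * g\<close>. With \<open>c\<close> a real multiple of \<open>q\<close> the cross
      term becomes \<open>- 2 * s\<close> times the square of \<open>cmod q\<close>.\<close>
    have var: "2 * s * (cmod q)\<^sup>2 \<le> s\<^sup>2 * (cmod q)\<^sup>2 * N g" for s :: real
    proof -
      define c where "c = of_real s * q"
      have "d \<le> N (\<lambda>x. f x - (k x + c * g x))" by (intro d_le lin kH g)
      also have "N (\<lambda>x. f x - (k x + c * g x)) =
          N (\<lambda>x. f x - k x) - 2 * Re (cnj c * q) + (cmod c)\<^sup>2 * N g"
      proof -
        have i1: "integrable M (\<lambda>x. (cmod (f x - k x))\<^sup>2)" "integrable M (\<lambda>x. (cmod (g x))\<^sup>2)"
          using fk(1) sq[OF g] by (auto simp: sq_integrable_def)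
        have i2: "integrable M (\<lambda>x. cnj c * ((f x - k x) * cnj (g x)))"
          by (intro integrable_mult_right sq_integrable_mult_cnj fk(1) sq g)
        define X where "X x = Re (cnj c * ((f x - k x) * cnj (g x)))" for x
        have X: "integrable M X" unfolding X_def by (rule integrable_Re[OF i2])
        have "(cmod (f x - (k x + c * g x)))\<^sup>2 = (cmod (f x - k x))\<^sup>2
             - 2 * X x + (cmod c)\<^sup>2 * (cmod (g x))\<^sup>2" for x
          unfolding cmod_power2 X_def by (simp add: power2_eq_square algebra_simps)
        then have "N (\<lambda>x. f x - (k x + c * g x)) = N (\<lambda>x. f x - k x)
            - 2 * integral\<^sup>L M X + (cmod c)\<^sup>2 * N g"
          unfolding N_def using i1 X by simp
        also have "integral\<^sup>L M X = Re (cnj c * q)"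
          unfolding X_def by (subst integral_Re[OF i2]) (simp add: q_def)
        finally show ?thesis .
      qed
      finally have "2 * Re (cnj c * q) \<le> (cmod c)\<^sup>2 * N g" using fk(2) by linarith
      moreover have "Re (cnj c * q) = s * (cmod q)\<^sup>2"
        unfolding c_def cmod_power2 by (simp add: power2_eq_square algebra_simps)
      moreover have "(cmod c)\<^sup>2 = s\<^sup>2 * (cmod q)\<^sup>2"
        unfolding c_def by (simp add: norm_mult power_mult_distrib)
      ultimately show ?thesis by simp
    qed
    have "q = 0"
    proof (rule ccontr)
      assume "q \<noteq> 0"
      then have q: "(cmod q)\<^sup>2 > 0" by simp
      \<comment> \<open>Small enough that the quadratic term is at most \<open>s\<close>, half of
        the linear term \<open>2 * s\<close>; the added 1 covers \<open>N g = 0\<close>.\<close>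
      define s where "s = 1 / (N g + 1)"
      have s: "s > 0" "s * N g \<le> 1" using N0[of g] by (auto simp: s_def field_simps)
      have "(2 * s) * (cmod q)\<^sup>2 \<le> (s\<^sup>2 * N g) * (cmod q)\<^sup>2" using var[of s] by (simp add: mult_ac)
      then have "2 * s \<le> s\<^sup>2 * N g" using q by simp
      also have "s\<^sup>2 * N g = s * (s * N g)" by (simp add: power2_eq_square)
      also have "\<dots> \<le> s * 1" using s by (intro mult_left_mono) auto
      finally show False using s by simp
    qed
    then show "integral\<^sup>L M (\<lambda>x. (f x - k x) * cnj (g x)) = 0" by (simp add: q_def)
  qed
qed

section \<open>Interior estimates and completeness of the Bergman space\<close>

lemma integral_bump_pos:
  assumes "r > 0" shows "integral\<^sup>L lborel (bump r :: 'a::euclidean_space \<Rightarrow> real) > 0"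
proof -
  have int: "integrable lborel (bump r :: 'a \<Rightarrow> real)" using assms by (simp add: integrable_bump)
  have "integral\<^sup>L lborel (bump r :: 'a \<Rightarrow> real) \<noteq> 0"
  proof
    assume "integral\<^sup>L lborel (bump r :: 'a \<Rightarrow> real) = 0"
    then have "AE x in lborel. bump r (x::'a) = 0"
      using integral_nonneg_eq_0_iff_AE[OF int] by (simp add: bump_nonneg)
    then obtain N where N: "{x \<in> space lborel. \<not> bump r (x::'a) = 0} \<subseteq> N" "N \<in> null_sets lborel"
      by (auto elim!: AE_E simp: null_sets_def)
    have "bump r x \<noteq> 0" if "x \<in> ball 0 r" for x :: 'a
    proof -
      have "norm x < r" using that by simp
      then have "(norm x)\<^sup>2 < r\<^sup>2" by (intro power_strict_mono) auto
      then show ?thesis by (simp add: bump_def power2_norm_eq_inner)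
    qed
    then have sub: "ball 0 r \<subseteq> N" using N(1) by auto
    have "negligible N"
      using N(2) by (simp add: negligible_iff_null_sets null_sets_completionI)
    then have "negligible (ball (0::'a) r)" using sub negligible_subset by blast
    then show False using open_not_negligible[OF open_ball, of "0::'a" r] assms by simp
  qed
  moreover have "integral\<^sup>L lborel (bump r :: 'a \<Rightarrow> real) \<ge> 0"
    by (intro integral_nonneg_AE) (simp add: bump_nonneg)
  ultimately show ?thesis by simp
qed

text \<open>The passage from integrals over the whole space, where translations and integration by
  parts live, to the Lebesgue measure on \<open>D\<close> in which the Bergman space is
  defined.\<close>

lemma lborel_to_lebesgue_on:
  fixes u :: "'a::euclidean_space \<Rightarrow> 'b::{banach,second_countable_topology}"
  assumes "integrable lborel u" "\<And>x. x \<notin> D \<Longrightarrow> u x = 0" "D \<in> sets lebesgue"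
  shows "integrable (lebesgue_on D) u" "integral\<^sup>L (lebesgue_on D) u = integral\<^sup>L lborel u"
proof -
  have eq: "(\<lambda>x. indicator D x *\<^sub>R u x) = u"
    using assms(2) by (auto simp: indicator_def fun_eq_iff)
  have D: "D \<inter> space lebesgue \<in> sets lebesgue" using assms(3) by simp
  have m: "u \<in> borel_measurable lborel" using assms(1) by auto
  show "integrable (lebesgue_on D) u"
    unfolding integrable_restrict_space[OF D] eq
    using assms(1) integrable_completion[OF m] by simp
  show "integral\<^sup>L (lebesgue_on D) u = integral\<^sup>L lborel u"
    unfolding integral_restrict_space[OF D] eq by (rule integral_completion[OF m])
qed

lemma L2_on_iff_sq_integrable:
  assumes "D \<in> sets lebesgue"
  shows "L2_on D f \<longleftrightarrow> sq_integrable (lebesgue_on D) f"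
  using assms unfolding L2_on_def sq_integrable_def set_integrable_def
  by (simp add: integrable_restrict_space)

lemma set_lebesgue_integral_eq_lebesgue_on:
  fixes f :: "'a::euclidean_space \<Rightarrow> 'b::{banach,second_countable_topology}"
  assumes "D \<in> sets lebesgue"
  shows "(LINT x:D|lebesgue. f x) = integral\<^sup>L (lebesgue_on D) f"
  using assms unfolding set_lebesgue_integral_def by (simp add: integral_restrict_space)

lemma (in finite_measure) sq_integrable_imp_integrable:
  assumes "sq_integrable M f" shows "integrable M f"
proof (rule Bochner_Integration.integrable_bound)
  show "integrable M (\<lambda>x. 1 + (cmod (f x))\<^sup>2)" using assms by (simp add: sq_integrable_def)
  show "f \<in> borel_measurable M" using assms by (simp add: sq_integrable_def)
  have "t \<le> 1 + t\<^sup>2" if "t \<ge> 0" for t :: real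
    using sum_squares_bound[of t 1] that by simp
  then show "AE x in M. norm (f x) \<le> norm (1 + (cmod (f x))\<^sup>2)" by (intro AE_I2) simp
qed

text \<open>Integrates the pointwise inequality
  \<open>cmod (f x) \<le> e + (cmod (f x))\<^sup>2 / e\<close>, which stands in for the
  Cauchy-Schwarz inequality.\<close>

lemma (in finite_measure) integral_norm_le_of_sq_integral:
  assumes f: "sq_integrable M f" and e: "e > 0"
    and le: "integral\<^sup>L M (\<lambda>x. (cmod (f x))\<^sup>2) \<le> e\<^sup>2"
  shows "integral\<^sup>L M (\<lambda>x. cmod (f x)) \<le> e * (measure M (space M) + 1)"
proof -
  have int: "integrable M (\<lambda>x. (cmod (f x))\<^sup>2)" using f by (simp add: sq_integrable_def)
  have "integral\<^sup>L M (\<lambda>x. cmod (f x)) \<le> integral\<^sup>L M (\<lambda>x. e + (cmod (f x))\<^sup>2 / e)"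
  proof (rule integral_mono)
    show "integrable M (\<lambda>x. cmod (f x))" using sq_integrable_imp_integrable[OF f] by simp
    show "integrable M (\<lambda>x. e + (cmod (f x))\<^sup>2 / e)" using int by simp
    fix x
    have "2 * cmod (f x) * e \<le> (cmod (f x))\<^sup>2 + e\<^sup>2" by (rule sum_squares_bound)
    moreover have "0 \<le> cmod (f x) * e" using e by simp
    ultimately have "cmod (f x) * e \<le> (cmod (f x))\<^sup>2 + e\<^sup>2" by linarith
    then show "cmod (f x) \<le> e + (cmod (f x))\<^sup>2 / e" using e by (simp add: field_simps power2_eq_square)
  qed
  also have "\<dots> = e * measure M (space M) + integral\<^sup>L M (\<lambda>x. (cmod (f x))\<^sup>2) / e"
    using int by simp
  also have "\<dots> \<le> e * measure M (space M) + e\<^sup>2 / e" using le e by (simp add: divide_right_mono)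
  also have "\<dots> = e * (measure M (space M) + 1)" by (simp add: power2_eq_square algebra_simps)
  finally show ?thesis .
qed

lemma derivative_bound_of_lipschitz:
  fixes f :: "'a::real_normed_vector \<Rightarrow> 'b::real_normed_vector"
  assumes der: "(f has_derivative f') (at x)" and S: "open S" "x \<in> S"
    and lip: "\<And>y. y \<in> S \<Longrightarrow> norm (f y - f x) \<le> B * norm (y - x)"
  shows "norm (f' v) \<le> B * norm v"
proof -
  define t where "t n = inverse (real (Suc n))" for n
  have t: "t \<longlonglongrightarrow> 0" "\<And>n. t n > 0"
    unfolding t_def using LIMSEQ_inverse_real_of_nat by auto
  have lim: "(\<lambda>n. norm ((f (x + t n *\<^sub>R v) - f x) /\<^sub>R t n)) \<longlonglongrightarrow> norm (f' v)"
    by (intro tendsto_norm has_derivative_directional_sequence[OF der t])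
  have "(\<lambda>n. x + t n *\<^sub>R v) \<longlonglongrightarrow> x + 0 *\<^sub>R v" by (intro tendsto_intros t)
  then have ev: "\<forall>\<^sub>F n in sequentially. x + t n *\<^sub>R v \<in> S"
    using S by (intro topological_tendstoD) auto
  show ?thesis
  proof (rule tendsto_upperbound[OF lim _ trivial_limit_sequentially], use ev in eventually_elim)
    case (elim n)
    have "norm (f (x + t n *\<^sub>R v) - f x) \<le> B * (t n * norm v)"
      using lip[OF elim] t(2)[of n] by simp
    moreover have "norm ((f (x + t n *\<^sub>R v) - f x) /\<^sub>R t n) = norm (f (x + t n *\<^sub>R v) - f x) / t n"
      using t(2)[of n] by (simp add: divide_inverse mult.commute)
    ultimately show ?case using t(2)[of n] by (simp add: pos_divide_le_eq mult_ac)
  qed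
qed

text \<open>The mean value formula is used on balls of radius \<open>r\<close> about all points of
  \<open>ball a r\<close>; they stay inside \<open>cball a (2 * r)\<close>. The weight is Lipschitz
  in its centre, so the formula at two points bounds the increment of \<open>h\<close>, and hence
  its derivative, by the same integral of \<open>cmod (h x)\<close>.\<close>

lemma holomorphic_n_local_bounds:
  fixes a :: "complex^'n"
  assumes D: "open D" and r: "r > 0" and sub: "cball a (2 * r) \<subseteq> D"
  obtains B where "B \<ge> 0"
    "\<And>h x. holomorphic_n h D \<Longrightarrow> integrable (lebesgue_on D) h \<Longrightarrow> x \<in> ball a r \<Longrightarrow>
      cmod (h x) \<le> B * integral\<^sup>L (lebesgue_on D) (\<lambda>x. cmod (h x))"
    "\<And>h x v. holomorphic_n h D \<Longrightarrow> integrable (lebesgue_on D) h \<Longrightarrow> x \<in> ball a r \<Longrightarrow>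
      cmod (frechet_derivative h (at x) v) \<le> B * integral\<^sup>L (lebesgue_on D) (\<lambda>x. cmod (h x)) * norm v"
proof -
  define J where "J = integral\<^sup>L lborel (bump r :: complex^'n \<Rightarrow> real)"
  have J: "J > 0" unfolding J_def by (rule integral_bump_pos[OF r])
  have Dm: "D \<in> sets lebesgue" using D by auto
  have cb: "cball x r \<subseteq> D" if "x \<in> ball a r" for x
  proof
    fix y assume "y \<in> cball x r"
    then have "dist a y \<le> 2 * r" using that dist_triangle[of a y x] by simp
    then show "y \<in> D" using sub by auto
  qed
  have mv: "integrable (lebesgue_on D) (\<lambda>y. bump r (y - x) *\<^sub>R h y)"
       "J *\<^sub>R h x = integral\<^sup>L (lebesgue_on D) (\<lambda>y. bump r (y - x) *\<^sub>R h y)"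
    if h: "holomorphic_n h D" and x: "x \<in> ball a r" for h x
  proof -
    have z: "bump r (y - x) *\<^sub>R h y = 0" if "y \<notin> D" for y
    proof -
      have "y - x \<notin> cball 0 r" using cb[OF x] that by (auto simp: dist_norm norm_minus_commute subset_iff)
      then show ?thesis using r by (simp add: bump_outside)
    qed
    note m = holomorphic_n_mean_value[OF D h r cb[OF x]]
    show "integrable (lebesgue_on D) (\<lambda>y. bump r (y - x) *\<^sub>R h y)"
       "J *\<^sub>R h x = integral\<^sup>L (lebesgue_on D) (\<lambda>y. bump r (y - x) *\<^sub>R h y)"
      using lborel_to_lebesgue_on[OF m(1) z Dm] m(2) by (simp_all add: J_def)
  qed
  \<comment> \<open>\<open>r ^ 4\<close> bounds the weight and \<open>4 * r ^ 3\<close> its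
    Lipschitz constant; the sum serves both estimates.\<close>
  define B where "B = (r ^ 4 + 4 * r ^ 3) / J"
  have B0: "B \<ge> 0" using J r by (simp add: B_def)
  have b1: "cmod (h x) \<le> B * integral\<^sup>L (lebesgue_on D) (\<lambda>x. cmod (h x))"
    if h: "holomorphic_n h D" "integrable (lebesgue_on D) h" and x: "x \<in> ball a r" for h x
  proof -
    have "J * cmod (h x) = cmod (J *\<^sub>R h x)" using J by simp
    also have "\<dots> \<le> integral\<^sup>L (lebesgue_on D) (\<lambda>y. (r ^ 4 + 4 * r ^ 3) * cmod (h y))"
      unfolding mv(2)[OF h(1) x]
    proof (rule Bochner_Integration.integral_norm_bound_integral[OF mv(1)[OF h(1) x]])
      show "integrable (lebesgue_on D) (\<lambda>y. (r ^ 4 + 4 * r ^ 3) * cmod (h y))" using h(2) by simp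
      fix y
      have "bump r (y - x) \<le> r ^ 4 + 4 * r ^ 3" using bump_le[of r "y - x"] zero_le_power[of r 3] r by linarith
      then show "cmod (bump r (y - x) *\<^sub>R h y) \<le> (r ^ 4 + 4 * r ^ 3) * cmod (h y)"
        using bump_nonneg[of r "y - x"] by (simp add: mult_right_mono)
    qed
    also have "\<dots> = (r ^ 4 + 4 * r ^ 3) * integral\<^sup>L (lebesgue_on D) (\<lambda>y. cmod (h y))" by simp
    finally show ?thesis using J by (simp add: B_def field_simps)
  qed
  have b2: "cmod (frechet_derivative h (at x) v) \<le> B * integral\<^sup>L (lebesgue_on D) (\<lambda>x. cmod (h x)) * norm v"
    if h: "holomorphic_n h D" "integrable (lebesgue_on D) h" and x: "x \<in> ball a r" for h x v
  proof (rule derivative_bound_of_lipschitz[OF holomorphic_n_frechet(1)[OF h(1)] open_ball x])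
    show "x \<in> D" using cb[OF x] r by auto
    fix y assume y: "y \<in> ball a r"
    let ?I = "integral\<^sup>L (lebesgue_on D) (\<lambda>x. cmod (h x))"
    have I0: "?I \<ge> 0" by simp
    have "J * cmod (h y - h x) = cmod (J *\<^sub>R h y - J *\<^sub>R h x)"
      using J by (simp flip: scaleR_diff_right)
    also have "J *\<^sub>R h y - J *\<^sub>R h x
        = integral\<^sup>L (lebesgue_on D) (\<lambda>z. bump r (z - y) *\<^sub>R h z - bump r (z - x) *\<^sub>R h z)"
      using mv[OF h(1) x] mv[OF h(1) y] by simp
    also have "cmod \<dots> \<le> integral\<^sup>L (lebesgue_on D) (\<lambda>z. (4 * r ^ 3 * norm (y - x)) * cmod (h z))"
    proof (rule Bochner_Integration.integral_norm_bound_integral)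
      show "integrable (lebesgue_on D) (\<lambda>z. bump r (z - y) *\<^sub>R h z - bump r (z - x) *\<^sub>R h z)"
        using mv[OF h(1) x] mv[OF h(1) y] by simp
      show "integrable (lebesgue_on D) (\<lambda>z. (4 * r ^ 3 * norm (y - x)) * cmod (h z))"
        using h(2) by simp
      fix z
      have "norm (bump r (z - y) - bump r (z - x)) \<le> 4 * r ^ 3 * norm ((z - y) - (z - x))"
        by (rule lipschitz_of_derivative_bound[of UNIV _ "bump_deriv r"])
           (use r in \<open>auto intro: has_derivative_bump bump_deriv_bound\<close>)
      then have "\<bar>bump r (z - y) - bump r (z - x)\<bar> \<le> 4 * r ^ 3 * norm (y - x)"
        by (simp add: norm_minus_commute)
      then show "cmod (bump r (z - y) *\<^sub>R h z - bump r (z - x) *\<^sub>R h z) \<le> (4 * r ^ 3 * norm (y - x)) * cmod (h z)"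
        by (simp add: mult_right_mono flip: scaleR_diff_left)
    qed
    also have "\<dots> = (4 * r ^ 3 * norm (y - x)) * ?I" by simp
    also have "\<dots> \<le> ((r ^ 4 + 4 * r ^ 3) * norm (y - x)) * ?I"
      using r I0 by (intro mult_right_mono) auto
    finally show "cmod (h y - h x) \<le> B * ?I * norm (y - x)" using J by (simp add: B_def field_simps)
  qed
  show ?thesis by (rule that[OF B0 b1 b2])
qed

lemma holomorphic_n_add_scaled:
  assumes "holomorphic_n h D" "holomorphic_n k D"
  shows "holomorphic_n (\<lambda>x. h x + c * k x) D"
  unfolding holomorphic_n_def
proof
  fix z assume z: "z \<in> D"
  note h = holomorphic_n_frechet[OF assms(1) z] and k = holomorphic_n_frechet[OF assms(2) z]
  show "\<exists>L. ((\<lambda>x. h x + c * k x) has_derivative L) (at z) \<and> (\<forall>c v. L (c *s v) = c * L v)"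
    by (rule exI[of _ "\<lambda>v. frechet_derivative h (at z) v + c * frechet_derivative k (at z) v"])
       (auto intro!: has_derivative_add has_derivative_mult_right h(1) k(1) simp: h(2) k(2) algebra_simps)
qed

lemma frechet_derivative_diff_holomorphic_n:
  assumes "holomorphic_n h D" "holomorphic_n k D" "z \<in> D"
  shows "frechet_derivative (\<lambda>x. h x - k x) (at z) v = frechet_derivative h (at z) v - frechet_derivative k (at z) v"
proof -
  have "((\<lambda>x. h x - k x) has_derivative (\<lambda>v. frechet_derivative h (at z) v - frechet_derivative k (at z) v)) (at z)"
    by (intro has_derivative_diff holomorphic_n_frechet(1)[OF assms(1,3)] holomorphic_n_frechet(1)[OF assms(2,3)])
  from frechet_derivative_at[OF this] show ?thesis by metis
qed

lemma convergent_of_cauchy_bound: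
  fixes s :: "nat \<Rightarrow> complex"
  assumes T: "\<And>e. e > 0 \<Longrightarrow> \<exists>N. \<forall>i\<ge>N. \<forall>j\<ge>N. T i j \<le> (e::real)"
    and C: "C \<ge> 0" "\<And>i j. cmod (s i - s j) \<le> C * T i j"
  shows "s \<longlonglongrightarrow> lim s"
proof -
  have "Cauchy s"
  proof (rule CauchyI)
    fix e :: real assume "e > 0"
    then have "e / (C + 1) / 2 > 0" using C(1) by simp
    from T[OF this] obtain N where N: "\<And>i j. i \<ge> N \<Longrightarrow> j \<ge> N \<Longrightarrow> T i j \<le> e / (C + 1) / 2" by blast
    have "cmod (s i - s j) < e" if "i \<ge> N" "j \<ge> N" for i j
    proof -
      have "cmod (s i - s j) \<le> C * (e / (C + 1) / 2)"
        using C(2)[of i j] mult_left_mono[OF N[OF that] C(1)] by linarith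
      also have "\<dots> < e" using C(1) \<open>e > 0\<close> by (simp add: field_simps add_strict_increasing)
      finally show ?thesis .
    qed
    then show "\<exists>M. \<forall>m\<ge>M. \<forall>n\<ge>M. cmod (s m - s n) < e" by blast
  qed
  then show ?thesis by (simp add: Cauchy_convergent_iff convergent_LIMSEQ_iff)
qed

text \<open>On a set of finite measure a Cauchy sequence in the square mean is Cauchy in the mean,
  and the interior estimates turn this into locally uniform convergence of the functions and of
  their derivatives. Complex linearity of the derivative survives the limit.\<close>

lemma bergman_space_complete:
  fixes D :: "(complex^'n) set"
  assumes D: "open D" "bounded D" and h: "\<And>j::nat. h j \<in> bergman_space D"
    and cauchy: "\<And>e. e > 0 \<Longrightarrow> \<exists>N. \<forall>i\<ge>N. \<forall>j\<ge>N. integral\<^sup>L (lebesgue_on D) (\<lambda>x. (cmod (h i x - h j x))\<^sup>2) \<le> e"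
  shows "\<exists>k. (\<forall>x\<in>D. (\<lambda>j. h j x) \<longlonglongrightarrow> k x) \<and> holomorphic_n k D"
proof -
  have lm: "D \<in> lmeasurable" using D by (rule_tac lmeasurable_open)
  interpret finite_measure "lebesgue_on D" by (rule finite_measure_lebesgue_on[OF lm])
  have Dm: "D \<in> sets lebesgue" using lm by auto
  have hol: "holomorphic_n (h j) D" and sq: "sq_integrable (lebesgue_on D) (h j)" for j
    using h[of j] by (auto simp: bergman_space_def L2_on_iff_sq_integrable[OF Dm])
  have hold: "holomorphic_n (\<lambda>x. h i x - h j x) D" for i j
    using holomorphic_n_add_scaled[OF hol[of i] hol[of j], of "-1"] by simp
  have sqd: "sq_integrable (lebesgue_on D) (\<lambda>x. h i x - h j x)" for i j
    by (intro sq_integrable_diff sq)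
  note intd = sq_integrable_imp_integrable[OF sqd]
  define T where "T i j = integral\<^sup>L (lebesgue_on D) (\<lambda>x. cmod (h i x - h j x))" for i j
  have T: "\<exists>N. \<forall>i\<ge>N. \<forall>j\<ge>N. T i j \<le> e" if "e > 0" for e
  proof -
    define m where "m = measure (lebesgue_on D) (space (lebesgue_on D)) + 1"
    have m: "m > 0" unfolding m_def by (simp add: add_nonneg_pos)
    have "(e / m)\<^sup>2 > 0" using m that by simp
    from cauchy[OF this] obtain N where
      N: "\<And>i j. i \<ge> N \<Longrightarrow> j \<ge> N \<Longrightarrow> integral\<^sup>L (lebesgue_on D) (\<lambda>x. (cmod (h i x - h j x))\<^sup>2) \<le> (e / m)\<^sup>2"
      by blast
    have "T i j \<le> e" if "i \<ge> N" "j \<ge> N" for i j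
    proof -
      have "T i j \<le> e / m * m" unfolding T_def m_def
        by (rule integral_norm_le_of_sq_integral[OF sqd])
           (use N[OF that] m \<open>e > 0\<close> in \<open>auto simp: m_def\<close>)
      then show ?thesis using m by simp
    qed
    then show ?thesis by blast
  qed
  define d where "d j x v = frechet_derivative (h j) (at x) v" for j x v
  \<comment> \<open>A limit fixed once for all points, so that the limits found on the various balls
    agree with one function.\<close>
  define k where "k x = lim (\<lambda>j. h j x)" for x
  have loc: "(\<lambda>j. h j a) \<longlonglongrightarrow> k a \<and> (\<exists>L. (k has_derivative L) (at a) \<and> (\<forall>c v. L (c *s v) = c * L v))"
    if a: "a \<in> D" for a
  proof -
    obtain e where e: "e > 0" "cball a e \<subseteq> D" using D(1) a open_contains_cball by blast
    define r where "r = e / 2"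
    have r: "r > 0" "cball a (2 * r) \<subseteq> D" using e by (auto simp: r_def)
    have ballD: "x \<in> D" if "x \<in> ball a r" for x using that r by (auto simp: subset_iff)
    obtain B where B: "B \<ge> 0"
      and B1: "\<And>h x. holomorphic_n h D \<Longrightarrow> integrable (lebesgue_on D) h \<Longrightarrow> x \<in> ball a r \<Longrightarrow>
        cmod (h x) \<le> B * integral\<^sup>L (lebesgue_on D) (\<lambda>x. cmod (h x))"
      and B2: "\<And>h x v. holomorphic_n h D \<Longrightarrow> integrable (lebesgue_on D) h \<Longrightarrow> x \<in> ball a r \<Longrightarrow>
        cmod (frechet_derivative h (at x) v) \<le> B * integral\<^sup>L (lebesgue_on D) (\<lambda>x. cmod (h x)) * norm v"
      using holomorphic_n_local_bounds[OF D(1) r] by metis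
    have c1: "cmod (h i x - h j x) \<le> B * T i j" if "x \<in> ball a r" for i j x
      unfolding T_def by (rule B1[OF hold intd that])
    have c2: "cmod (d i x v - d j x v) \<le> B * T i j * norm v" if "x \<in> ball a r" for i j x v
      using B2[OF hold intd that, of i j v] frechet_derivative_diff_holomorphic_n[OF hol hol ballD[OF that], of i j v]
      unfolding T_def d_def by simp
    have l1: "(\<lambda>j. h j x) \<longlonglongrightarrow> k x" if "x \<in> ball a r" for x
      unfolding k_def by (rule convergent_of_cauchy_bound[OF T B c1[OF that]])
    define g' where "g' x v = lim (\<lambda>j. d j x v)" for x v
    have l2: "(\<lambda>j. d j x v) \<longlonglongrightarrow> g' x v" if "x \<in> ball a r" for x v
      unfolding g'_def
      by (rule convergent_of_cauchy_bound[OF T, where C="B * norm v"])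
         (use c2[OF that] B in \<open>auto simp: mult_ac\<close>)
    have "\<exists>g. \<forall>x\<in>ball a r. (\<lambda>n. h n x) \<longlonglongrightarrow> g x \<and> (g has_derivative g' x) (at x within ball a r)"
    proof (rule has_derivative_sequence[OF convex_ball, where f' = d])
      show "(h n has_derivative d n x) (at x within ball a r)" if "x \<in> ball a r" for n x
        unfolding d_def by (rule has_derivative_at_withinI[OF holomorphic_n_frechet(1)[OF hol ballD[OF that]]])
      show "a \<in> ball a r" using r by simp
      then show "(\<lambda>n. h n a) \<longlonglongrightarrow> k a" by (rule l1)
      fix e :: real assume "e > 0"
      then have "e / (B + 1) > 0" using B by simp
      from T[OF this] obtain N where N: "\<And>i j. i \<ge> N \<Longrightarrow> j \<ge> N \<Longrightarrow> T i j \<le> e / (B + 1)" by blast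
      have le: "cmod (d n x v - g' x v) \<le> e * norm v" if n: "n \<ge> N" and x: "x \<in> ball a r" for n x v
      proof (rule tendsto_upperbound[OF _ _ trivial_limit_sequentially])
        show "(\<lambda>j. cmod (d n x v - d j x v)) \<longlonglongrightarrow> cmod (d n x v - g' x v)"
          by (intro tendsto_intros l2 x)
        show "\<forall>\<^sub>F j in sequentially. cmod (d n x v - d j x v) \<le> e * norm v"
          using eventually_ge_at_top[of N]
        proof eventually_elim
          case (elim j)
          have "B * T n j \<le> B * (e / (B + 1))" by (intro mult_left_mono N n elim B)
          also have "\<dots> \<le> e" using B \<open>e > 0\<close> by (simp add: field_simps)
          finally have "B * T n j * norm v \<le> e * norm v" by (intro mult_right_mono) auto
          with c2[OF x, of n v j] show ?case by linarith
        qed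
      qed
      show "\<forall>\<^sub>F n in sequentially. \<forall>x\<in>ball a r. \<forall>v. norm (d n x v - g' x v) \<le> e * norm v"
        using eventually_ge_at_top[of N] by eventually_elim (use le in blast)
    qed
    then obtain g where g: "\<And>x. x \<in> ball a r \<Longrightarrow> (\<lambda>n. h n x) \<longlonglongrightarrow> g x"
       "\<And>x. x \<in> ball a r \<Longrightarrow> (g has_derivative g' x) (at x within ball a r)" by blast
    have aS: "a \<in> ball a r" using r by simp
    have "(g has_derivative g' a) (at a)"
      using g(2)[OF aS] at_within_open[OF aS open_ball] by simp
    then have "(k has_derivative g' a) (at a)"
      by (rule has_derivative_transform_within_open[OF _ open_ball aS])
         (use LIMSEQ_unique g(1) l1 in blast)
    moreover have "g' a (c *s v) = c * g' a v" for c v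
    proof (rule LIMSEQ_unique[OF l2[OF aS]])
      have "(\<lambda>j. c * d j a v) \<longlonglongrightarrow> c * g' a v" by (intro tendsto_intros l2 aS)
      then show "(\<lambda>j. d j a (c *s v)) \<longlonglongrightarrow> c * g' a v"
        unfolding d_def holomorphic_n_frechet(2)[OF hol a] .
    qed
    ultimately show ?thesis using l1[OF aS] by blast
  qed
  show ?thesis
    by (rule exI[of _ k]) (use loc in \<open>auto simp: holomorphic_n_def\<close>)
qed

text \<open>The projection is encoded as a relation between \<open>f\<close> and \<open>g\<close>.
  An estimate over all related pairs says something about a given \<open>f\<close> only once some
  \<open>g\<close> is known to be related to it.\<close>

theorem bergman_projection_exists:
  fixes D :: "(complex^'n) set"
  assumes D: "open D" "bounded D" and f: "L2_on D f"
  obtains g where "is_bergman_projection D f g"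
proof -
  have Dm: "D \<in> sets lebesgue" using D by auto
  have sp: "space (lebesgue_on D) = D" by (simp add: space_restrict_space)
  have "\<exists>g\<in>bergman_space D. \<forall>h\<in>bergman_space D. integral\<^sup>L (lebesgue_on D) (\<lambda>x. (f x - g x) * cnj (h x)) = 0"
  proof (rule orthogonal_projection_exists)
    show "sq_integrable (lebesgue_on D) h" if "h \<in> bergman_space D" for h
      using that by (simp add: bergman_space_def L2_on_iff_sq_integrable[OF Dm])
    have "holomorphic_n (\<lambda>x. 0) D" unfolding holomorphic_n_def
      by (intro ballI exI[of _ "\<lambda>v. 0"]) auto
    then show "(\<lambda>x. 0) \<in> bergman_space D"
      by (simp add: bergman_space_def L2_on_iff_sq_integrable[OF Dm] sq_integrable_def)
    show "(\<lambda>x. h x + c * k x) \<in> bergman_space D" if "h \<in> bergman_space D" "k \<in> bergman_space D" for h k c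
      using that by (auto simp: bergman_space_def L2_on_iff_sq_integrable[OF Dm]
         intro: holomorphic_n_add_scaled sq_integrable_add_scaled)
    show "sq_integrable (lebesgue_on D) f" using f by (simp add: L2_on_iff_sq_integrable[OF Dm])
    fix h :: "nat \<Rightarrow> complex^'n \<Rightarrow> complex"
    assume "\<And>j. h j \<in> bergman_space D"
      "\<And>e. e > 0 \<Longrightarrow> \<exists>N. \<forall>i\<ge>N. \<forall>j\<ge>N. integral\<^sup>L (lebesgue_on D) (\<lambda>x. (cmod (h i x - h j x))\<^sup>2) \<le> e"
    from bergman_space_complete[OF D this]
    show "\<exists>k. (\<forall>x\<in>space (lebesgue_on D). (\<lambda>j. h j x) \<longlonglongrightarrow> k x) \<and>
         (sq_integrable (lebesgue_on D) k \<longrightarrow> k \<in> bergman_space D)"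
      unfolding sp by (auto simp: bergman_space_def L2_on_iff_sq_integrable[OF Dm])
  qed
  then show ?thesis
    using that unfolding is_bergman_projection_def set_lebesgue_integral_eq_lebesgue_on[OF Dm] by blast
qed

section \<open>A holomorphic logarithm at the farthest boundary point\<close>

definition cdot :: "complex^'n \<Rightarrow> complex^'n \<Rightarrow> complex" where
  "cdot z p = (\<Sum>j\<in>UNIV. z $ j * cnj (p $ j))"

lemma Re_cdot: "Re (cdot z p) = z \<bullet> p"
  by (simp add: cdot_def inner_vec_def inner_complex_def)

lemma cdot_cscale: "cdot (c *s z) p = c * cdot z p"
  by (simp add: cdot_def sum_distrib_left mult_ac)

lemma cdot_self: "cdot p p = of_real ((norm p)\<^sup>2)"
  by (simp add: cdot_def complex_norm_square power2_norm_eq_inner inner_vec_def complex_eq_iff inner_complex_def)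

lemma norm_cdot_le: "cmod (cdot z p) \<le> norm z * norm p"
proof -
  have "cmod (cdot z p) \<le> (\<Sum>j\<in>UNIV. cmod (z $ j) * cmod (p $ j))"
    unfolding cdot_def by (rule order_trans[OF norm_sum]) (simp add: norm_mult)
  also have "\<dots> \<le> norm z * norm p"
    unfolding norm_vec_def using L2_set_mult_ineq[of "\<lambda>j. norm (z $ j)" "\<lambda>j. norm (p $ j)" UNIV] by simp
  finally show ?thesis .
qed

lemma bounded_linear_cdot: "bounded_linear (\<lambda>z. cdot z p)"
proof (rule bounded_linear_intro[where K="norm p"])
  show "cdot (x + y) p = cdot x p + cdot y p" for x y
    by (simp add: cdot_def algebra_simps sum.distrib)
  show "cdot (r *\<^sub>R x) p = r *\<^sub>R cdot x p" for r x
    by (simp add: cdot_def scaleR_sum_right)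
qed (rule norm_cdot_le)

text \<open>On the ball of radius \<open>norm p\<close> this function has positive real part; it vanishes at the
  boundary point \<open>p\<close>.\<close>
definition peak :: "complex^'n \<Rightarrow> complex^'n \<Rightarrow> complex" where
  "peak p z = 1 - cdot z p / of_real ((norm p)\<^sup>2)"

lemma Re_peak: "Re (peak p z) = 1 - (z \<bullet> p) / (norm p)\<^sup>2"
  by (simp add: peak_def Re_cdot)

text \<open>Expand the square of \<open>norm (z - p)\<close> and use
  \<open>norm z \<le> norm p\<close>. The left side is written as a square so that its root can
  serve as the \<open>s\<close> in the bound for \<open>Ln\<close> below.\<close>

lemma Re_peak_lower:
  assumes "p \<noteq> 0" "norm z \<le> norm p"
  shows "(norm (z - p) / (2 * norm p))\<^sup>2 \<le> Re (peak p z) / 2"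
proof -
  have "(norm (z - p))\<^sup>2 = (norm z)\<^sup>2 + (norm p)\<^sup>2 - 2 * (z \<bullet> p)"
    by (simp add: power2_norm_eq_inner inner_diff_left inner_diff_right inner_commute)
  moreover have "(norm z)\<^sup>2 \<le> (norm p)\<^sup>2" using assms by (intro power_mono) auto
  ultimately have "(norm (z - p))\<^sup>2 \<le> 2 * (norm p)\<^sup>2 - 2 * (z \<bullet> p)" by linarith
  then show ?thesis
    using assms by (simp add: Re_peak power_divide power_mult_distrib field_simps)
qed

lemma Re_peak_pos:
  assumes "p \<noteq> 0" "norm z < norm p"
  shows "Re (peak p z) > 0"
proof -
  have "z \<noteq> p" using assms by auto
  then have "0 < (norm (z - p) / (2 * norm p))\<^sup>2" using assms by simp
  with Re_peak_lower[of p z] assms show ?thesis by linarith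
qed

lemma norm_peak_le:
  assumes "p \<noteq> 0" "norm z \<le> norm p" shows "cmod (peak p z) \<le> 2"
proof -
  have "cmod (cdot z p) \<le> norm p * norm p"
    using norm_cdot_le[of z p] mult_right_mono[OF assms(2) norm_ge_zero[of p]] by linarith
  then have "cmod (cdot z p / of_real ((norm p)\<^sup>2)) \<le> 1"
    using assms by (simp add: norm_divide norm_mult power2_eq_square)
  then show ?thesis
    unfolding peak_def using norm_triangle_ineq4[of 1 "cdot z p / of_real ((norm p)\<^sup>2)"] by simp
qed

text \<open>The real part of \<open>Ln x\<close> is \<open>ln (cmod x)\<close>, bounded above by a
  constant and below by \<open>2 * ln s\<close>; the imaginary part is at most \<open>pi\<close> in
  modulus. The crude loss \<open>2 / s\<close> is affordable, since near \<open>p\<close> it meets a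
  factor comparable to \<open>s\<close>.\<close>

lemma norm_Ln_le:
  assumes "s > 0" "s\<^sup>2 \<le> cmod x" "cmod x \<le> 3"
  shows "cmod (Ln x) \<le> 3 + pi + 2 / s"
proof -
  have x: "cmod x > 0" using assms zero_less_power[of s 2] by linarith
  then have x0: "x \<noteq> 0" by auto
  have "ln (cmod x) \<le> 3" using ln_le_minus_one[OF x] assms by linarith
  moreover have "- ln (cmod x) \<le> 2 / s"
  proof -
    have "2 * ln s \<le> ln (cmod x)"
      using ln_mono[OF assms(2)] assms(1) by (simp add: ln_realpow)
    moreover have "ln (1 / s) \<le> 1 / s" using ln_le_minus_one[of "1 / s"] assms by simp
    ultimately show ?thesis using assms by (simp add: ln_div)
  qed
  moreover have "2 / s \<ge> 0" using assms by simp
  ultimately have "\<bar>ln (cmod x)\<bar> \<le> 3 + 2 / s" by linarith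
  then have "\<bar>Re (Ln x)\<bar> \<le> 3 + 2 / s" using x0 by simp
  moreover have "\<bar>Im (Ln x)\<bar> \<le> pi"
    using Im_Ln_le_pi[OF x0] mpi_less_Im_Ln[OF x0] by linarith
  ultimately show ?thesis using cmod_le[of "Ln x"] by linarith
qed

text \<open>The shift by \<open>e > 0\<close> keeps the argument away from 0 on \<open>D\<close>, so
  each function is bounded there and lies in the Bergman space.\<close>

definition log_peak :: "real \<Rightarrow> complex^'n \<Rightarrow> complex^'n \<Rightarrow> complex" where
  "log_peak e p z = Ln (of_real e + peak p z)"

definition log_peak_deriv :: "real \<Rightarrow> complex^'n \<Rightarrow> complex^'n \<Rightarrow> complex^'n \<Rightarrow> complex" where
  "log_peak_deriv e p z v = - (cdot v p / of_real ((norm p)\<^sup>2)) / (of_real e + peak p z)"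

lemma has_derivative_log_peak:
  assumes "p \<noteq> 0" "norm z < norm p" "e \<ge> 0"
  shows "(log_peak e p has_derivative log_peak_deriv e p z) (at z)"
proof -
  have "Re (of_real e + peak p z) > 0" using Re_peak_pos[OF assms(1,2)] assms(3) by simp
  then have "of_real e + peak p z \<notin> \<real>\<^sub>\<le>\<^sub>0" using complex_nonpos_Reals_iff by force
  then have "(Ln has_derivative (*) (inverse (of_real e + peak p z))) (at (of_real e + peak p z))"
    using has_field_derivative_Ln by (simp add: has_field_derivative_def)
  moreover have "((\<lambda>z. of_real e + peak p z) has_derivative (\<lambda>v. - (cdot v p / of_real ((norm p)\<^sup>2)))) (at z)"
  proof -
    have "((\<lambda>z. cdot z p) has_derivative (\<lambda>v. cdot v p)) (at z)"
      by (rule bounded_linear_imp_has_derivative[OF bounded_linear_cdot])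
    then show ?thesis unfolding peak_def divide_inverse
      by (auto intro!: derivative_eq_intros)
  qed
  ultimately have "((\<lambda>z. Ln (of_real e + peak p z)) has_derivative
      (\<lambda>v. inverse (of_real e + peak p z) * - (cdot v p / of_real ((norm p)\<^sup>2)))) (at z)"
    by (rule has_derivative_compose[rotated])
  moreover have "inverse (of_real e + peak p z) * - (cdot v p / of_real ((norm p)\<^sup>2)) = log_peak_deriv e p z v" for v
    by (simp add: log_peak_deriv_def divide_inverse mult_ac)
  ultimately show ?thesis unfolding log_peak_def[abs_def] by (simp only:)
qed

lemma holomorphic_n_log_peak:
  assumes "p \<noteq> 0" "e \<ge> 0" "\<And>z. z \<in> D \<Longrightarrow> norm z < norm p"
  shows "holomorphic_n (log_peak e p) D"
  unfolding holomorphic_n_def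
proof
  fix z assume "z \<in> D"
  from has_derivative_log_peak[OF assms(1) assms(3)[OF this] assms(2)]
  show "\<exists>L. (log_peak e p has_derivative L) (at z) \<and> (\<forall>c v. L (c *s v) = c * L v)"
    by (intro exI[of _ "log_peak_deriv e p z"]) (simp add: log_peak_deriv_def cdot_cscale)
qed

lemma norm_log_peak_deriv_le:
  assumes "p \<noteq> 0" "norm z < norm p" "e \<ge> 0"
  shows "cmod (log_peak_deriv e p z v) \<le> norm v / norm p / (e + Re (peak p z))"
proof -
  have "cmod (cdot v p / of_real ((norm p)\<^sup>2)) \<le> norm v / norm p"
    using norm_cdot_le[of v p] assms(1) by (simp add: norm_divide norm_mult power2_eq_square field_simps)
  moreover have "e + Re (peak p z) \<le> cmod (of_real e + peak p z)"
    using complex_Re_le_cmod[of "of_real e + peak p z"] by simp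
  ultimately have "cmod (cdot v p / of_real ((norm p)\<^sup>2)) / cmod (of_real e + peak p z)
      \<le> norm v / norm p / (e + Re (peak p z))"
    using Re_peak_pos[OF assms(1,2)] assms(3) by (intro frac_le[of "norm v / norm p"]) auto
  then show ?thesis by (simp add: log_peak_deriv_def norm_divide norm_mult)
qed

text \<open>With \<open>s = norm (z - p) / (2 * norm p)\<close> the singular term
  \<open>2 / s\<close> times \<open>norm (z - p)\<close> is the constant \<open>4 * norm p\<close>;
  the rest uses \<open>norm (z - p) \<le> 2 * norm p\<close>. The bound does not depend on
  \<open>e\<close>.\<close>

lemma norm_log_peak_le:
  assumes p: "p \<noteq> 0" and z: "norm z < norm p" and e: "0 \<le> e" "e \<le> 1"
  shows "cmod (log_peak e p z) * norm (z - p) \<le> (10 + 2 * pi) * norm p"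
proof -
  define s where "s = norm (z - p) / (2 * norm p)"
  have zp: "norm (z - p) > 0" using z by auto
  have s: "s > 0" using zp p by (simp add: s_def)
  have "s\<^sup>2 \<le> Re (of_real e + peak p z)"
    using Re_peak_lower[OF p less_imp_le[OF z]] Re_peak_pos[OF p z] e unfolding s_def by simp
  also have "\<dots> \<le> cmod (of_real e + peak p z)" by (rule complex_Re_le_cmod)
  finally have 1: "s\<^sup>2 \<le> cmod (of_real e + peak p z)" .
  have 2: "cmod (of_real e + peak p z) \<le> 3"
    using norm_triangle_ineq[of "of_real e" "peak p z"] norm_peak_le[OF p less_imp_le[OF z]] e by simp
  have "cmod (log_peak e p z) * norm (z - p) \<le> (3 + pi + 2 / s) * norm (z - p)"
    unfolding log_peak_def by (intro mult_right_mono norm_Ln_le s 1 2) auto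
  also have "\<dots> = (3 + pi) * norm (z - p) + 4 * norm p"
    using p zp by (simp add: s_def field_simps)
  also have "\<dots> \<le> (3 + pi) * (2 * norm p) + 4 * norm p"
    using norm_triangle_ineq4[of z p] z by (intro add_right_mono mult_left_mono) (auto simp: add_nonneg_nonneg)
  finally show ?thesis by (simp add: algebra_simps)
qed

section \<open>The boundary near the farthest point\<close>

lemma has_derivative_eventually_lipschitz:
  assumes "(f has_derivative f') (at p)"
  obtains B where "B \<ge> 0" "\<forall>\<^sub>F z in nhds p. norm (f z - f p) \<le> B * norm (z - p)"
proof -
  have bl: "bounded_linear f'" using assms by (rule has_derivative_bounded_linear)
  obtain K where K: "K > 0" "\<And>v. norm (f' v) \<le> norm v * K"
    using bounded_linear.pos_bounded[OF bl] by blast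
  obtain d where d: "d > 0" "\<And>y. norm (y - p) < d \<Longrightarrow> norm (f y - f p - f' (y - p)) \<le> 1 * norm (y - p)"
    using assms[unfolded has_derivative_at_alt, THEN conjunct2, rule_format, of 1] by auto
  show ?thesis
  proof (rule that[of "K + 1"])
    show "\<forall>\<^sub>F z in nhds p. norm (f z - f p) \<le> (K + 1) * norm (z - p)"
      unfolding eventually_nhds_metric
    proof (intro exI[of _ d] conjI allI impI d(1))
      fix y assume "dist y p < d"
      then have "norm (f y - f p - f' (y - p)) \<le> norm (y - p)" using d(2)[of y] by (simp add: dist_norm)
      then show "norm (f y - f p) \<le> (K + 1) * norm (y - p)"
        using K(2)[of "y - p"] norm_triangle_ineq2[of "f y - f p" "f' (y - p)"] by (simp add: algebra_simps)
    qed
  qed (use K in auto)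
qed

lemma smooth_on_differentiable:
  assumes "smooth_on V \<rho>" "open V"
  shows "\<And>x. x \<in> V \<Longrightarrow> (\<rho> has_derivative frechet_derivative \<rho> (at x)) (at x)"
    and "\<And>b. b \<in> Basis \<Longrightarrow> (\<lambda>x. frechet_derivative \<rho> (at x) b) differentiable_on V"
proof -
  have d: "\<rho> differentiable_on V" and s: "\<And>b. b \<in> Basis \<Longrightarrow> smooth_on V (\<lambda>x. frechet_derivative \<rho> (at x) b)"
    using assms(1) by (auto elim: smooth_on.cases)
  show "(\<rho> has_derivative frechet_derivative \<rho> (at x)) (at x)" if "x \<in> V" for x
    using d that assms(2) by (intro frechet_derivative_works[THEN iffD1]) (simp add: differentiable_on_eq_differentiable_at)
  show "(\<lambda>x. frechet_derivative \<rho> (at x) b) differentiable_on V" if "b \<in> Basis" for b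
    using s[OF that] by (auto elim: smooth_on.cases)
qed

text \<open>Unfolding smoothness twice makes every partial derivative differentiable at
  \<open>p\<close>, hence Lipschitz in comparison with its value at \<open>p\<close>. Summing over
  the finite basis gives a bound uniform in the direction \<open>v\<close>.\<close>

lemma smooth_on_derivative_lipschitz_at:
  fixes \<rho> :: "'a::euclidean_space \<Rightarrow> real"
  assumes "smooth_on V \<rho>" "open V" "p \<in> V"
  obtains B where "B \<ge> 0"
    "\<forall>\<^sub>F z in nhds p. \<forall>v. \<bar>frechet_derivative \<rho> (at z) v - frechet_derivative \<rho> (at p) v\<bar> \<le> B * norm (z - p) * norm v"
proof -
  let ?D = "\<lambda>z. frechet_derivative \<rho> (at z)"
  have "\<forall>b\<in>Basis. \<exists>B\<ge>0. \<forall>\<^sub>F z in nhds p. norm (?D z b - ?D p b) \<le> B * norm (z - p)"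
  proof
    fix b :: 'a assume "b \<in> Basis"
    then have "(\<lambda>x. ?D x b) differentiable at p"
      using smooth_on_differentiable(2)[OF assms(1,2)] assms by (simp add: differentiable_on_eq_differentiable_at)
    then obtain D' where "((\<lambda>x. ?D x b) has_derivative D') (at p)" by (auto simp: differentiable_def)
    then show "\<exists>B\<ge>0. \<forall>\<^sub>F z in nhds p. norm (?D z b - ?D p b) \<le> B * norm (z - p)"
      by (rule has_derivative_eventually_lipschitz) blast
  qed
  from bchoice[OF this] obtain B where B: "\<And>b. b \<in> Basis \<Longrightarrow> B b \<ge> 0"
     "\<And>b. b \<in> Basis \<Longrightarrow> \<forall>\<^sub>F z in nhds p. norm (?D z b - ?D p b) \<le> B b * norm (z - p)"
    by blast
  have ev: "\<forall>\<^sub>F z in nhds p. \<forall>b\<in>Basis. norm (?D z b - ?D p b) \<le> B b * norm (z - p)"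
    by (rule eventually_ball_finite) (use B in auto)
  have evV: "\<forall>\<^sub>F z in nhds p. z \<in> V" using assms eventually_nhds by blast
  show ?thesis
  proof (rule that[of "\<Sum>b\<in>Basis. B b"])
    show "(\<Sum>b\<in>Basis. B b) \<ge> 0" by (intro sum_nonneg B)
    show "\<forall>\<^sub>F z in nhds p. \<forall>v. \<bar>?D z v - ?D p v\<bar> \<le> (\<Sum>b\<in>Basis. B b) * norm (z - p) * norm v"
      using ev evV
    proof eventually_elim
      case (elim z)
      have lin: "linear (?D z)" "linear (?D p)"
        using smooth_on_differentiable(1)[OF assms(1,2)] elim assms has_derivative_linear by blast+
      show ?case
      proof
        fix v
        have "?D z v - ?D p v = (\<Sum>b\<in>Basis. (v \<bullet> b) * (?D z b - ?D p b))"
          unfolding linear_euclidean_sum[OF lin(1), of v] linear_euclidean_sum[OF lin(2), of v]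
          by (simp add: sum_subtractf algebra_simps)
        also have "\<bar>\<dots>\<bar> \<le> (\<Sum>b\<in>Basis. \<bar>(v \<bullet> b) * (?D z b - ?D p b)\<bar>)" by (rule sum_abs)
        also have "\<dots> \<le> (\<Sum>b\<in>Basis. norm v * (B b * norm (z - p)))"
          unfolding abs_mult using elim by (intro sum_mono mult_mono) (auto simp: Basis_le_norm)
        also have "\<dots> = (\<Sum>b\<in>Basis. B b) * norm (z - p) * norm v"
          by (simp add: sum_distrib_left sum_distrib_right mult_ac)
        finally show "\<bar>?D z v - ?D p v\<bar> \<le> (\<Sum>b\<in>Basis. B b) * norm (z - p) * norm v" .
      qed
    qed
  qed
qed

text \<open>Compactness of the closure yields a maximum of the norm. The inequality on
  \<open>D\<close> is strict because a point of an open set can be moved outward; at the origin,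
  which has no outward direction, any vector will do.\<close>

lemma farthest_boundary_point:
  fixes D :: "'a::euclidean_space set"
  assumes "open D" "D \<noteq> {}" "bounded D"
  obtains p where "p \<in> closure D" "p \<in> frontier D" "p \<noteq> 0" "\<And>z. z \<in> D \<Longrightarrow> norm z < norm p"
proof -
  have "compact (closure D)" using assms(3) by simp
  moreover have "closure D \<noteq> {}" using assms(2) by simp
  ultimately obtain p where p: "p \<in> closure D" "\<And>z. z \<in> closure D \<Longrightarrow> norm z \<le> norm p"
    using continuous_attains_sup[of "closure D" norm] continuous_on_norm_id by blast
  have lt: "norm z < norm p" if z: "z \<in> D" for z
  proof -
    obtain e where e: "e > 0" "ball z e \<subseteq> D" using assms(1) z openE by blast
    obtain u :: 'a where u: "norm u = e / 2" "norm (z + u) > norm z"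
    proof (cases "z = 0")
      case True
      obtain u :: 'a where "norm u = e / 2" using vector_choose_size[of "e/2"] e(1) by auto
      moreover from this have "u \<noteq> 0" using e(1) by auto
      ultimately show ?thesis using that[of u] True by simp
    next
      case False
      have "z + (e / 2 / norm z) *\<^sub>R z = (1 + e / 2 / norm z) *\<^sub>R z" by (simp add: algebra_simps)
      then have "norm (z + (e / 2 / norm z) *\<^sub>R z) = \<bar>1 + e / 2 / norm z\<bar> * norm z" by simp
      also have "\<dots> = norm z + e / 2" using e(1) False by (simp add: field_simps)
      finally show ?thesis using that[of "(e / 2 / norm z) *\<^sub>R z"] False e(1) by simp
    qed
    have "z + u \<in> ball z e" using u(1) e(1) by (simp add: dist_norm)
    then have "norm (z + u) \<le> norm p" using e(2) p(2) closure_subset by blast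
    then show ?thesis using u(2) by simp
  qed
  have "p \<notin> D" using lt[of p] by auto
  then have "p \<in> frontier D" using p(1) assms(1) by (simp add: frontier_def interior_open)
  moreover obtain z where "z \<in> D" using assms(2) by blast
  then have "p \<noteq> 0" using lt[of z] by auto
  ultimately show ?thesis using that p(1) lt by blast
qed

text \<open>A direction \<open>v\<close> with \<open>v \<bullet> p > 0\<close> leaves the ball of
  radius \<open>norm p\<close>, and with it \<open>D\<close>, so \<open>\<rho>\<close> does not
  decrease along it. A linear functional that is nonnegative on an open half-space is a nonnegative
  multiple of the inner product with \<open>p\<close>, and here it is not zero.\<close>

lemma gradient_at_farthest_point:
  fixes D :: "'a::euclidean_space set" and \<rho> :: "'a \<Rightarrow> real"
  assumes p0: "p \<noteq> 0" and lt: "\<And>z. z \<in> D \<Longrightarrow> norm z < norm p"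
    and V: "open V" "p \<in> V" and DV: "D \<inter> V = {x \<in> V. \<rho> x < 0}"
    and der: "(\<rho> has_derivative \<rho>') (at p)" and nz: "\<rho>' \<noteq> (\<lambda>v. 0)" and zero: "\<rho> p = 0"
  shows "\<rho>' p > 0" and "\<And>v. v \<bullet> p = 0 \<Longrightarrow> \<rho>' v = 0"
proof -
  have lin: "linear \<rho>'" using der by (rule has_derivative_linear)
  have nn: "\<rho>' v \<ge> 0" if v: "v \<bullet> p > 0" for v
  proof -
    define t where "t n = inverse (real (Suc n))" for n
    have t: "t \<longlonglongrightarrow> 0" "\<And>n. t n > 0"
      unfolding t_def using LIMSEQ_inverse_real_of_nat by auto
    have lim: "(\<lambda>n. (\<rho> (p + t n *\<^sub>R v) - \<rho> p) /\<^sub>R t n) \<longlonglongrightarrow> \<rho>' v"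
      by (rule has_derivative_directional_sequence[OF der t])
    have "(\<lambda>n. p + t n *\<^sub>R v) \<longlonglongrightarrow> p + 0 *\<^sub>R v" by (intro tendsto_intros t)
    then have ev: "\<forall>\<^sub>F n in sequentially. p + t n *\<^sub>R v \<in> V"
      using V by (intro topological_tendstoD) auto
    show ?thesis
    proof (rule tendsto_lowerbound[OF lim _ trivial_limit_sequentially], use ev in eventually_elim)
      case (elim n)
      have "(norm p)\<^sup>2 \<le> (norm (p + t n *\<^sub>R v))\<^sup>2"
      proof -
        have "(p + t n *\<^sub>R v) \<bullet> (p + t n *\<^sub>R v) = p \<bullet> p + 2 * (t n * (v \<bullet> p)) + (t n)\<^sup>2 * (v \<bullet> v)"
          by (simp add: inner_add_left inner_add_right inner_commute power2_eq_square)
        moreover have "0 \<le> 2 * (t n * (v \<bullet> p)) + (t n)\<^sup>2 * (v \<bullet> v)"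
          using t(2)[of n] v by (intro add_nonneg_nonneg mult_nonneg_nonneg) auto
        ultimately show ?thesis unfolding power2_norm_eq_inner by linarith
      qed
      then have "norm p \<le> norm (p + t n *\<^sub>R v)" by (rule power2_le_imp_le) simp
      then have "p + t n *\<^sub>R v \<notin> D" using lt by fastforce
      then have "\<rho> (p + t n *\<^sub>R v) \<ge> 0" using DV elim by force
      then show ?case using zero t(2)[of n] by simp
    qed
  qed
  have pp: "p \<bullet> p > 0" using p0 by simp
  have perp_nn: "\<rho>' v \<ge> 0" if "v \<bullet> p = 0" for v
  proof (rule ccontr)
    assume "\<not> \<rho>' v \<ge> 0"
    then have neg: "\<rho>' v < 0" by simp
    have rp: "\<rho>' p \<ge> 0" using nn[of p] pp by simp
    \<comment> \<open>Tilting \<open>v\<close> by \<open>s *\<^sub>R p\<close> moves it into the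
      open half-space while raising \<open>\<rho>' v\<close> by at most half its modulus, so the
      value stays negative. The added 1 avoids division by zero.\<close>
    define s where "s = - \<rho>' v / (2 * (\<rho>' p + 1))"
    have s: "s > 0" using neg rp by (simp add: s_def field_simps)
    have "\<rho>' (v + s *\<^sub>R p) \<ge> 0"
      by (rule nn) (use that s pp in \<open>simp add: inner_add_left\<close>)
    then have "\<rho>' v + s * \<rho>' p \<ge> 0" using lin by (simp add: linear_add linear_scale)
    moreover have "s * \<rho>' p \<le> s * (\<rho>' p + 1)" using s by (simp add: algebra_simps)
    moreover have "s * (\<rho>' p + 1) = - \<rho>' v / 2" using rp by (simp add: s_def field_simps)
    ultimately show False using neg by linarith
  qed
  show perp: "\<rho>' v = 0" if "v \<bullet> p = 0" for v
    using perp_nn[of v] perp_nn[of "- v"] that lin by (simp add: linear_neg)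
  show "\<rho>' p > 0"
  proof (rule ccontr)
    assume "\<not> \<rho>' p > 0"
    then have 0: "\<rho>' p = 0" using nn[of p] pp by simp
    have "\<rho>' v = 0" for v
    proof -
      define c where "c = (v \<bullet> p) / (p \<bullet> p)"
      have "(v - c *\<^sub>R p) \<bullet> p = 0" using pp by (simp add: c_def inner_diff_left)
      from perp[OF this] have "\<rho>' v - c * \<rho>' p = 0" using lin by (simp add: linear_diff linear_scale)
      then show ?thesis using 0 by simp
    qed
    then show False using nz by auto
  qed
qed

text \<open>Everything that is used of the boundary of \<open>D\<close>: near the farthest point \<open>p\<close> from the origin,
  \<open>D\<close> is \<open>{\<rho> < 0}\<close> for a \<open>\<rho>\<close> whose derivative is Lipschitz at \<open>p\<close>.\<close>
locale farthest_point =
  fixes D :: "(complex^'n) set" and p :: "complex^'n" and \<rho> \<rho>' S L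
  assumes openD: "open D" and boundedD: "bounded D"
    and p_closure: "p \<in> closure D" and p0: "p \<noteq> 0" and lt: "\<And>z. z \<in> D \<Longrightarrow> norm z < norm p"
    and S: "S > 0" "S \<le> 1" and L: "L \<ge> 0"
    and D_eq: "\<And>z. z \<in> cball p S \<Longrightarrow> z \<in> D \<longleftrightarrow> \<rho> z < 0"
    and der: "\<And>z. z \<in> cball p S \<Longrightarrow> (\<rho> has_derivative \<rho>' z) (at z)"
    and bnd: "\<And>z v. z \<in> cball p S \<Longrightarrow> \<bar>\<rho>' z v\<bar> \<le> L * norm v"
    and lip: "\<And>z v. z \<in> cball p S \<Longrightarrow> \<bar>\<rho>' z v - \<rho>' p v\<bar> \<le> L * norm (z - p) * norm v"
    and zero: "\<rho> p = 0" and grad_pos: "\<rho>' p p > 0" and grad_i: "\<rho>' p (\<i> *s p) = 0"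

lemma smoothly_bounded_farthest_point:
  fixes D :: "(complex^'n) set"
  assumes D: "open D" "D \<noteq> {}" "bounded D" and "smoothly_bounded D"
  obtains p \<rho> \<rho>' S L where "farthest_point D p \<rho> \<rho>' S L"
proof -
  obtain V \<rho> where V: "open V" "frontier D \<subseteq> V" and sm: "smooth_on V \<rho>"
    and nz: "\<And>x. x \<in> frontier D \<Longrightarrow> frechet_derivative \<rho> (at x) \<noteq> (\<lambda>v. 0)"
    and DV: "D \<inter> V = {x\<in>V. \<rho> x < 0}"
    using \<open>smoothly_bounded D\<close> unfolding smoothly_bounded_def by blast
  obtain p where p: "p \<in> closure D" "p \<in> frontier D" "p \<noteq> 0" and lt: "\<And>z. z \<in> D \<Longrightarrow> norm z < norm p"
    using farthest_boundary_point[OF D] by blast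
  define \<rho>' where "\<rho>' z = frechet_derivative \<rho> (at z)" for z
  have der: "(\<rho> has_derivative \<rho>' z) (at z)" if "z \<in> V" for z
    unfolding \<rho>'_def by (rule smooth_on_differentiable(1)[OF sm V(1) that])
  have pV: "p \<in> V" using p V by blast
  obtain B where B: "B \<ge> 0" "\<forall>\<^sub>F z in nhds p. \<forall>v. \<bar>\<rho>' z v - \<rho>' p v\<bar> \<le> B * norm (z - p) * norm v"
    using smooth_on_derivative_lipschitz_at[OF sm V(1) pV] unfolding \<rho>'_def by blast
  have "\<forall>\<^sub>F z in nhds p. z \<in> V" using V(1) pV eventually_nhds by blast
  with B(2) have "\<forall>\<^sub>F z in nhds p. z \<in> V \<and> (\<forall>v. \<bar>\<rho>' z v - \<rho>' p v\<bar> \<le> B * norm (z - p) * norm v)"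
    by eventually_elim auto
  then obtain d where d: "d > 0" "\<And>z. dist z p < d \<Longrightarrow> z \<in> V"
     "\<And>z v. dist z p < d \<Longrightarrow> \<bar>\<rho>' z v - \<rho>' p v\<bar> \<le> B * norm (z - p) * norm v"
    unfolding eventually_nhds_metric by blast
  \<comment> \<open>Half of \<open>d\<close> puts the closed ball inside the open one; the bound 1
    allows \<open>norm (z - p)\<close> to be dropped from the Lipschitz estimate.\<close>
  define S where "S = min 1 (d / 2)"
  have S: "S > 0" "S \<le> 1" using d(1) by (auto simp: S_def)
  have Sd: "dist z p < d" if "z \<in> cball p S" for z
  proof -
    have "dist z p \<le> d / 2" using that by (simp add: S_def dist_commute)
    then show ?thesis using d(1) by linarith
  qed
  obtain K where K: "K > 0" "\<And>v. norm (\<rho>' p v) \<le> norm v * K"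
    using bounded_linear.pos_bounded[OF has_derivative_bounded_linear[OF der[OF pV]]] by blast
  \<comment> \<open>\<open>\<rho> p\<close> is not negative because \<open>p\<close> lies outside
    \<open>D\<close>. If it were positive, \<open>\<rho>\<close> would be positive near
    \<open>p\<close>, and \<open>p\<close> would not be in the closure of \<open>D\<close>.\<close>
  have zero: "\<rho> p = 0"
  proof (rule antisym)
    show "0 \<le> \<rho> p" using DV pV lt[of p] by force
    show "\<rho> p \<le> 0"
    proof (rule ccontr)
      assume "\<not> \<rho> p \<le> 0"
      then have "\<rho> p > 0" by simp
      moreover have "(\<rho> \<longlongrightarrow> \<rho> p) (nhds p)"
        using has_derivative_continuous[OF der[OF pV]] by (simp add: isCont_def tendsto_at_iff_tendsto_nhds)
      ultimately have "\<forall>\<^sub>F z in nhds p. \<rho> z > 0" by (metis order_tendstoD(1))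
      moreover have "\<forall>\<^sub>F z in nhds p. z \<in> V" using V(1) pV eventually_nhds by blast
      ultimately have "\<forall>\<^sub>F z in nhds p. z \<notin> D"
        by eventually_elim (use DV in force)
      then obtain T where "open T" "p \<in> T" "\<And>z. z \<in> T \<Longrightarrow> z \<notin> D" unfolding eventually_nhds by blast
      then show False using p(1) by (auto simp: closure_iff_nhds_not_empty)
    qed
  qed
  note grad = gradient_at_farthest_point[OF p(3) lt V(1) pV DV der[OF pV] nz[OF p(2), folded \<rho>'_def] zero]
  \<comment> \<open>\<open>K\<close> bounds the derivative at \<open>p\<close> and \<open>B\<close>
    its variation, so the sum serves as the single constant for both locale assumptions.\<close>
  have "farthest_point D p \<rho> \<rho>' S (K + B)"
  proof
    show "(z \<in> D) = (\<rho> z < 0)" if "z \<in> cball p S" for z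
      using DV d(2)[OF Sd[OF that]] by blast
    fix z v assume z: "z \<in> cball p S"
    have l: "\<bar>\<rho>' z v - \<rho>' p v\<bar> \<le> B * norm (z - p) * norm v" by (rule d(3)[OF Sd[OF z]])
    have zp: "norm (z - p) \<le> 1" using z S by (simp add: dist_norm norm_minus_commute)
    have "B * norm (z - p) * norm v \<le> B * 1 * norm v"
      using zp B(1) by (intro mult_right_mono mult_left_mono) auto
    with l K(2)[of v] show "\<bar>\<rho>' z v\<bar> \<le> (K + B) * norm v" by (simp add: algebra_simps)
    have "B * norm (z - p) * norm v \<le> (K + B) * norm (z - p) * norm v"
      using K(1) by (intro mult_right_mono) auto
    with l show "\<bar>\<rho>' z v - \<rho>' p v\<bar> \<le> (K + B) * norm (z - p) * norm v" by linarith
  qed (use D p lt S B K der d(2) Sd zero grad in auto)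
  then show ?thesis by (rule that)
qed

section \<open>A bounded function with unbounded Bergman projection\<close>

text \<open>The combination of directions \<open>q\<close> and \<open>\<i> *s q\<close> is twice the
  holomorphic derivative of \<open>A\<close>. This operator annihilates the antiholomorphic
  \<open>cnj g\<close>, so its value on \<open>A\<close> times \<open>cnj g\<close> is again a
  combination of derivatives of a compactly supported product.\<close>

lemma dbar_orthogonal_compact_support:
  fixes A g :: "complex^'n \<Rightarrow> complex"
  assumes A: "\<And>x. (A has_derivative A' x) (at x)" "\<And>x. x \<notin> K \<Longrightarrow> A x = 0"
    and K: "compact K" "K \<subseteq> D" and D: "open D"
    and A': "\<And>x v. x \<in> K \<Longrightarrow> cmod (A' x v) \<le> C * norm v"
    and g: "holomorphic_n g D"
  shows "integrable lborel (\<lambda>x. (A' x q - \<i> * A' x (\<i> *s q)) * cnj (g x))"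
    and "integral\<^sup>L lborel (\<lambda>x. (A' x q - \<i> * A' x (\<i> *s q)) * cnj (g x)) = 0"
proof -
  define F' where "F' x v = cnj (frechet_derivative g (at x) v)" for x v
  have F: "((\<lambda>x. cnj (g x)) has_derivative F' x) (at x)" if "x \<in> K" for x
    unfolding F'_def using K(2) that by (intro has_derivative_cnj holomorphic_n_frechet(1)[OF g]) auto
  obtain L where L: "L \<ge> 0" "\<And>x v. x \<in> K \<Longrightarrow> cmod (F' x v) \<le> L * norm v"
    using holomorphic_n_derivative_bound[OF D g K] unfolding F'_def complex_mod_cnj by blast
  have ibp1: "integrable lborel (\<lambda>x. A x * F' x v + A' x v * cnj (g x))"
    and ibp2: "integral\<^sup>L lborel (\<lambda>x. A x * F' x v + A' x v * cnj (g x)) = 0" for v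
    using integration_by_parts_compact_support[OF A K(1) A' F L(2)] by blast+
  have eq: "(A' x q - \<i> * A' x (\<i> *s q)) * cnj (g x) =
      (A x * F' x q + A' x q * cnj (g x)) - \<i> * (A x * F' x (\<i> *s q) + A' x (\<i> *s q) * cnj (g x))" for x
  \<comment> \<open>On \<open>K\<close> the antilinearity of the derivative of \<open>cnj g\<close>
    cancels the two terms containing \<open>A x\<close>; off \<open>K\<close> they vanish with
    \<open>A\<close>.\<close>
  proof (cases "x \<in> K")
    case True
    then have "F' x (\<i> *s q) = - \<i> * F' x q"
      unfolding F'_def using K(2) by (subst holomorphic_n_frechet(2)[OF g]) auto
    then show ?thesis by (simp add: algebra_simps)
  next
    case False
    then show ?thesis using A(2) by (simp add: algebra_simps)
  qed
  have ibp3: "integrable lborel (\<lambda>x. \<i> * (A x * F' x (\<i> *s q) + A' x (\<i> *s q) * cnj (g x)))"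
    by (rule integrable_mult_right) (rule ibp1)
  show "integrable lborel (\<lambda>x. (A' x q - \<i> * A' x (\<i> *s q)) * cnj (g x))"
    unfolding eq by (rule Bochner_Integration.integrable_diff[OF ibp1 ibp3])
  show "integral\<^sup>L lborel (\<lambda>x. (A' x q - \<i> * A' x (\<i> *s q)) * cnj (g x)) = 0"
    unfolding eq Bochner_Integration.integral_diff[OF ibp1 ibp3] integral_mult_right_zero ibp2 by simp
qed

text \<open>A \<open>C\<^sup>1\<close> regularisation of the identity on the positive axis that vanishes on \<open>(0, d]\<close>
  and whose derivative stays in \<open>[0, 1]\<close>.\<close>
definition trunc :: "real \<Rightarrow> real \<Rightarrow> real" where
  "trunc d t = (max 0 (t - d))\<^sup>2 / t"

definition trunc_deriv :: "real \<Rightarrow> real \<Rightarrow> real" where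
  "trunc_deriv d t = 2 * (max 0 (t - d) / t) - (max 0 (t - d) / t)\<^sup>2"

lemma trunc_zero: "t \<le> d \<Longrightarrow> trunc d t = 0" "t \<le> d \<Longrightarrow> trunc_deriv d t = 0"
  by (simp_all add: trunc_def trunc_deriv_def)

lemma has_real_derivative_trunc:
  assumes "t > 0" shows "(trunc d has_real_derivative trunc_deriv d t) (at t)"
proof -
  have "((\<lambda>t. (max 0 (t - d))\<^sup>2) has_real_derivative 2 * max 0 (t - d)) (at t)"
  proof -
    have "((\<lambda>t. t - d) has_real_derivative 1) (at t)" by (auto intro!: derivative_eq_intros)
    from DERIV_chain2[OF has_real_derivative_pos_part_square this] show ?thesis by simp
  qed
  from DERIV_divide[OF this DERIV_ident]
  have "((\<lambda>t. (max 0 (t - d))\<^sup>2 / t) has_real_derivative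
      (2 * max 0 (t - d) * t - (max 0 (t - d))\<^sup>2 * 1) / (t * t)) (at t)" using assms by simp
  also have "(2 * max 0 (t - d) * t - (max 0 (t - d))\<^sup>2 * 1) / (t * t) = trunc_deriv d t"
    using assms by (simp add: trunc_deriv_def diff_divide_distrib power2_eq_square)
  finally show ?thesis unfolding trunc_def[abs_def] .
qed

text \<open>In terms of \<open>q = max 0 (t - d) / t\<close>, a number between 0 and 1, the two
  functions are \<open>q\<^sup>2 * t\<close> and \<open>1 - (1 - q)\<^sup>2\<close>.\<close>

lemma trunc_bounds:
  assumes "t > 0" "d \<ge> 0"
  shows "0 \<le> trunc d t" "trunc d t \<le> t" "0 \<le> trunc_deriv d t" "trunc_deriv d t \<le> 1"
proof -
  define q where "q = max 0 (t - d) / t"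
  have q: "0 \<le> q" "q \<le> 1" using assms by (auto simp: q_def field_simps)
  have "trunc d t = q\<^sup>2 * t" using assms by (simp add: trunc_def q_def power_divide power2_eq_square)
  moreover have "q\<^sup>2 \<le> 1" using q by (simp add: power_le_one)
  ultimately show "0 \<le> trunc d t" "trunc d t \<le> t"
    using assms mult_right_mono[of "q\<^sup>2" 1 t] by auto
  have "trunc_deriv d t = 1 - (1 - q)\<^sup>2"
    by (simp add: trunc_deriv_def q_def[symmetric] power2_eq_square algebra_simps)
  moreover have "0 \<le> (1 - q)\<^sup>2" "(1 - q)\<^sup>2 \<le> 1" using q by (auto simp: power_le_one)
  ultimately show "0 \<le> trunc_deriv d t" "trunc_deriv d t \<le> 1" by linarith+
qed

lemma trunc_tendsto:
  assumes "t > 0" "d \<longlonglongrightarrow> 0"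
  shows "(\<lambda>n. trunc (d n) t) \<longlonglongrightarrow> t" "(\<lambda>n. trunc_deriv (d n) t) \<longlonglongrightarrow> 1"
proof -
  have "(\<lambda>n. (max 0 (t - d n))\<^sup>2 / t) \<longlonglongrightarrow> (max 0 (t - 0))\<^sup>2 / t"
    using assms by (intro tendsto_intros) auto
  then show "(\<lambda>n. trunc (d n) t) \<longlonglongrightarrow> t"
    using assms by (simp add: trunc_def power2_eq_square)
  have "(\<lambda>n. 2 * (max 0 (t - d n) / t) - (max 0 (t - d n) / t)\<^sup>2)
     \<longlonglongrightarrow> 2 * (max 0 (t - 0) / t) - (max 0 (t - 0) / t)\<^sup>2"
    using assms by (intro tendsto_intros) auto
  then show "(\<lambda>n. trunc_deriv (d n) t) \<longlonglongrightarrow> 1"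
    using assms by (simp add: trunc_deriv_def)
qed

section \<open>Cut-off, truncation and the orthogonal function\<close>

context farthest_point
begin

text \<open>Half of \<open>S\<close>, so that a point in the support of the cut-off can be pushed by
  another \<open>rad\<close> and remain where \<open>\<rho>\<close> is controlled.\<close>

definition rad :: real where "rad = S / 2"

definition cut :: "complex^'n \<Rightarrow> real" where "cut z = bump rad (z - p) / rad ^ 4"

definition cut' :: "complex^'n \<Rightarrow> complex^'n \<Rightarrow> real" where "cut' z v = bump_deriv rad (z - p) v / rad ^ 4"

lemma rad_pos: "rad > 0" and rad_le: "rad \<le> S"
  using S by (auto simp: rad_def)

lemma has_derivative_cut: "(cut has_derivative cut' z) (at z)"
proof -
  have "((\<lambda>z. z - p) has_derivative (\<lambda>v. v)) (at z)"
    by (auto intro!: derivative_eq_intros)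
  from has_derivative_compose[OF this has_derivative_bump]
  have "((\<lambda>z. bump rad (z - p)) has_derivative bump_deriv rad (z - p)) (at z)" .
  from has_derivative_mult_left[OF this, of "inverse (rad ^ 4)"]
  show ?thesis unfolding cut_def[abs_def] cut'_def[abs_def] divide_inverse .
qed

lemma cut_nonneg: "cut z \<ge> 0" and cut_le: "cut z \<le> 1"
  using bump_nonneg[of rad "z - p"] bump_le[of rad "z - p"] rad_pos by (auto simp: cut_def)

lemma cut'_bound: "\<bar>cut' z v\<bar> \<le> 4 / rad * norm v"
proof -
  have "\<bar>cut' z v\<bar> = \<bar>bump_deriv rad (z - p) v\<bar> / rad ^ 4" using rad_pos by (simp add: cut'_def)
  also have "\<dots> \<le> (4 * rad ^ 3 * norm v) / rad ^ 4"
    using bump_deriv_bound[of rad] rad_pos by (intro divide_right_mono) auto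
  also have "\<dots> = 4 / rad * norm v" using rad_pos by (simp add: field_simps power_numeral_reduce)
  finally show ?thesis .
qed

lemma cut_outside: "z \<notin> cball p rad \<Longrightarrow> cut z = 0"
  using bump_outside[of rad "z - p"] rad_pos by (simp add: cut_def dist_norm norm_minus_commute)

lemma cut'_outside: "z \<notin> cball p rad \<Longrightarrow> cut' z v = 0"
  using has_derivative_zero_off_support[OF has_derivative_cut closed_cball _ cut_outside] by metis

text \<open>A Lipschitz bound from \<open>cut p = 1\<close>. It holds on the whole space, so it also
  absorbs the logarithm where the cut-off has vanished.\<close>

lemma one_minus_cut: "\<bar>1 - cut z\<bar> \<le> 4 / rad * norm (z - p)"
proof -
  have "norm (cut p - cut z) \<le> 4 / rad * norm (p - z)"
    by (rule lipschitz_of_derivative_bound[of UNIV _ cut']) (simp_all only: real_norm_def UNIV_I convex_UNIV has_derivative_cut cut'_bound)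
  moreover have "cut p = 1" using rad_pos by (simp add: cut_def bump_def)
  ultimately show ?thesis by (simp add: norm_minus_commute)
qed

lemma \<rho>_lipschitz:
  assumes "x \<in> cball p S" "y \<in> cball p S" shows "\<bar>\<rho> x - \<rho> y\<bar> \<le> L * norm (x - y)"
  using lipschitz_of_derivative_bound[OF convex_cball der _ assms, of L] bnd by simp

lemma \<rho>_le: "z \<in> cball p S \<Longrightarrow> \<bar>\<rho> z\<bar> \<le> L * norm (z - p)"
  using \<rho>_lipschitz[of z p] zero S by simp

text \<open>Moving from \<open>z\<close> in the direction \<open>p\<close> by \<open>Re (peak p z)\<close> reaches the supporting hyperplane at \<open>p\<close>.\<close>
lemma \<rho>_le_peak:
  assumes z: "z \<in> cball p rad" "z \<in> D"
  shows "\<bar>\<rho> z\<bar> \<le> L * (norm p * Re (peak p z))"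
proof -
  define t where "t = Re (peak p z)"
  have t: "t > 0" unfolding t_def by (rule Re_peak_pos[OF p0 lt[OF z(2)]])
  have pp: "(norm p)\<^sup>2 > 0" using p0 by simp
  define y where "y = z + t *\<^sub>R p"
  have tR: "t * (norm p)\<^sup>2 = p \<bullet> p - z \<bullet> p"
    using pp by (simp add: t_def Re_peak field_simps power2_norm_eq_inner)
  have yp: "y \<bullet> p = (norm p)\<^sup>2"
    using tR by (simp add: y_def inner_add_left power2_norm_eq_inner)
  have "t * (norm p)\<^sup>2 = (p - z) \<bullet> p" using tR by (simp add: inner_diff_left)
  also have "\<dots> \<le> norm (z - p) * norm p"
    using norm_cauchy_schwarz[of "p - z" p] by (simp add: norm_minus_commute)
  finally have tp: "t * norm p \<le> norm (z - p)" using p0 by (simp add: power2_eq_square)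
  have "norm p * norm p \<le> norm y * norm p"
    using norm_cauchy_schwarz[of y p] yp by (simp add: power2_eq_square)
  then have "norm p \<le> norm y" using p0 by simp
  then have yD: "y \<notin> D" using lt by fastforce
  have "norm (y - p) \<le> norm (z - p) + norm (t *\<^sub>R p)"
    unfolding y_def using norm_triangle_ineq[of "z - p" "t *\<^sub>R p"] by (simp add: algebra_simps)
  also have "\<dots> \<le> rad + rad" using tp t z(1) by (simp add: dist_norm norm_minus_commute)
  finally have yS: "y \<in> cball p S" by (simp add: rad_def dist_norm norm_minus_commute)
  have zS: "z \<in> cball p S" using z(1) rad_le by auto
  \<comment> \<open>\<open>\<rho>\<close> changes sign between \<open>z\<close> and
    \<open>y\<close>, so its modulus at \<open>z\<close> is at most the increment, which the
    Lipschitz bound controls by the distance moved.\<close>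
  have "\<rho> y \<ge> 0" using D_eq[OF yS] yD by auto
  moreover have "\<rho> z < 0" using D_eq[OF zS] z(2) by auto
  moreover have "\<bar>\<rho> y - \<rho> z\<bar> \<le> L * norm (y - z)" by (rule \<rho>_lipschitz[OF yS zS])
  moreover have "norm (y - z) = norm p * t" using t by (simp add: y_def)
  ultimately show ?thesis by (simp add: t_def)
qed

text \<open>The truncated form of \<open>u\<close>. It vanishes off the compact set
  \<open>K d\<close> below, which lies in \<open>D\<close> for \<open>d > 0\<close>.\<close>

definition A :: "real \<Rightarrow> real \<Rightarrow> complex^'n \<Rightarrow> complex" where
  "A d e z = of_real (cut z * trunc d (- \<rho> z)) * log_peak e p z"

definition A' :: "real \<Rightarrow> real \<Rightarrow> complex^'n \<Rightarrow> complex^'n \<Rightarrow> complex" where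
  "A' d e z v = of_real (cut z * trunc d (- \<rho> z)) * log_peak_deriv e p z v +
     of_real (cut z * (trunc_deriv d (- \<rho> z) * (- \<rho>' z v)) + cut' z v * trunc d (- \<rho> z)) * log_peak e p z"

text \<open>The limit of \<^term>\<open>A'\<close> as \<open>d \<rightarrow> 0\<close>, that is, the derivative of \<open>- cut \<cdot> \<rho> \<cdot> log_peak\<close>.\<close>
definition T :: "real \<Rightarrow> complex^'n \<Rightarrow> complex^'n \<Rightarrow> complex" where
  "T e z v = of_real (cut z * (- \<rho> z)) * log_peak_deriv e p z v +
     of_real (cut z * (- \<rho>' z v) + cut' z v * (- \<rho> z)) * log_peak e p z"

definition K :: "real \<Rightarrow> (complex^'n) set" where
  "K d = cball p rad \<inter> \<rho> -` {.. - d}"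

lemma rad_cball: "z \<in> cball p rad \<Longrightarrow> z \<in> cball p S"
  using rad_le by auto

lemma compact_K: "compact (K d)"
proof -
  have "continuous_on (cball p rad) \<rho>"
    by (meson der rad_cball continuous_at_imp_continuous_on has_derivative_continuous)
  then have "closed (K d)" unfolding K_def by (rule continuous_closed_preimage) auto
  moreover have "bounded (K d)" unfolding K_def by (rule bounded_subset[OF bounded_cball]) blast
  ultimately show ?thesis by (simp add: compact_eq_bounded_closed)
qed

lemma K_subset: "d > 0 \<Longrightarrow> K d \<subseteq> D"
  using D_eq rad_cball by (fastforce simp: K_def)

lemma neg_\<rho>_pos: "z \<in> cball p rad \<Longrightarrow> z \<in> D \<Longrightarrow> - \<rho> z > 0"
  using D_eq[of z] rad_cball[of z] by auto

lemma A_outside: "z \<notin> K d \<Longrightarrow> A d e z = 0"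
  using cut_outside[of z] trunc_zero[of "- \<rho> z" d] by (auto simp: K_def A_def)

lemma A'_outside: "z \<notin> K d \<Longrightarrow> A' d e z v = 0"
  using cut_outside[of z] cut'_outside[of z v] trunc_zero[of "- \<rho> z" d] by (auto simp: K_def A'_def)

lemma has_derivative_A:
  assumes d: "d > 0" and e: "e \<ge> 0"
  shows "(A d e has_derivative A' d e z) (at z)"
proof (cases "z \<in> K d")
  case True
  then have z: "z \<in> cball p rad" "z \<in> D" "- \<rho> z > 0" using K_subset[OF d] d by (auto simp: K_def)
  have "((\<lambda>z. - \<rho> z) has_derivative (\<lambda>v. - \<rho>' z v)) (at z)"
    by (intro has_derivative_minus der rad_cball z)
  from has_derivative_compose[OF this has_real_derivative_trunc[OF z(3), unfolded has_field_derivative_def]]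
  have "((\<lambda>z. trunc d (- \<rho> z)) has_derivative (\<lambda>v. trunc_deriv d (- \<rho> z) * (- \<rho>' z v))) (at z)" .
  from has_derivative_of_real[OF has_derivative_mult[OF has_derivative_cut this]]
  have "((\<lambda>z. complex_of_real (cut z * trunc d (- \<rho> z))) has_derivative (\<lambda>v. of_real (cut z *
     (trunc_deriv d (- \<rho> z) * (- \<rho>' z v)) + cut' z v * trunc d (- \<rho> z)))) (at z)" .
  from has_derivative_mult[OF this has_derivative_log_peak[OF p0 lt[OF z(2)] e]]
  show ?thesis unfolding A_def[abs_def] A'_def[abs_def] .
next
  case False
  have "((\<lambda>z. 0) has_derivative (\<lambda>v. 0)) (at z)" by simp
  then have "(A d e has_derivative (\<lambda>v. 0)) (at z)"
    by (rule has_derivative_transform_within_open[of _ _ _ _ "- K d"])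
       (use False compact_imp_closed[OF compact_K] A_outside in auto)
  moreover have "A' d e z = (\<lambda>v. 0)" using A'_outside[OF False] by auto
  ultimately show ?thesis by simp
qed

text \<open>A bound independent of \<open>d\<close> that blows up as \<open>e\<close> tends to 0; it
  serves only to dominate the limit in \<open>d\<close> for fixed \<open>e\<close>.\<close>

definition Cb :: "real \<Rightarrow> real" where
  "Cb e = L / norm p / e + (L + 4 / rad * L) * (3 + pi + 2 / sqrt e)"

lemma log_peak_bounded:
  assumes z: "z \<in> D" and e: "0 < e" "e \<le> 1"
  shows "cmod (log_peak e p z) \<le> 3 + pi + 2 / sqrt e"
  unfolding log_peak_def
proof (rule norm_Ln_le)
  show "sqrt e > 0" using e by simp
  have "(sqrt e)\<^sup>2 \<le> Re (of_real e + peak p z)" using e Re_peak_pos[OF p0 lt[OF z]] by simp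
  also have "\<dots> \<le> cmod (of_real e + peak p z)" by (rule complex_Re_le_cmod)
  finally show "(sqrt e)\<^sup>2 \<le> cmod (of_real e + peak p z)" .
  show "cmod (of_real e + peak p z) \<le> 3"
    using norm_triangle_ineq[of "of_real e" "peak p z"] norm_peak_le[OF p0 less_imp_le[OF lt[OF z]]] e by simp
qed

lemma A'_bound:
  assumes z: "z \<in> D" and d: "d > 0" and e: "0 < e" "e \<le> 1"
  shows "cmod (A' d e z v) \<le> Cb e * norm v"
proof (cases "z \<in> K d")
  case True
  then have zr: "z \<in> cball p rad" and pos: "- \<rho> z > 0" using d by (auto simp: K_def)
  have "norm (z - p) \<le> 1" using zr rad_le S by (simp add: dist_norm norm_minus_commute)
  then have "- \<rho> z \<le> L"
    using \<rho>_le[OF rad_cball[OF zr]] mult_left_mono[of "norm (z - p)" 1 L] L by simp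
  then have tL: "\<bar>trunc d (- \<rho> z)\<bar> \<le> L" using trunc_bounds[OF pos, of d] d by simp
  have ct: "\<bar>cut z * trunc d (- \<rho> z)\<bar> \<le> L"
    using mult_mono[OF cut_le[of z] tL] cut_nonneg[of z] by (simp add: abs_mult)
  have "\<bar>cut z * (trunc_deriv d (- \<rho> z) * (- \<rho>' z v)) + cut' z v * trunc d (- \<rho> z)\<bar>
     \<le> \<bar>cut z\<bar> * (\<bar>trunc_deriv d (- \<rho> z)\<bar> * \<bar>\<rho>' z v\<bar>) + \<bar>cut' z v\<bar> * \<bar>trunc d (- \<rho> z)\<bar>"
    by (rule order_trans[OF abs_triangle_ineq]) (simp only: abs_mult abs_minus_cancel order_refl)
  also have "\<dots> \<le> 1 * (1 * (L * norm v)) + (4 / rad * norm v) * L"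
    using trunc_bounds[OF pos, of d] d cut_nonneg[of z] cut_le[of z] bnd[OF rad_cball[OF zr], of v]
      cut'_bound[of z v] tL L rad_pos
    by (intro add_mono mult_mono) auto
  finally have P': "\<bar>cut z * (trunc_deriv d (- \<rho> z) * (- \<rho>' z v)) + cut' z v * trunc d (- \<rho> z)\<bar>
    \<le> (L + 4 / rad * L) * norm v" by (simp add: algebra_simps)
  have "cmod (log_peak_deriv e p z v) \<le> norm v / norm p / (e + Re (peak p z))"
    using norm_log_peak_deriv_le[OF p0 lt[OF z]] e by simp
  also have "\<dots> \<le> norm v / norm p / e"
    using e Re_peak_pos[OF p0 lt[OF z]] by (intro divide_left_mono) auto
  finally have h': "cmod (log_peak_deriv e p z v) \<le> norm v / norm p / e" .
  have "cmod (A' d e z v) \<le> \<bar>cut z * trunc d (- \<rho> z)\<bar> * cmod (log_peak_deriv e p z v) +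
     \<bar>cut z * (trunc_deriv d (- \<rho> z) * (- \<rho>' z v)) + cut' z v * trunc d (- \<rho> z)\<bar> * cmod (log_peak e p z)"
    unfolding A'_def by (rule order_trans[OF norm_triangle_ineq]) (simp only: norm_mult norm_of_real order_refl)
  also have "\<dots> \<le> L * (norm v / norm p / e) + ((L + 4 / rad * L) * norm v) * (3 + pi + 2 / sqrt e)"
    using ct h' P' log_peak_bounded[OF z e] L rad_pos e by (intro add_mono mult_mono) auto
  also have "\<dots> = Cb e * norm v"
  proof -
    have "L * (n / P / e) + (Y * n) * X = (L / P / e + Y * X) * n" for n P X Y :: real
      by (simp add: algebra_simps)
    then show ?thesis unfolding Cb_def .
  qed
  finally show ?thesis .
next
  case False
  have "Cb e \<ge> 0" unfolding Cb_def using L rad_pos e by (intro add_nonneg_nonneg mult_nonneg_nonneg) auto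
  then show ?thesis using A'_outside[OF False] by simp
qed

lemma A'_tendsto:
  assumes z: "z \<in> D" and d: "d \<longlonglongrightarrow> 0"
  shows "(\<lambda>n. A' (d n) e z v) \<longlonglongrightarrow> T e z v"
proof (cases "z \<in> cball p rad")
  case True
  note lims = trunc_tendsto[OF neg_\<rho>_pos[OF True z] d]
  have "(\<lambda>n. A' (d n) e z v) \<longlonglongrightarrow> of_real (cut z * (- \<rho> z)) * log_peak_deriv e p z v +
     of_real (cut z * (1 * (- \<rho>' z v)) + cut' z v * (- \<rho> z)) * log_peak e p z"
    unfolding A'_def by (intro tendsto_intros lims)
  then show ?thesis by (simp add: T_def)
next
  case False
  then show ?thesis using cut_outside[OF False] cut'_outside[OF False] by (simp add: A'_def T_def)
qed

text \<open>Twice the holomorphic derivative, in the direction \<open>p\<close>, of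
  \<open>- cut \<cdot> \<rho> \<cdot> log_peak\<close>.\<close>

definition \<Phi> :: "real \<Rightarrow> complex^'n \<Rightarrow> complex" where
  "\<Phi> e z = T e z p - \<i> * T e z (\<i> *s p)"

lemma D_lmeasurable: "D \<in> lmeasurable"
  by (rule lmeasurable_open[OF boundedD openD])

lemma D_sets: "D \<in> sets lebesgue"
  using D_lmeasurable by auto

lemma space_D: "space (lebesgue_on D) = D"
  by (simp add: space_restrict_space)

text \<open>The compactly supported case applies for every \<open>d n > 0\<close>, and the bound
  \<open>Cb e\<close> dominates the integrands by a multiple of \<open>cmod (g z)\<close>.
  Measurability of the product is inherited from the approximating functions.\<close>

lemma
  assumes e: "0 < e" "e \<le> 1" and g: "holomorphic_n g D" "integrable (lebesgue_on D) g"
  shows \<Phi>_orthogonal: "integral\<^sup>L (lebesgue_on D) (\<lambda>z. \<Phi> e z * cnj (g z)) = 0"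
    and \<Phi>_mult_measurable: "(\<lambda>z. \<Phi> e z * cnj (g z)) \<in> borel_measurable (lebesgue_on D)"
proof -
  define d where "d n = inverse (real (Suc n))" for n
  have d: "d \<longlonglongrightarrow> 0" "\<And>n. d n > 0"
    unfolding d_def using LIMSEQ_inverse_real_of_nat by auto
  define G where "G n z = (A' (d n) e z p - \<i> * A' (d n) e z (\<i> *s p)) * cnj (g z)" for n z
  have lb: "integrable lborel (G n)" "integral\<^sup>L lborel (G n) = 0" for n
  proof -
    have "cmod (A' (d n) e x v) \<le> Cb e * norm v" if "x \<in> K (d n)" for x v
      using A'_bound[OF _ d(2) e] K_subset[OF d(2)] that by blast
    note * = dbar_orthogonal_compact_support[OF has_derivative_A[OF d(2) less_imp_le[OF e(1)]] A_outside compact_K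
       K_subset[OF d(2)] openD this g(1), where q = p]
    show "integrable lborel (G n)" unfolding G_def by (rule *(1))
    show "integral\<^sup>L lborel (G n) = 0" unfolding G_def by (rule *(2))
  qed
  have zero: "G n z = 0" if "z \<notin> D" for n z
  proof -
    have "z \<notin> K (d n)" using that K_subset[OF d(2)] by blast
    then show ?thesis by (simp add: G_def A'_outside)
  qed
  have on: "integrable (lebesgue_on D) (G n)" "integral\<^sup>L (lebesgue_on D) (G n) = 0" for n
    using lborel_to_lebesgue_on[OF lb(1) zero D_sets, of n] lb(2)[of n] by auto
  have lim: "(\<lambda>n. G n z) \<longlonglongrightarrow> \<Phi> e z * cnj (g z)" if "z \<in> D" for z
    unfolding G_def \<Phi>_def by (intro tendsto_intros A'_tendsto that d)
  have meas: "G n \<in> borel_measurable (lebesgue_on D)" for n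
    using on(1) by (rule borel_measurable_integrable)
  show m: "(\<lambda>z. \<Phi> e z * cnj (g z)) \<in> borel_measurable (lebesgue_on D)"
    by (rule borel_measurable_LIMSEQ_metric[where f = G, OF meas]) (simp add: lim space_D)
  have "(\<lambda>n. integral\<^sup>L (lebesgue_on D) (G n)) \<longlonglongrightarrow> integral\<^sup>L (lebesgue_on D) (\<lambda>z. \<Phi> e z * cnj (g z))"
  proof (rule integral_dominated_convergence[where s = G, OF m meas])
    show "integrable (lebesgue_on D) (\<lambda>z. 2 * (Cb e * norm p) * cmod (g z))" using g(2) by simp
    show "AE z in lebesgue_on D. (\<lambda>n. G n z) \<longlonglongrightarrow> \<Phi> e z * cnj (g z)"
      by (rule AE_I2) (simp add: lim space_D)
    show "AE z in lebesgue_on D. norm (G n z) \<le> 2 * (Cb e * norm p) * cmod (g z)" for n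
    proof (rule AE_I2)
      fix z assume "z \<in> space (lebesgue_on D)"
      then have z: "z \<in> D" by (simp add: space_D)
      have "cmod (A' (d n) e z p - \<i> * A' (d n) e z (\<i> *s p)) \<le> cmod (A' (d n) e z p) + cmod (A' (d n) e z (\<i> *s p))"
        by (rule order_trans[OF norm_triangle_ineq4]) (simp add: norm_mult)
      also have "\<dots> \<le> 2 * (Cb e * norm p)"
        using A'_bound[OF z d(2) e, of n p] A'_bound[OF z d(2) e, of n "\<i> *s p"] by (simp add: norm_cscale)
      finally show "norm (G n z) \<le> 2 * (Cb e * norm p) * cmod (g z)"
        unfolding G_def norm_mult complex_mod_cnj by (rule mult_right_mono) simp
    qed
  qed
  then show "integral\<^sup>L (lebesgue_on D) (\<lambda>z. \<Phi> e z * cnj (g z)) = 0"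
    by (simp add: on(2) LIMSEQ_const_iff)
qed

text \<open>The bracket bounds the coefficient of the logarithm per unit of
  \<open>norm (z - p)\<close>: the derivative of the cut-off in the directions \<open>p\<close> and
  \<open>\<i> *s p\<close>, the deviation of the cut-off from 1, and the variation of
  \<open>\<rho>'\<close> in both directions. The last summand bounds \<open>\<rho>\<close> times the
  derivative of the logarithm. Nothing depends on \<open>e\<close>.\<close>

definition M :: real where
  "M = (8 * L / rad * norm p + 4 * \<rho>' p p / rad + 2 * L * norm p) * ((10 + 2 * pi) * norm p) + 2 * L * norm p"

lemma \<Phi>_plus_log_peak_bounded:
  assumes z: "z \<in> D" and e: "0 < e" "e \<le> 1"
  shows "cmod (\<Phi> e z + of_real (\<rho>' p p) * log_peak e p z) \<le> M"
proof -
  let ?h = "log_peak e p z" and ?c = "\<rho>' p p"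
  define H where "H = cmod ?h * norm (z - p)"
  have H: "0 \<le> H" "H \<le> (10 + 2 * pi) * norm p"
    unfolding H_def using norm_log_peak_le[OF p0 lt[OF z]] e by auto
  have ip: "norm (\<i> *s p) = norm p" by (simp add: norm_cscale)
  \<comment> \<open>The pole of the logarithmic derivative is at most the reciprocal of
    \<open>Re (peak p z)\<close> up to a factor, and \<open>\<rho>\<close> is bounded by a multiple
    of \<open>Re (peak p z)\<close>. Dropping \<open>e\<close> from the denominator makes the bound
    uniform.\<close>
  have t1: "cmod (of_real (cut z * (- \<rho> z)) * log_peak_deriv e p z v) \<le> L * norm v" for v
  proof (cases "z \<in> cball p rad")
    case True
    have w: "Re (peak p z) > 0" by (rule Re_peak_pos[OF p0 lt[OF z]])
    have "cmod (log_peak_deriv e p z v) \<le> norm v / norm p / (e + Re (peak p z))"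
      using norm_log_peak_deriv_le[OF p0 lt[OF z]] e by simp
    also have "\<dots> \<le> norm v / norm p / Re (peak p z)"
      using e w by (intro divide_left_mono) auto
    finally have h': "cmod (log_peak_deriv e p z v) \<le> norm v / norm p / Re (peak p z)" .
    have "cmod (of_real (cut z * (- \<rho> z)) * log_peak_deriv e p z v)
        = (cut z * \<bar>\<rho> z\<bar>) * cmod (log_peak_deriv e p z v)"
      using cut_nonneg[of z] by (simp add: norm_mult)
    also have "\<dots> \<le> (1 * (L * (norm p * Re (peak p z)))) * (norm v / norm p / Re (peak p z))"
      using cut_le[of z] cut_nonneg[of z] \<rho>_le_peak[OF True z] h' w L
      by (intro mult_mono) auto
    also have "\<dots> = L * norm v" using w p0 by simp
    finally show ?thesis .
  next
    case False
    then show ?thesis using cut_outside L by simp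
  qed
  \<comment> \<open>Here the factor that tames the logarithm is \<open>\<rho>\<close> itself, which
    is at most \<open>L * norm (z - p)\<close>.\<close>
  have t2: "cmod (of_real (cut' z v * (- \<rho> z)) * ?h) \<le> 4 * L / rad * norm v * H" for v
  proof (cases "z \<in> cball p rad")
    case True
    have "cmod (of_real (cut' z v * (- \<rho> z)) * ?h) = (\<bar>cut' z v\<bar> * \<bar>\<rho> z\<bar>) * cmod ?h"
      by (simp add: norm_mult)
    also have "\<dots> \<le> ((4 / rad * norm v) * (L * norm (z - p))) * cmod ?h"
      using cut'_bound[of z v] \<rho>_le[OF rad_cball[OF True]] L rad_pos
      by (intro mult_mono) auto
    also have "\<dots> = 4 * L / rad * norm v * H" by (simp add: H_def)
    finally show ?thesis .
  next
    case False
    then show ?thesis using cut'_outside L H rad_pos by simp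
  qed
  \<comment> \<open>The coefficient of the logarithm left after adding \<open>\<rho>' p p\<close>,
    apart from the terms with \<open>cut'\<close>. It vanishes at \<open>p\<close> because
    \<open>cut p = 1\<close> and \<open>\<rho>' p (\<i> *s p) = 0\<close>, and linearly so by the
    Lipschitz bounds.\<close>
  define E where "E = of_real (?c - cut z * \<rho>' z p) + \<i> * of_real (cut z * \<rho>' z (\<i> *s p))"
  have E: "cmod E \<le> (4 * ?c / rad + 2 * L * norm p) * norm (z - p)"
  proof (cases "z \<in> cball p rad")
    case True
    note zS = rad_cball[OF True]
    have 1: "\<bar>?c - \<rho>' z p\<bar> \<le> L * norm (z - p) * norm p"
      using lip[OF zS, of p] by (simp add: abs_minus_commute)
    have 2: "\<bar>\<rho>' z (\<i> *s p)\<bar> \<le> L * norm (z - p) * norm p"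
      using lip[OF zS, of "\<i> *s p"] by (simp add: grad_i norm_cscale)
    have "?c - cut z * \<rho>' z p = ?c * (1 - cut z) + cut z * (?c - \<rho>' z p)" by (simp add: algebra_simps)
    then have "\<bar>?c - cut z * \<rho>' z p\<bar> \<le> ?c * \<bar>1 - cut z\<bar> + cut z * \<bar>?c - \<rho>' z p\<bar>"
      using abs_triangle_ineq[of "?c * (1 - cut z)" "cut z * (?c - \<rho>' z p)"] grad_pos cut_nonneg[of z]
      by (simp add: abs_mult)
    also have "\<dots> \<le> ?c * (4 / rad * norm (z - p)) + 1 * (L * norm (z - p) * norm p)"
      using one_minus_cut[of z] cut_le[of z] cut_nonneg[of z] grad_pos 1 L
      by (intro add_mono mult_mono) auto
    finally have 3: "\<bar>?c - cut z * \<rho>' z p\<bar> \<le> ?c * (4 / rad * norm (z - p)) + L * norm (z - p) * norm p" by simp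
    have 4: "\<bar>cut z * \<rho>' z (\<i> *s p)\<bar> \<le> L * norm (z - p) * norm p"
      using mult_mono[OF cut_le[of z] 2] cut_nonneg[of z] by (simp add: abs_mult)
    have "cmod E \<le> \<bar>?c - cut z * \<rho>' z p\<bar> + \<bar>cut z * \<rho>' z (\<i> *s p)\<bar>"
      unfolding E_def by (rule order_trans[OF norm_triangle_ineq]) (simp only: norm_mult norm_of_real norm_ii mult_1 order_refl)
    with 3 4 show ?thesis by (simp add: algebra_simps)
  next
    case False
    have "cmod E = ?c * \<bar>1 - cut z\<bar>" using cut_outside[OF False] grad_pos by (simp add: E_def)
    also have "\<dots> \<le> ?c * (4 / rad * norm (z - p))"
      using one_minus_cut[of z] grad_pos by (intro mult_left_mono) auto
    also have "\<dots> \<le> (4 * ?c / rad + 2 * L * norm p) * norm (z - p)"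
      using L by (simp add: algebra_simps)
    finally show ?thesis .
  qed
  have eq: "\<Phi> e z + of_real ?c * ?h =
     (of_real (cut z * (- \<rho> z)) * log_peak_deriv e p z p
     - \<i> * (of_real (cut z * (- \<rho> z)) * log_peak_deriv e p z (\<i> *s p)))
     + (of_real (cut' z p * (- \<rho> z)) * ?h - \<i> * (of_real (cut' z (\<i> *s p) * (- \<rho> z)) * ?h)) + E * ?h"
    by (simp add: \<Phi>_def T_def E_def algebra_simps)
  have tri: "cmod ((a - \<i> * b) + (c - \<i> * d) + f * g) \<le> (cmod a + cmod b) + (cmod c + cmod d) + cmod f * cmod g" for a b c d f g
    using norm_triangle_ineq[of "(a - \<i> * b) + (c - \<i> * d)" "f * g"] norm_triangle_ineq[of "a - \<i> * b" "c - \<i> * d"]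
      norm_triangle_ineq4[of a "\<i> * b"] norm_triangle_ineq4[of c "\<i> * d"] by (simp add: norm_mult)
  have "cmod (\<Phi> e z + of_real ?c * ?h) \<le> (cmod (of_real (cut z * (- \<rho> z)) * log_peak_deriv e p z p)
     + cmod (of_real (cut z * (- \<rho> z)) * log_peak_deriv e p z (\<i> *s p)))
     + (cmod (of_real (cut' z p * (- \<rho> z)) * ?h) + cmod (of_real (cut' z (\<i> *s p) * (- \<rho> z)) * ?h)) + cmod E * cmod ?h"
    unfolding eq by (rule tri)
  also have "\<dots> \<le> (L * norm p + L * norm p) + (4 * L / rad * norm p * H + 4 * L / rad * norm p * H)
      + (4 * ?c / rad + 2 * L * norm p) * H"
  proof (intro add_mono)
    show "cmod E * cmod ?h \<le> (4 * ?c / rad + 2 * L * norm p) * H"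
      using mult_right_mono[OF E norm_ge_zero[of ?h]] by (simp add: H_def mult_ac)
  qed (rule t1 t2 t1[of "\<i> *s p", unfolded ip] t2[of "\<i> *s p", unfolded ip])+
  also have "\<dots> = (8 * L / rad * norm p + 4 * ?c / rad + 2 * L * norm p) * H + 2 * L * norm p"
    by (simp add: distrib_right)
  also have "\<dots> \<le> M" unfolding M_def
    using H(2) L rad_pos grad_pos by (intro add_right_mono mult_left_mono) auto
  finally show ?thesis .
qed

section \<open>The duality argument and the blow-up of the logarithm\<close>

interpretation finite_measure "lebesgue_on D"
  by (rule finite_measure_lebesgue_on[OF D_lmeasurable])

lemma sq_integrable_bounded_continuous:
  assumes "continuous_on D f" "\<And>z. z \<in> D \<Longrightarrow> cmod (f z) \<le> B"
  shows "sq_integrable (lebesgue_on D) f"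
  unfolding sq_integrable_def
proof
  show [measurable]: "f \<in> borel_measurable (lebesgue_on D)"
    by (rule continuous_imp_measurable_on_sets_lebesgue[OF assms(1) D_sets])
  show "integrable (lebesgue_on D) (\<lambda>x. (cmod (f x))\<^sup>2)"
    by (rule integrable_const_bound[where B = "B\<^sup>2"])
       (auto intro!: AE_I2 power_mono assms(2) simp: space_D)
qed

text \<open>Duality tested on a bump at \<open>a\<close> with projection \<open>k\<close>. Pairing
  \<open>h\<close> with \<open>k\<close> is pairing it with the bump, which gives
  \<open>J * h a\<close> by the mean value property, while \<open>\<Phi> e\<close> pairs to zero
  with \<open>k\<close>. Thus \<open>c * J * h a\<close> is the pairing of a function bounded by
  \<open>M\<close> with \<open>k\<close>, whose integral norm is at most \<open>C * J\<close>; the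
  factor \<open>J\<close> cancels.\<close>

lemma log_peak_bound_of_L1_bound:
  assumes C: "\<And>f g. L2_on D f \<Longrightarrow> is_bergman_projection D f g \<Longrightarrow>
      (LINT z:D|lebesgue. cmod (g z)) \<le> C * (LINT z:D|lebesgue. cmod (f z))"
    and a: "a \<in> D" and e: "0 < e" "e \<le> 1"
  shows "\<rho>' p p * cmod (log_peak e p a) \<le> M * C"
proof -
  let ?I = "\<lambda>f. integral\<^sup>L (lebesgue_on D) f"
  define h where "h = log_peak e p"
  define c where "c = \<rho>' p p"
  note conv = set_lebesgue_integral_eq_lebesgue_on[OF D_sets] and L2 = L2_on_iff_sq_integrable[OF D_sets]
  have holh: "holomorphic_n h D"
    unfolding h_def by (rule holomorphic_n_log_peak) (use p0 e lt in auto)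
  have sqh: "sq_integrable (lebesgue_on D) h"
    unfolding h_def
    by (rule sq_integrable_bounded_continuous[OF holomorphic_n_continuous_on[OF holh, unfolded h_def] log_peak_bounded[OF _ e]])
  have h: "h \<in> bergman_space D" using holh sqh by (simp add: bergman_space_def L2)
  obtain r where r: "r > 0" "cball a r \<subseteq> D" using openD a open_contains_cball by blast
  define J where "J = integral\<^sup>L lborel (bump r :: complex^'n \<Rightarrow> real)"
  have J: "J > 0" unfolding J_def by (rule integral_bump_pos[OF r(1)])
  define \<phi> where "\<phi> y = complex_of_real (bump r (y - a))" for y
  have out: "bump r (y - a) = 0" if "y \<notin> D" for y
  proof -
    have "y - a \<notin> cball 0 r" using r(2) that by (auto simp: dist_norm norm_minus_commute subset_iff)
    then show ?thesis using r by (simp add: bump_outside)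
  qed
  have sq\<phi>: "sq_integrable (lebesgue_on D) \<phi>"
  proof (rule sq_integrable_bounded_continuous)
    show "continuous_on D \<phi>" unfolding \<phi>_def
      by (intro continuous_intros continuous_on_compose2[OF continuous_on_bump[of UNIV]]) auto
    show "cmod (\<phi> z) \<le> r ^ 4" for z using bump_le[of r "z - a"] bump_nonneg[of r "z - a"] by (simp add: \<phi>_def)
  qed
  have I\<phi>: "?I (\<lambda>z. cmod (\<phi> z)) = J"
  proof -
    have m: "(bump r :: complex^'n \<Rightarrow> real) \<in> borel_measurable borel"
      by (rule borel_measurable_continuous_onI[OF continuous_on_bump])
    have "integrable lborel (bump r :: complex^'n \<Rightarrow> real)" using r by (simp add: integrable_bump)
    then have "integrable lborel (\<lambda>y. bump r (y - a))" using lborel_integral_shift(2)[OF m, of "- a"] by simp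
    from lborel_to_lebesgue_on(2)[OF this out D_sets]
    have "?I (\<lambda>y. bump r (y - a)) = J"
      using lborel_integral_shift(1)[OF m, of "- a"] by (simp add: J_def)
    moreover have "cmod (\<phi> z) = bump r (z - a)" for z using bump_nonneg[of r "z - a"] by (simp add: \<phi>_def)
    ultimately show ?thesis by simp
  qed
  have I\<phi>h: "?I (\<lambda>z. \<phi> z * cnj (h z)) = J *\<^sub>R cnj (h a)"
  proof -
    note mv = holomorphic_n_mean_value[OF openD holh r]
    have "?I (\<lambda>z. bump r (z - a) *\<^sub>R h z) = J *\<^sub>R h a"
      using lborel_to_lebesgue_on(2)[OF mv(1) _ D_sets] out mv(2) by (simp add: J_def)
    then have "cnj (?I (\<lambda>z. bump r (z - a) *\<^sub>R h z)) = J *\<^sub>R cnj (h a)" by simp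
    moreover have "\<phi> z * cnj (h z) = cnj (bump r (z - a) *\<^sub>R h z)" for z
      by (simp add: \<phi>_def scaleR_conv_of_real)
    ultimately show ?thesis by (simp only: Bochner_Integration.integral_cnj)
  qed
  obtain k where k: "is_bergman_projection D \<phi> k"
    using bergman_projection_exists[OF openD boundedD, of \<phi>] sq\<phi> by (auto simp: L2)
  then have kA: "holomorphic_n k D" "sq_integrable (lebesgue_on D) k"
    and orth: "?I (\<lambda>z. (\<phi> z - k z) * cnj (h z)) = 0"
    using h by (auto simp: is_bergman_projection_def bergman_space_def L2 conv)
  have intk: "integrable (lebesgue_on D) k" by (rule sq_integrable_imp_integrable[OF kA(2)])
  have Ik: "?I (\<lambda>z. cmod (k z)) \<le> C * J"
    using C[OF _ k] sq\<phi> I\<phi> by (simp add: L2 conv)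
  have inthk: "integrable (lebesgue_on D) (\<lambda>z. h z * cnj (k z))"
    by (rule sq_integrable_mult_cnj[OF sqh kA(2)])
  \<comment> \<open>\<open>h\<close> belongs to the Bergman space, so it does not see the difference
    between the bump and its projection.\<close>
  have Ikh: "?I (\<lambda>z. h z * cnj (k z)) = J *\<^sub>R h a"
  proof -
    have "?I (\<lambda>z. \<phi> z * cnj (h z)) - ?I (\<lambda>z. k z * cnj (h z)) = 0"
      using orth sq_integrable_mult_cnj[OF sq\<phi> sqh] sq_integrable_mult_cnj[OF kA(2) sqh]
      by (simp add: left_diff_distrib)
    then have "?I (\<lambda>z. k z * cnj (h z)) = J *\<^sub>R cnj (h a)" by (simp add: I\<phi>h)
    then have "cnj (?I (\<lambda>z. k z * cnj (h z))) = J *\<^sub>R h a" by simp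
    moreover have "h z * cnj (k z) = cnj (k z * cnj (h z))" for z by simp
    ultimately show ?thesis by (simp only: Bochner_Integration.integral_cnj)
  qed
  have cpos: "c > 0" unfolding c_def by (rule grad_pos)
  have bound: "cmod (\<Phi> e z + c * h z) \<le> M" if "z \<in> D" for z
    using \<Phi>_plus_log_peak_bounded[OF that e] by (simp add: c_def h_def)
  \<comment> \<open>\<open>\<Phi> e\<close> alone is bounded here with a constant growing as
    \<open>e\<close> tends to 0. This is used for integrability only; the uniform bound
    \<open>M\<close> belongs to the sum with \<open>c * h\<close>.\<close>
  have int\<Phi>: "integrable (lebesgue_on D) (\<lambda>z. \<Phi> e z * cnj (k z))"
  proof (rule Bochner_Integration.integrable_bound)
    let ?B = "M + c * (3 + pi + 2 / sqrt e)"
    show "integrable (lebesgue_on D) (\<lambda>z. ?B * cmod (k z))" using intk by simp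
    show "(\<lambda>z. \<Phi> e z * cnj (k z)) \<in> borel_measurable (lebesgue_on D)"
      by (rule \<Phi>_mult_measurable[OF e kA(1) intk])
    show "AE z in lebesgue_on D. norm (\<Phi> e z * cnj (k z)) \<le> norm (?B * cmod (k z))"
    proof (rule AE_I2)
      fix z assume "z \<in> space (lebesgue_on D)"
      then have z: "z \<in> D" by (simp add: space_D)
      have "c * cmod (h z) \<le> c * (3 + pi + 2 / sqrt e)"
        using log_peak_bounded[OF z e] cpos by (intro mult_left_mono) (auto simp: h_def)
      moreover have "cmod (\<Phi> e z) \<le> cmod (\<Phi> e z + c * h z) + c * cmod (h z)"
        using norm_triangle_ineq4[of "\<Phi> e z + c * h z" "c * h z"] cpos by (simp add: norm_mult)
      ultimately have "cmod (\<Phi> e z) \<le> ?B" using bound[OF z] by linarith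
      then have "cmod (\<Phi> e z) * cmod (k z) \<le> ?B * cmod (k z)" by (intro mult_right_mono) auto
      then show "norm (\<Phi> e z * cnj (k z)) \<le> norm (?B * cmod (k z))"
        unfolding norm_mult complex_mod_cnj real_norm_def by linarith
    qed
  qed
  have intF: "integrable (lebesgue_on D) (\<lambda>z. \<Phi> e z * cnj (k z) + c * (h z * cnj (k z)))"
    by (intro Bochner_Integration.integrable_add int\<Phi> integrable_mult_right inthk)
  have "?I (\<lambda>z. \<Phi> e z * cnj (k z) + c * (h z * cnj (k z))) = ?I (\<lambda>z. \<Phi> e z * cnj (k z)) + c * ?I (\<lambda>z. h z * cnj (k z))"
    using int\<Phi> inthk by simp
  also have "\<dots> = c * (J *\<^sub>R h a)"
    by (simp add: \<Phi>_orthogonal[OF e kA(1) intk] Ikh)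
  finally have "c * J * cmod (h a) = cmod (?I (\<lambda>z. \<Phi> e z * cnj (k z) + c * (h z * cnj (k z))))"
    using cpos J by (simp add: norm_mult)
  also have "\<dots> \<le> ?I (\<lambda>z. M * cmod (k z))"
  proof (rule Bochner_Integration.integral_norm_bound_integral[OF intF])
    show "integrable (lebesgue_on D) (\<lambda>z. M * cmod (k z))" using intk by simp
    fix z assume "z \<in> space (lebesgue_on D)"
    then have z: "z \<in> D" by (simp add: space_D)
    have "\<Phi> e z * cnj (k z) + c * (h z * cnj (k z)) = (\<Phi> e z + c * h z) * cnj (k z)" by (simp add: algebra_simps)
    then show "cmod (\<Phi> e z * cnj (k z) + c * (h z * cnj (k z))) \<le> M * cmod (k z)"
      using mult_right_mono[OF bound[OF z] norm_ge_zero[of "k z"]] by (simp add: norm_mult)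
  qed
  also have "\<dots> = M * ?I (\<lambda>z. cmod (k z))" by simp
  also have "\<dots> \<le> M * (C * J)"
  proof (intro mult_left_mono Ik)
    show "M \<ge> 0" using bound[OF a] norm_ge_zero order_trans by blast
  qed
  finally have "(c * cmod (h a)) * J \<le> (M * C) * J" by (simp add: mult_ac)
  then show ?thesis using J by (simp add: c_def h_def)
qed

lemma log_peak_unbounded:
  obtains a e where "a \<in> D" "0 < e" "e \<le> 1" "cmod (log_peak e p a) > B"
proof -
  \<comment> \<open>Near \<open>p\<close> the argument of the logarithm is smaller than
    \<open>2 * e\<close>, one \<open>e\<close> from the shift and one from \<open>peak\<close>. Half
    of the exponential therefore pushes the real part of the logarithm below
    \<open>- \<bar>B\<bar> - 1\<close>.\<close>
  define e where "e = min (1/2) (exp (- \<bar>B\<bar> - 1) / 2)"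
  have "e \<le> 1 / 2" unfolding e_def by (rule min.cobounded1)
  moreover have "0 < e" by (simp add: e_def)
  ultimately have e: "0 < e" "e \<le> 1" by simp_all
  have "continuous_on UNIV (peak p)" unfolding peak_def
    by (intro continuous_intros linear_continuous_on[OF bounded_linear_cdot]) (use p0 in auto)
  then have "isCont (peak p) p" by (simp add: continuous_on_eq_continuous_at)
  moreover have "peak p p = 0" using p0 by (simp add: peak_def cdot_self)
  ultimately obtain d where d: "d > 0" "\<And>z. dist z p < d \<Longrightarrow> cmod (peak p z) < e"
    using e(1) unfolding continuous_at_eps_delta by (force simp: dist_norm)
  obtain a where a: "a \<in> D" "dist a p < d"
    using p_closure d(1) closure_approachable[of p D] by auto
  define x where "x = of_real e + peak p a"
  have "Re x > 0" using Re_peak_pos[OF p0 lt[OF a(1)]] e by (simp add: x_def)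
  then have x0: "x \<noteq> 0" by auto
  have "cmod x < e + e"
    unfolding x_def using norm_triangle_ineq[of "of_real e" "peak p a"] d(2)[OF a(2)] e by simp
  also have "\<dots> \<le> exp (- \<bar>B\<bar> - 1)" by (auto simp: e_def min_def)
  finally have "ln (cmod x) < ln (exp (- \<bar>B\<bar> - 1))" using x0 by (subst ln_less_cancel_iff) auto
  then have "Re (Ln x) < - \<bar>B\<bar> - 1" using x0 by simp
  then have "cmod (Ln x) > B" using abs_Re_le_cmod[of "Ln x"] by linarith
  then show ?thesis using that[OF a(1) e] by (simp add: log_peak_def x_def)
qed

end

theorem theorem1p1:
  fixes D :: "(complex^'n) set"
  assumes "open D" and "connected D" and "D \<noteq> {}" and "bounded D"
    and "smoothly_bounded D"
  shows "\<not> (\<exists>C::real. \<forall>f g. L2_on D f \<longrightarrow> is_bergman_projection D f g \<longrightarrow>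
            (LINT z:D|lebesgue. cmod (g z)) \<le> C * (LINT z:D|lebesgue. cmod (f z)))"
proof
  assume "\<exists>C::real. \<forall>f g. L2_on D f \<longrightarrow> is_bergman_projection D f g \<longrightarrow>
            (LINT z:D|lebesgue. cmod (g z)) \<le> C * (LINT z:D|lebesgue. cmod (f z))"
  then obtain C where C: "\<And>f g. L2_on D f \<Longrightarrow> is_bergman_projection D f g \<Longrightarrow>
            (LINT z:D|lebesgue. cmod (g z)) \<le> C * (LINT z:D|lebesgue. cmod (f z))" by blast
  obtain p \<rho> \<rho>' S L where "farthest_point D p \<rho> \<rho>' S L"
    using smoothly_bounded_farthest_point[OF assms(1,3,4,5)] by blast
  then interpret farthest_point D p \<rho> \<rho>' S L .
  \<comment> \<open>\<open>M\<close>, \<open>C\<close> and \<open>\<rho>' p p\<close> depend on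
    neither \<open>a\<close> nor \<open>e\<close>, so the quotient is a legitimate bound to be
    exceeded.\<close>
  obtain a e where a: "a \<in> D" "0 < e" "e \<le> 1" "cmod (log_peak e p a) > M * C / \<rho>' p p"
    using log_peak_unbounded by blast
  then have "M * C < \<rho>' p p * cmod (log_peak e p a)"
    using grad_pos by (simp add: field_simps)
  moreover have "\<rho>' p p * cmod (log_peak e p a) \<le> M * C"
    by (rule log_peak_bound_of_L1_bound[OF C a(1,2,3)])
  ultimately show False by linarith
qed

end
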